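(* The center of $\mathcal{H}_n(G)$ consists exactly of the (finite) sums $$z=\sum_{\underline{i}\in\mathcal{I},\ \alpha\in\mathbb{Z}_+^n} d_{\underline{i},\alpha}\,x^{\alpha}\,\overline{C_{\underline{i}}},\qquad d_{\underline{i},\alpha}\in\mathbb{F},$$ whose coefficients are $S_n$-invariant, i.e. $d_{w\underline{i},w\alpha}=d_{\underline{i},\alpha}$ for all $w\in S_n$, $\underline{i}\in\mathcal{I}$ and $\alpha\in\mathbb{Z}_+^n$.
   Context: Let $\mathbb{F}$ be an algebraically closed field of characteristic $p\ge 0$, $G$ a finite group, $n\ge 1$. $S_n$ acts on $G^n$ by ${}^{w}(g_1,\ldots,g_n)=(g_{w^{-1}(1)},\ldots,g_{w^{-1}(n)})$. For $g\in G$, $g^{(i)}\in G^n$ has $g$ in the $i$-th factor and $1$ elsewhere; $t_{ij}=\sum_{h\in G}h^{(i)}(h^{-1})^{(j)}\in\mathbb{F}G^n$ for $i<j$. The wreath Hecke algebra $\mathcal{H}_n(G)$ is the associative unital $\mathbb{F}$-algebra generated by $G^n$, $s_1,\ldots,s_{n-1}$, $x_1,\ldots,x_n$ subject to the relations of the group $G^n$ and: $x_ix_j=x_jx_i$; $x_ig=gx_i$ for $g\in G^n$; $s_i^2=1$, $s_is_j=s_js_i$ if $|i-j|>1$, $s_is_{i+1}s_i=s_{i+1}s_is_{i+1}$; $s_ix_i=x_{i+1}s_i-t_{i,i+1}$; $s_ix_j=x_js_i$ for $j\ne i,i+1$; $s_ig={}^{s_i}g\,s_i$ for $g\in G^n$.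 The elements $x^\alpha g w$ ($\alpha\in\mathbb{Z}_+^n$, $x^\alpha=x_1^{\alpha_1}\cdots x_n^{\alpha_n}$, $g\in G^n$, $w\in S_n$) form a basis of $\mathcal{H}_n(G)$. Let $C_1,\ldots,C_s$ be the conjugacy classes of $G$ and $\mathcal{I}=\{\underline{i}=(i_1,\ldots,i_n)\mid 1\le i_1,\ldots,i_n\le s\}$. $S_n$ acts by $w\underline{i}=(i_{w^{-1}1},\ldots,i_{w^{-1}n})$ on $\mathcal{I}$ and by $w\alpha=(\alpha_{w^{-1}1},\ldots,\alpha_{w^{-1}n})$ on $\mathbb{Z}_+^n$. For $\underline{i}\in\mathcal{I}$, $C_{\underline{i}}=\{(g_1,\ldots,g_n)\in G^n\mid g_k\in C_{i_k},\ 1\le k\le n\}$ and $\overline{C_{\underline{i}}}=\sum_{g\in C_{\underline{i}}}g\in\mathbb{F}G^n\subset\mathcal{H}_n(G)$. *)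

theory Defs
  imports
    "HOL-Algebra.Algebra"
    "HOL-Combinatorics.Permutations"
    "HOL-Library.Poly_Mapping"
    "HOL-Computational_Algebra.Polynomial"
begin

section \<open>Free associative algebras\<close>

text \<open>Words form the free monoid, written additively because the product on
  \<open>'b \<Rightarrow>\<^sub>0 'f\<close> is convolution over an additive (here noncommutative) monoid \<open>'b\<close>.
  Hence \<open>'a word \<Rightarrow>\<^sub>0 'f\<close> is the free associative unital algebra on the letters \<open>'a\<close>.\<close>

datatype 'a word = Word (letters: "'a list")

instantiation word :: (type) monoid_add
begin

definition "0 = Word []"

definition "u + v = Word (letters u @ letters v)"

instance
  by standard (simp_all add: zero_word_def plus_word_def)

end

lemma letters_zero [simp]: "letters 0 = []"
  by (simp add: zero_word_def)

lemma letters_plus [simp]: "letters (u + v) = letters u @ letters v"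
  by (simp add: plus_word_def)

definition free_algebra :: "'a set \<Rightarrow> ('a word \<Rightarrow>\<^sub>0 'f::field) ring" where
  "free_algebra A =
    \<lparr>carrier = {p. \<forall>w \<in> Poly_Mapping.keys p. set (letters w) \<subseteq> A},
     monoid.mult = (*), one = 1, ring.zero = 0, ring.add = (+)\<rparr>"

lemma free_algebra_ops [simp]:
  "monoid.mult (free_algebra A) = (*)" "monoid.one (free_algebra A) = 1"
  "ring.zero (free_algebra A) = 0" "ring.add (free_algebra A) = (+)"
  by (simp_all add: free_algebra_def)

definition letter :: "'a \<Rightarrow> ('a word \<Rightarrow>\<^sub>0 'f::field)" where
  "letter a = Poly_Mapping.single (Word [a]) 1"

definition scalar :: "'f::field \<Rightarrow> ('a word \<Rightarrow>\<^sub>0 'f)" where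
  "scalar c = Poly_Mapping.single 0 c"

lemma free_algebra_closed:
  shows zero_free_algebra: "0 \<in> carrier (free_algebra A)"
    and one_free_algebra: "1 \<in> carrier (free_algebra A)"
    and scalar_free_algebra: "scalar c \<in> carrier (free_algebra A)"
    and letter_free_algebra: "a \<in> A \<Longrightarrow> letter a \<in> carrier (free_algebra A)"
    and uminus_free_algebra:
      "p \<in> carrier (free_algebra A) \<Longrightarrow> - p \<in> carrier (free_algebra A)"
    and plus_free_algebra:
      "\<lbrakk>p \<in> carrier (free_algebra A); q \<in> carrier (free_algebra A)\<rbrakk>
        \<Longrightarrow> p + q \<in> carrier (free_algebra A)"
    and minus_free_algebra:
      "\<lbrakk>p \<in> carrier (free_algebra A); q \<in> carrier (free_algebra A)\<rbrakk>
        \<Longrightarrow> p - q \<in> carrier (free_algebra A)"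
    and times_free_algebra:
      "\<lbrakk>p \<in> carrier (free_algebra A); q \<in> carrier (free_algebra A)\<rbrakk>
        \<Longrightarrow> p * q \<in> carrier (free_algebra A)"
proof -
  show "p * q \<in> carrier (free_algebra A)"
    if "p \<in> carrier (free_algebra A)" "q \<in> carrier (free_algebra A)"
    using that keys_mult[of p q] by (fastforce simp: free_algebra_def)
  show "p + q \<in> carrier (free_algebra A)"
    if "p \<in> carrier (free_algebra A)" "q \<in> carrier (free_algebra A)"
    using that Poly_Mapping.keys_add[of p q] by (fastforce simp: free_algebra_def)
  show "p - q \<in> carrier (free_algebra A)"
    if "p \<in> carrier (free_algebra A)" "q \<in> carrier (free_algebra A)"
    using that keys_diff[of p q] by (fastforce simp: free_algebra_def)
qed (auto simp: free_algebra_def scalar_def letter_def)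

lemma sum_free_algebra:
  "(\<And>i. i \<in> I \<Longrightarrow> f i \<in> carrier (free_algebra A)) \<Longrightarrow> sum f I \<in> carrier (free_algebra A)"
  by (induction I rule: infinite_finite_induct)
    (auto intro: zero_free_algebra plus_free_algebra)

lemma ring_free_algebra: "ring (free_algebra A :: ('a word \<Rightarrow>\<^sub>0 'f::field) ring)" (is "ring ?R")
proof (rule ringI)
  show "abelian_group ?R"
  proof (rule abelian_groupI)
    show "\<exists>y\<in>carrier ?R. y \<oplus>\<^bsub>?R\<^esub> x = \<zero>\<^bsub>?R\<^esub>"
      if "x \<in> carrier ?R" for x :: "'a word \<Rightarrow>\<^sub>0 'f"
      using uminus_free_algebra[OF that] by (intro bexI[of _ "- x"]) auto
  qed (simp_all add: plus_free_algebra zero_free_algebra add_ac)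
  show "Group.monoid ?R"
    by (rule monoidI) (simp_all add: times_free_algebra one_free_algebra mult.assoc)
qed (simp_all add: algebra_simps)


section \<open>The wreath Hecke algebra\<close>

text \<open>The left action of the symmetric group on \<open>n\<close>-tuples, which are extensional functions
  on \<open>{1..n}\<close>. It is used for \<open>G\<^sup>n\<close>, for the multi-indices and for the exponents.\<close>

definition perm_tuple :: "nat \<Rightarrow> (nat \<Rightarrow> nat) \<Rightarrow> (nat \<Rightarrow> 'a) \<Rightarrow> nat \<Rightarrow> 'a" where
  "perm_tuple n w f = (\<lambda>k\<in>{1..n}. f (inv_into UNIV w k))"

abbreviation group_power :: "('g, 'm) monoid_scheme \<Rightarrow> nat \<Rightarrow> (nat \<Rightarrow> 'g) monoid" where
  "group_power G n \<equiv> product_group {1..n} (\<lambda>_. G)"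

definition factor_emb :: "('g, 'm) monoid_scheme \<Rightarrow> nat \<Rightarrow> nat \<Rightarrow> 'g \<Rightarrow> nat \<Rightarrow> 'g" where
  "factor_emb G n i g = (\<lambda>k\<in>{1..n}. if k = i then g else \<one>\<^bsub>G\<^esub>)"

datatype 'g hecke_gen = GGen "nat \<Rightarrow> 'g" | SGen nat | XGen nat

definition hecke_gens :: "('g, 'm) monoid_scheme \<Rightarrow> nat \<Rightarrow> 'g hecke_gen set" where
  "hecke_gens G n = GGen ` carrier (group_power G n) \<union> SGen ` {1..<n} \<union> XGen ` {1..n}"

type_synonym ('g, 'f) free_hecke = "'g hecke_gen word \<Rightarrow>\<^sub>0 'f"

abbreviation gL :: "(nat \<Rightarrow> 'g) \<Rightarrow> ('g, 'f::field) free_hecke" where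
  "gL g \<equiv> letter (GGen g)"

abbreviation sL :: "nat \<Rightarrow> ('g, 'f::field) free_hecke" where
  "sL i \<equiv> letter (SGen i)"

abbreviation xL :: "nat \<Rightarrow> ('g, 'f::field) free_hecke" where
  "xL i \<equiv> letter (XGen i)"

definition tL :: "('g, 'm) monoid_scheme \<Rightarrow> nat \<Rightarrow> nat \<Rightarrow> nat \<Rightarrow> ('g, 'f::field) free_hecke" where
  "tL G n i j =
    (\<Sum>h\<in>carrier G. gL (factor_emb G n i h \<otimes>\<^bsub>group_power G n\<^esub> factor_emb G n j (inv\<^bsub>G\<^esub> h)))"

text \<open>A relation \<open>a = b\<close> is recorded as the element \<open>a - b\<close> of the free algebra.\<close>

inductive_set hecke_rels ::
    "('g, 'm) monoid_scheme \<Rightarrow> nat \<Rightarrow> ('g, 'f::field) free_hecke set"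
  for G :: "('g, 'm) monoid_scheme" and n :: nat where
  G_one: "gL \<one>\<^bsub>group_power G n\<^esub> - 1 \<in> hecke_rels G n"
| G_mult: "\<lbrakk>g \<in> carrier (group_power G n); h \<in> carrier (group_power G n)\<rbrakk>
    \<Longrightarrow> gL g * gL h - gL (g \<otimes>\<^bsub>group_power G n\<^esub> h) \<in> hecke_rels G n"
| x_x: "\<lbrakk>i \<in> {1..n}; j \<in> {1..n}\<rbrakk> \<Longrightarrow> xL i * xL j - xL j * xL i \<in> hecke_rels G n"
| x_g: "\<lbrakk>i \<in> {1..n}; g \<in> carrier (group_power G n)\<rbrakk>
    \<Longrightarrow> xL i * gL g - gL g * xL i \<in> hecke_rels G n"
| s_square: "i \<in> {1..<n} \<Longrightarrow> sL i * sL i - 1 \<in> hecke_rels G n"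
| s_commute: "\<lbrakk>i \<in> {1..<n}; j \<in> {1..<n}; i + 1 < j \<or> j + 1 < i\<rbrakk>
    \<Longrightarrow> sL i * sL j - sL j * sL i \<in> hecke_rels G n"
| s_braid: "\<lbrakk>i \<in> {1..<n}; i + 1 \<in> {1..<n}\<rbrakk>
    \<Longrightarrow> sL i * sL (i + 1) * sL i - sL (i + 1) * sL i * sL (i + 1) \<in> hecke_rels G n"
| s_x: "i \<in> {1..<n}
    \<Longrightarrow> sL i * xL i - (xL (i + 1) * sL i - tL G n i (i + 1)) \<in> hecke_rels G n"
| s_x_far: "\<lbrakk>i \<in> {1..<n}; j \<in> {1..n}; j \<noteq> i; j \<noteq> i + 1\<rbrakk>
    \<Longrightarrow> sL i * xL j - xL j * sL i \<in> hecke_rels G n"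
| s_g: "\<lbrakk>i \<in> {1..<n}; g \<in> carrier (group_power G n)\<rbrakk>
    \<Longrightarrow> sL i * gL g - gL (perm_tuple n (transpose i (i + 1)) g) * sL i \<in> hecke_rels G n"

definition hecke_ideal :: "('g, 'm) monoid_scheme \<Rightarrow> nat \<Rightarrow> ('g, 'f::field) free_hecke set" where
  "hecke_ideal G n = genideal (free_algebra (hecke_gens G n)) (hecke_rels G n)"

definition wreath_Hecke ::
    "('g, 'm) monoid_scheme \<Rightarrow> nat \<Rightarrow> ('g, 'f::field) free_hecke set ring" where
  "wreath_Hecke G n = free_algebra (hecke_gens G n) Quot hecke_ideal G n"

definition hecke_class ::
    "('g, 'm) monoid_scheme \<Rightarrow> nat \<Rightarrow> ('g, 'f::field) free_hecke \<Rightarrow> ('g, 'f) free_hecke set" where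
  "hecke_class G n p = hecke_ideal G n +>\<^bsub>free_algebra (hecke_gens G n)\<^esub> p"

definition hecke_scalar ::
    "('g, 'm) monoid_scheme \<Rightarrow> nat \<Rightarrow> 'f::field \<Rightarrow> ('g, 'f) free_hecke set" where
  "hecke_scalar G n c = hecke_class G n (scalar c)"

definition hecke_xpow ::
    "('g, 'm) monoid_scheme \<Rightarrow> nat \<Rightarrow> (nat \<Rightarrow> nat) \<Rightarrow> ('g, 'f::field) free_hecke set" where
  "hecke_xpow G n \<alpha> =
    foldr (\<lambda>k z. (hecke_class G n (xL k) [^]\<^bsub>wreath_Hecke G n\<^esub> \<alpha> k) \<otimes>\<^bsub>wreath_Hecke G n\<^esub> z)
      [1..<n + 1] \<one>\<^bsub>wreath_Hecke G n\<^esub>"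

definition conj_classes :: "('g, 'm) monoid_scheme \<Rightarrow> 'g set set" where
  "conj_classes G = orbits G (carrier G) (\<lambda>g. \<lambda>h\<in>carrier G. g \<otimes>\<^bsub>G\<^esub> h \<otimes>\<^bsub>G\<^esub> inv\<^bsub>G\<^esub> g)"

text \<open>The sum in the wreath Hecke algebra over the class of \<open>G\<^sup>n\<close> with multi-index \<open>i\<close>,
  where \<open>C\<close> enumerates the conjugacy classes of \<open>G\<close>.\<close>

definition hecke_class_sum ::
    "('g, 'm) monoid_scheme \<Rightarrow> nat \<Rightarrow> (nat \<Rightarrow> 'g set) \<Rightarrow> (nat \<Rightarrow> nat)
      \<Rightarrow> ('g, 'f::field) free_hecke set" where
  "hecke_class_sum G n C i =
    (\<Oplus>\<^bsub>wreath_Hecke G n\<^esub> g \<in> (\<Pi>\<^sub>E k\<in>{1..n}. C (i k)). hecke_class G n (gL g))"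

definition ring_center :: "('a, 'm) ring_scheme \<Rightarrow> 'a set" where
  "ring_center R = {z \<in> carrier R. \<forall>a \<in> carrier R. z \<otimes>\<^bsub>R\<^esub> a = a \<otimes>\<^bsub>R\<^esub> z}"


section \<open>Well-definedness\<close>

lemma perm_tuple_closed:
  assumes "w permutes {1..n}" "f \<in> (\<Pi>\<^sub>E k\<in>{1..n}. A)"
  shows "perm_tuple n w f \<in> (\<Pi>\<^sub>E k\<in>{1..n}. A)"
proof -
  have "inv_into UNIV w k \<in> {1..n}" if "k \<in> {1..n}" for k
    using permutes_in_image[OF permutes_inv[OF assms(1)]] that by blast
  then show ?thesis
    using assms(2) by (auto simp: perm_tuple_def PiE_iff)
qed

text \<open>Without this inclusion the ideal generated by the relations would be an intersection
  over the empty family.\<close>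

lemma hecke_rels_closed:
  assumes "group G"
  shows "hecke_rels G n \<subseteq> carrier (free_algebra (hecke_gens G n))"
proof -
  interpret G: group G by fact
  interpret P: group "group_power G n" by simp
  let ?F = "carrier (free_algebra (hecke_gens G n))"
  have emb: "factor_emb G n i g \<in> carrier (group_power G n)" if "g \<in> carrier G" for i g
    using that by (auto simp: factor_emb_def)
  have g: "gL g \<in> ?F" if "g \<in> carrier (group_power G n)" for g
    using that by (intro letter_free_algebra) (auto simp: hecke_gens_def)
  have s: "sL i \<in> ?F" if "i \<in> {1..<n}" for i
    using that by (intro letter_free_algebra) (auto simp: hecke_gens_def)
  have x: "xL i \<in> ?F" if "i \<in> {1..n}" for i
    using that by (intro letter_free_algebra) (auto simp: hecke_gens_def)
  have t: "tL G n i j \<in> ?F" for i j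
    unfolding tL_def by (intro sum_free_algebra g P.m_closed emb G.inv_closed)
  have p: "perm_tuple n (transpose i (i + 1)) g \<in> carrier (group_power G n)"
    if "i \<in> {1..<n}" "g \<in> carrier (group_power G n)" for i g
    using perm_tuple_closed[OF permutes_swap_id, of i n "i + 1" g] that by simp
  show ?thesis
  proof
    fix r assume "r \<in> hecke_rels G n"
    then show "r \<in> ?F"
      by cases
        (simp only:, intro minus_free_algebra times_free_algebra one_free_algebra
          g s x t p P.m_closed P.one_closed; simp)+
  qed
qed

lemma ideal_hecke_ideal:
  assumes "group G"
  shows "ideal (hecke_ideal G n) (free_algebra (hecke_gens G n))"
  unfolding hecke_ideal_def
  by (rule ring.genideal_ideal[OF ring_free_algebra hecke_rels_closed[OF assms]])

lemma ring_wreath_Hecke: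
  assumes "group G"
  shows "ring (wreath_Hecke G n)"
  unfolding wreath_Hecke_def by (rule ideal.quotient_is_ring[OF ideal_hecke_ideal[OF assms]])

end

theory Submission
  imports Defs
begin

text \<open>The centre is computed in the basis \<open>x\<^sup>\<alpha> g w\<close>, so the proof has two halves: showing that these
  elements are a basis, and comparing coefficients.

  Independence comes from a module. Let \<open>V\<close> be the space with basis the triples \<open>(\<alpha>, g, w)\<close>, and
  let the generators act on \<open>V\<close> as left multiplication ought to act on \<open>x\<^sup>\<alpha> g w\<close>; for \<open>s\<^sub>i\<close> this
  means the permutation of all three components, plus \<open>t\<^sub>i\<^sub>,\<^sub>i\<^sub>+\<^sub>1\<close> times the divided difference of
  \<open>x\<^sup>\<alpha>\<close>. The relations between \<open>s\<^sub>i\<close> and the \<open>x\<^sub>j\<close> and \<open>g\<close> are read off from the formula. The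
  relations among the \<open>s\<^sub>i\<close> alone need no computation with divided differences: both sides of such a
  relation commute in the same way past the \<open>x\<^sub>j\<close> and the \<open>g\<close> and agree on the permutations, which
  generate \<open>V\<close> (\<open>nf_space_induct_eq\<close>; see \<open>opS_square\<close>, \<open>opS_opS_far\<close>, \<open>opS_braid\<close>). Hence \<open>V\<close> is
  a module over the algebra (\<open>hact_hecke_ideal\<close>). Conversely the normal forms span, because words in
  the \<open>s\<^sub>i\<close> with the same permutation are equal by the Coxeter relations (\<open>coxeter_eqI\<close>) and the span
  is stable under the generators (\<open>spanned_all\<close>). So an element \<open>p\<close> is determined by its
  coordinate vector, the image of the basis vector \<open>1\<close> under \<open>p\<close> (\<open>hecke_normal_form\<close>, \<open>hcong_iff\<close>).

  Now let \<open>p\<close> be central with coordinate vector \<open>v\<close>. Modulo terms of lower degree in the \<open>x\<^sub>k\<close>, right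
  multiplication by \<open>x\<^sub>j\<close> sends \<open>x\<^sup>\<alpha> g w\<close> to \<open>x\<^sub>w\<^sub>(\<^sub>j\<^sub>) x\<^sup>\<alpha> g w\<close>. If \<open>v\<close> has terms with \<open>w \<noteq> id\<close>, take
  those of top degree that belong to one such \<open>w\<close>, and \<open>j\<close> with \<open>w(j) \<noteq> j\<close>: their sum is annihilated by
  \<open>x\<^sub>j - x\<^sub>w\<^sub>(\<^sub>j\<^sub>)\<close>, which is impossible
  (\<open>central_keys_id\<close>). So \<open>v\<close> only involves \<open>w = id\<close>, and commuting with \<open>g\<close> and with \<open>s\<^sub>i\<close> says that
  its coefficients are constant on conjugacy classes and invariant under permutations
  (\<open>central_imp_invariant\<close>).

  Conversely let \<open>v\<close> be invariant, with element \<open>p\<close>. Then \<open>p\<close> commutes with the \<open>x\<^sub>j\<close> and \<open>g\<close>. The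
  commutator \<open>q = s\<^sub>i p - p s\<^sub>i\<close> also involves only \<open>w = id\<close>, so it commutes with \<open>x\<^sub>i\<close>; but the relations
  give \<open>q x\<^sub>i = x\<^sub>i\<^sub>+\<^sub>1 q\<close>. Hence \<open>(x\<^sub>i - x\<^sub>i\<^sub>+\<^sub>1) q = 0\<close> and \<open>q = 0\<close>
  (\<open>invariant_imp_central\<close>). This argument is independent of the characteristic. Finally invariant
  vectors are the coordinate vectors of the sums in the theorem
  (\<open>invariant_imp_class_vector\<close>, \<open>class_class_vector\<close>).\<close>

section \<open>Linear extension on finitely supported functions\<close>

abbreviation "lookup \<equiv> Poly_Mapping.lookup"
abbreviation "keys \<equiv> Poly_Mapping.keys"
abbreviation "single \<equiv> Poly_Mapping.single"

definition scale :: "'f::field \<Rightarrow> ('k \<Rightarrow>\<^sub>0 'f) \<Rightarrow> ('k \<Rightarrow>\<^sub>0 'f)" where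
  "scale c v = Poly_Mapping.map ((*) c) v"

lemma lookup_scale [simp]: "lookup (scale c v) k = c * lookup v k"
  by (simp add: scale_def map.rep_eq when_def)

lemma scale_add: "scale c (u + v) = scale c u + scale c v"
  by (rule poly_mapping_eqI) (simp add: lookup_add algebra_simps)

lemma scale_add_left: "scale (c + d) v = scale c v + scale d v"
  by (rule poly_mapping_eqI) (simp add: lookup_add algebra_simps)

lemma scale_scale [simp]: "scale c (scale d v) = scale (c * d) v"
  by (rule poly_mapping_eqI) (simp add: algebra_simps)

lemma scale_simps [simp]: "scale c 0 = 0" "scale 0 v = 0" "scale 1 v = v"
  "scale c (single k d) = single k (c * d)"
  by (rule poly_mapping_eqI, simp add: lookup_single when_def)+

lemma scale_sum: "scale c (sum f I) = (\<Sum>i\<in>I. scale c (f i))"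
  by (rule poly_mapping_eqI) (simp add: lookup_sum sum_distrib_left)

lemma scale_eq_mult: "scale c p = single 0 c * (p :: 'a word \<Rightarrow>\<^sub>0 'f::field)"
  by (simp add: scale_def mult_map_scale_conv_mult)

lemma keys_scale: "keys (scale c v) \<subseteq> keys v"
  by (auto simp: in_keys_iff)

definition lin :: "('k \<Rightarrow> ('l \<Rightarrow>\<^sub>0 'f::field)) \<Rightarrow> ('k \<Rightarrow>\<^sub>0 'f) \<Rightarrow> ('l \<Rightarrow>\<^sub>0 'f)" where
  "lin f v = (\<Sum>k\<in>keys v. scale (lookup v k) (f k))"

lemma lin_superset:
  assumes "finite S" "keys v \<subseteq> S"
  shows "lin f v = (\<Sum>k\<in>S. scale (lookup v k) (f k))"
  unfolding lin_def using assms by (intro sum.mono_neutral_left) (auto simp: in_keys_iff)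

lemma lin_add: "lin f (u + v) = lin f u + lin f v"
proof -
  have "keys (u + v) \<subseteq> keys u \<union> keys v" by (rule Poly_Mapping.keys_add)
  then show ?thesis
    by (subst (1 2 3) lin_superset[of "keys u \<union> keys v"])
      (auto simp: lookup_add scale_add_left sum.distrib)
qed

lemma lin_scale: "lin f (scale c v) = scale c (lin f v)"
  by (subst (1 2) lin_superset[of "keys v"]) (auto simp: keys_scale scale_sum)

lemma lin_single [simp]: "lin f (single k c) = scale c (f k)"
  by (subst lin_superset[of "{k}"]) auto

lemma lin_cong: "(\<And>k. k \<in> keys v \<Longrightarrow> f k = g k) \<Longrightarrow> lin f v = lin g v"
  by (simp add: lin_def)

lemma lookup_lin: "lookup (lin f v) l = (\<Sum>k\<in>keys v. lookup v k * lookup (f k) l)"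
  by (simp add: lin_def lookup_sum)

lemma keys_lin: "keys (lin f v) \<subseteq> (\<Union>k\<in>keys v. keys (f k))"
proof
  fix l assume "l \<in> keys (lin f v)"
  then have "(\<Sum>k\<in>keys v. lookup v k * lookup (f k) l) \<noteq> 0"
    by (simp add: in_keys_iff lookup_lin)
  then obtain k where "k \<in> keys v" "lookup v k * lookup (f k) l \<noteq> 0"
    by (rule sum.not_neutral_contains_not_neutral)
  then show "l \<in> (\<Union>k\<in>keys v. keys (f k))"
    by (auto simp: in_keys_iff)
qed

definition linear_map :: "(('k \<Rightarrow>\<^sub>0 'f::field) \<Rightarrow> ('l \<Rightarrow>\<^sub>0 'f)) \<Rightarrow> bool" where
  "linear_map T \<longleftrightarrow> (\<forall>u v. T (u + v) = T u + T v) \<and> (\<forall>c v. T (scale c v) = scale c (T v))"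

lemma linear_mapI:
  "(\<And>u v. T (u + v) = T u + T v) \<Longrightarrow> (\<And>c v. T (scale c v) = scale c (T v)) \<Longrightarrow> linear_map T"
  by (simp add: linear_map_def)

lemma linear_map_add: "linear_map T \<Longrightarrow> T (u + v) = T u + T v"
  and linear_map_scale: "linear_map T \<Longrightarrow> T (scale c v) = scale c (T v)"
  by (simp_all add: linear_map_def)

lemma linear_map_zero: "linear_map T \<Longrightarrow> T 0 = 0"
  using linear_map_scale[of T 0 0] by simp

lemma linear_map_diff: "linear_map T \<Longrightarrow> T (u - v) = T u - T v"
  using linear_map_add[of T "u - v" v] by simp

lemma linear_map_uminus: "linear_map T \<Longrightarrow> T (- v) = - T v"
  using linear_map_diff[of T 0 v] linear_map_zero[of T] by simp

lemma linear_map_sum: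
  assumes T: "linear_map T"
  shows "T (sum f I) = (\<Sum>i\<in>I. T (f i))"
  by (induction I rule: infinite_finite_induct)
    (simp_all add: linear_map_add[OF T] linear_map_zero[OF T])

lemma linear_map_lin: "linear_map (lin f)"
  by (simp add: linear_map_def lin_add lin_scale)

lemmas lin_zero = linear_map_zero[OF linear_map_lin]
lemmas lin_diff = linear_map_diff[OF linear_map_lin]
lemmas lin_uminus = linear_map_uminus[OF linear_map_lin]
lemmas lin_sum = linear_map_sum[OF linear_map_lin]

lemma linear_map_id: "linear_map (\<lambda>v. v)"
  by (simp add: linear_map_def)

lemma linear_map_compose: "linear_map T \<Longrightarrow> linear_map U \<Longrightarrow> linear_map (\<lambda>v. T (U v))"
  by (simp add: linear_map_def)

lemma linear_map_plus: "linear_map T \<Longrightarrow> linear_map U \<Longrightarrow> linear_map (\<lambda>v. T v + U v)"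
  by (simp add: linear_map_def scale_add algebra_simps)

lemma scale_diff: "scale c (u - v) = scale c u - scale c v"
  by (rule poly_mapping_eqI) (simp add: lookup_minus algebra_simps)

lemma linear_map_minus: "linear_map T \<Longrightarrow> linear_map U \<Longrightarrow> linear_map (\<lambda>v. T v - U v)"
  by (simp add: linear_map_def scale_diff algebra_simps)

lemma linear_map_sums: "(\<And>i. i \<in> I \<Longrightarrow> linear_map (T i)) \<Longrightarrow> linear_map (\<lambda>v. \<Sum>i\<in>I. T i v)"
  by (simp add: linear_map_def scale_sum sum.distrib)

lemma lin_expand: "lin (\<lambda>k. single k 1) v = v"
proof (rule poly_mapping_eqI)
  fix l
  have "lookup (lin (\<lambda>k. single k 1) v) l = (\<Sum>k\<in>keys v. if k = l then lookup v k else 0)"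
    unfolding lookup_lin by (intro sum.cong) (auto simp: lookup_single when_def)
  then show "lookup (lin (\<lambda>k. single k 1) v) l = lookup v l"
    by (simp add: in_keys_iff)
qed

lemma linear_map_eq_lin:
  assumes "linear_map T"
  shows "T v = lin (\<lambda>k. T (single k 1)) v"
proof -
  have "T v = T (lin (\<lambda>k. single k 1) v)"
    by (simp only: lin_expand)
  also have "\<dots> = lin (\<lambda>k. T (single k 1)) v"
    unfolding lin_def linear_map_sum[OF assms] linear_map_scale[OF assms] ..
  finally show ?thesis .
qed

text \<open>The basis vectors in the support of \<open>v\<close> suffice. This is what allows identities to be checked on
  basis vectors that lie in a subspace only.\<close>

lemma linear_map_eqI:
  assumes "linear_map T" "linear_map U" "\<And>k. k \<in> keys v \<Longrightarrow> T (single k 1) = U (single k 1)"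
  shows "T v = U v"
proof -
  have "T v = lin (\<lambda>k. T (single k 1)) v"
    by (rule linear_map_eq_lin[OF assms(1)])
  also have "\<dots> = lin (\<lambda>k. U (single k 1)) v"
    by (rule lin_cong) (rule assms(3))
  also have "\<dots> = U v"
    by (rule linear_map_eq_lin[OF assms(2), symmetric])
  finally show ?thesis .
qed

text \<open>A map that permutes basis vectors moves coefficients without adding any, provided that \<open>l\<close> has a
  single preimage in the support.\<close>

lemma lookup_lin_single_inj:
  assumes "\<And>k. k \<in> keys v \<Longrightarrow> f k = l \<longleftrightarrow> k = l'"
  shows "lookup (lin (\<lambda>k. single (f k) 1) v) l = lookup v l'"
proof -
  have "lookup (lin (\<lambda>k. single (f k) 1) v) l = (\<Sum>k\<in>keys v. if k = l' then lookup v k else 0)"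
    unfolding lookup_lin by (intro sum.cong) (auto simp: assms lookup_single when_def)
  also have "\<dots> = lookup v l'"
    by (auto simp: in_keys_iff)
  finally show ?thesis .
qed

section \<open>Modules over free algebras\<close>

definition act_letters :: "('a \<Rightarrow> 'k \<Rightarrow> ('k \<Rightarrow>\<^sub>0 'f::field)) \<Rightarrow> 'a list \<Rightarrow> ('k \<Rightarrow>\<^sub>0 'f) \<Rightarrow> ('k \<Rightarrow>\<^sub>0 'f)" where
  "act_letters A as = foldr (\<lambda>a. lin (A a)) as"

definition free_act ::
    "('a \<Rightarrow> 'k \<Rightarrow> ('k \<Rightarrow>\<^sub>0 'f::field)) \<Rightarrow> ('a word \<Rightarrow>\<^sub>0 'f) \<Rightarrow> ('k \<Rightarrow>\<^sub>0 'f) \<Rightarrow> ('k \<Rightarrow>\<^sub>0 'f)" where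
  "free_act A p v = lin (\<lambda>w. act_letters A (letters w) v) p"

lemma linear_map_act_letters: "linear_map (act_letters A as)"
  by (induction as) (simp_all add: act_letters_def linear_map_def lin_add lin_scale)

lemma linear_map_free_act_left: "linear_map (\<lambda>p. free_act A p v)"
  unfolding free_act_def by (rule linear_map_lin)

lemma linear_map_free_act: "linear_map (free_act A p)"
  unfolding free_act_def lin_def
  by (rule linear_map_sums)
    (simp add: linear_map_def linear_map_add[OF linear_map_act_letters] scale_add
      linear_map_scale[OF linear_map_act_letters] mult.commute)

lemma free_act_single: "free_act A (single w c) v = scale c (act_letters A (letters w) v)"
  by (simp add: free_act_def)

lemma free_act_letter [simp]: "free_act A (letter a) v = lin (A a) v"
  by (simp add: letter_def free_act_single act_letters_def)

lemma free_act_one [simp]: "free_act A 1 v = v"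
  by (simp add: free_act_single act_letters_def flip: single_one)

lemma free_act_scalar [simp]: "free_act A (scalar c) v = scale c v"
  by (simp add: free_act_single act_letters_def scalar_def)

lemmas free_act_add = linear_map_add[OF linear_map_free_act_left]
lemmas free_act_diff = linear_map_diff[OF linear_map_free_act_left]
lemmas free_act_zero = linear_map_zero[OF linear_map_free_act_left]
lemmas free_act_scale = linear_map_scale[OF linear_map_free_act_left]

lemma linear_map_mult_right: "linear_map (\<lambda>p :: 'a word \<Rightarrow>\<^sub>0 'f::field. p * q)"
  by (rule linear_mapI) (simp_all add: algebra_simps scale_eq_mult)

lemma scale_eq_mult_right: "scale c p = (p :: 'a word \<Rightarrow>\<^sub>0 'f::field) * single 0 c"
proof (rule linear_map_eqI[where v = p])
  show "linear_map (\<lambda>p :: 'a word \<Rightarrow>\<^sub>0 'f. scale c p)"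
    by (rule linear_mapI) (simp_all add: scale_add mult.commute)
qed (simp_all add: linear_map_mult_right mult_single)

lemma linear_map_mult_left: "linear_map ((*) (p :: 'a word \<Rightarrow>\<^sub>0 'f::field))"
  by (rule linear_mapI) (simp_all add: algebra_simps scale_eq_mult_right)

lemma free_act_mult [simp]: "free_act A (p * q) v = free_act A p (free_act A q v)"
proof -
  have 1: "free_act A (single u 1 * single w 1) v = free_act A (single u 1) (free_act A (single w 1) v)" for u w
    by (simp add: mult_single free_act_single act_letters_def)
  have 2: "free_act A (single u 1 * q) v = free_act A (single u 1) (free_act A q v)" for u
  proof (rule linear_map_eqI[where v = q])
    show "linear_map (\<lambda>q. free_act A (single u 1 * q) v)"
      by (rule linear_map_compose[OF linear_map_free_act_left linear_map_mult_left])
    show "linear_map (\<lambda>q. free_act A (single u 1) (free_act A q v))"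
      by (rule linear_map_compose[OF linear_map_free_act linear_map_free_act_left])
  qed (rule 1)
  show ?thesis
  proof (rule linear_map_eqI[where v = p])
    show "linear_map (\<lambda>p. free_act A (p * q) v)"
      by (rule linear_map_compose[OF linear_map_free_act_left linear_map_mult_right])
    show "linear_map (\<lambda>p. free_act A p (free_act A q v))"
      by (rule linear_map_free_act_left)
  qed (rule 2)
qed

section \<open>The operators of the generators on the space of normal forms\<close>

declare mult_product_group [simp del] one_product_group [simp del] inv_product_group [simp del] One_nat_def [simp del]

text \<open>The triple \<open>(\<alpha>, g, w)\<close> stands for the normal form \<open>x\<^sup>\<alpha> g w\<close>.\<close>

type_synonym 'g nf = "(nat \<Rightarrow> nat) \<times> (nat \<Rightarrow> 'g) \<times> (nat \<Rightarrow> nat)"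

abbreviation adj :: "nat \<Rightarrow> nat \<Rightarrow> nat" where
  "adj i \<equiv> transpose i (Suc i)"

lemma adj_in_iff: "1 \<le> i \<Longrightarrow> i < n \<Longrightarrow> adj i k \<in> {1..n} \<longleftrightarrow> k \<in> {1..n}"
  by (auto simp: transpose_def)

lemma comp_adj_ext: "i \<in> {1..<n} \<Longrightarrow> f \<in> ({1..n} \<rightarrow>\<^sub>E A) \<Longrightarrow> f \<circ> adj i \<in> ({1..n} \<rightarrow>\<^sub>E A)"
  by (auto simp: PiE_iff extensional_def adj_in_iff simp del: atLeastAtMost_iff)

text \<open>Composition with the transposition keeps the default values outside \<open>{1..n}\<close>, so the action of \<open>s\<^sub>i\<close>
  on tuples can be written without restrictions; transpositions are their own inverses.\<close>

lemma perm_tuple_adj: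
  assumes "i \<in> {1..<n}" "f \<in> ({1..n} \<rightarrow>\<^sub>E A)"
  shows "perm_tuple n (adj i) f = f \<circ> adj i"
  using comp_adj_ext[OF assms] by (auto simp: perm_tuple_def fun_eq_iff PiE_iff extensional_def)

locale wreath_data = group G for G :: "('g, 'm) monoid_scheme" (structure) +
  fixes n :: nat
  assumes finite_carrier: "finite (carrier G)"
begin

abbreviation P where "P \<equiv> group_power G n"

sublocale P: group P
  by simp

lemma P_mult_apply: "(g \<otimes>\<^bsub>P\<^esub> h) k = (if k \<in> {1..n} then g k \<otimes> h k else undefined)"
  by (simp add: mult_product_group)

lemma P_eqI:
  "g \<in> carrier P \<Longrightarrow> h \<in> carrier P \<Longrightarrow> (\<And>k. k \<in> {1..n} \<Longrightarrow> g k = h k) \<Longrightarrow> g = h"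
  unfolding carrier_product_group by (rule PiE_ext)

lemma P_apply_closed: "g \<in> carrier P \<Longrightarrow> k \<in> {1..n} \<Longrightarrow> g k \<in> carrier G"
  by (auto simp: PiE_iff)

lemma comp_adj_closed: "i \<in> {1..<n} \<Longrightarrow> g \<in> carrier P \<Longrightarrow> g \<circ> adj i \<in> carrier P"
  unfolding carrier_product_group by (rule comp_adj_ext)

lemma comp_adj_mult:
  "i \<in> {1..<n} \<Longrightarrow> (g \<otimes>\<^bsub>P\<^esub> h) \<circ> adj i = (g \<circ> adj i) \<otimes>\<^bsub>P\<^esub> (h \<circ> adj i)"
  by (auto simp: P_mult_apply fun_eq_iff adj_in_iff simp del: atLeastAtMost_iff)

lemma comp_adj_one: "i \<in> {1..<n} \<Longrightarrow> \<one>\<^bsub>P\<^esub> \<circ> adj i = \<one>\<^bsub>P\<^esub>"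
  by (auto simp: one_product_group fun_eq_iff adj_in_iff restrict_def simp del: atLeastAtMost_iff)

text \<open>The summand of \<open>t\<^sub>j\<^sub>k\<close> that belongs to \<open>h\<close>.\<close>

definition tt :: "nat \<Rightarrow> nat \<Rightarrow> 'g \<Rightarrow> nat \<Rightarrow> 'g" where
  "tt j k h = factor_emb G n j h \<otimes>\<^bsub>P\<^esub> factor_emb G n k (inv h)"

lemma tt_closed [simp]: "h \<in> carrier G \<Longrightarrow> tt j k h \<in> carrier P"
  unfolding tt_def by (intro P.m_closed) (auto simp: factor_emb_def)

lemma tt_apply: "h \<in> carrier G \<Longrightarrow> j \<noteq> k \<Longrightarrow> l \<in> {1..n} \<Longrightarrow>
   tt j k h l = (if l = j then h else if l = k then inv h else \<one>)"
  by (auto simp: tt_def P_mult_apply factor_emb_def)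

lemma factor_emb_comp_adj:
  assumes "i \<in> {1..<n}"
  shows "factor_emb G n j h \<circ> adj i = factor_emb G n (adj i j) h"
proof
  fix k
  have "adj i k = j \<longleftrightarrow> k = adj i j"
    by (metis transpose_involutory)
  then show "(factor_emb G n j h \<circ> adj i) k = factor_emb G n (adj i j) h k"
    using adj_in_iff[of i n k] assms by (simp add: factor_emb_def)
qed

lemma tt_comp_adj: "i \<in> {1..<n} \<Longrightarrow> tt j k h \<circ> adj i = tt (adj i j) (adj i k) h"
  by (simp add: tt_def comp_adj_mult factor_emb_comp_adj)

lemma tt_swap:
  assumes "h \<in> carrier G" "j \<noteq> k"
  shows "tt j k h = tt k j (inv h)"
  using assms by (intro P_eqI tt_closed) (auto simp: tt_apply)

text \<open>The element form of \<open>t\<^sub>i\<^sub>,\<^sub>i\<^sub>+\<^sub>1 g = (s\<^sub>i g) t\<^sub>i\<^sub>,\<^sub>i\<^sub>+\<^sub>1\<close>: the summands are permuted by the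
  substitution \<open>h \<mapsto> g\<^sub>i\<^sub>+\<^sub>1\<^sup>-\<^sup>1 h g\<^sub>i\<close>.\<close>

lemma tt_mult:
  assumes "i \<in> {1..<n}" "g \<in> carrier P" "h \<in> carrier G"
  shows "tt i (Suc i) h \<otimes>\<^bsub>P\<^esub> g = (g \<circ> adj i) \<otimes>\<^bsub>P\<^esub> tt i (Suc i) (inv (g (Suc i)) \<otimes> h \<otimes> g i)"
proof (rule P_eqI)
  have g: "g l \<in> carrier G" if "l \<in> {1..n}" for l
    using P_apply_closed[OF assms(2) that] .
  have c: "g i \<in> carrier G" "g (Suc i) \<in> carrier G"
    using assms by (auto intro!: g)
  show "(g \<circ> adj i) \<otimes>\<^bsub>P\<^esub> tt i (Suc i) (inv (g (Suc i)) \<otimes> h \<otimes> g i) \<in> carrier P"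
    using assms c by (intro P.m_closed comp_adj_closed tt_closed) auto
  show "(tt i (Suc i) h \<otimes>\<^bsub>P\<^esub> g) l =
      ((g \<circ> adj i) \<otimes>\<^bsub>P\<^esub> tt i (Suc i) (inv (g (Suc i)) \<otimes> h \<otimes> g i)) l" if l: "l \<in> {1..n}" for l
  proof -
    consider "l = i" | "l = Suc i" | "l \<noteq> i" "l \<noteq> Suc i" by blast
    then show ?thesis
    proof cases
      case 1
      have "h \<otimes> g i = g (Suc i) \<otimes> (inv (g (Suc i)) \<otimes> h \<otimes> g i)"
        using assms c by (simp add: m_assoc[symmetric])
      then show ?thesis
        using 1 l c assms by (simp add: P_mult_apply tt_apply)
    next
      case 2
      have "inv h \<otimes> g (Suc i) = g i \<otimes> inv (inv (g (Suc i)) \<otimes> h \<otimes> g i)"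
        using assms c by (simp add: inv_mult_group m_assoc[symmetric])
      then show ?thesis
        using 2 l c assms by (simp add: P_mult_apply tt_apply)
    next
      case 3
      then show ?thesis
        using l c assms g[OF l] by (simp add: P_mult_apply tt_apply)
    qed
  qed
qed (use assms in \<open>simp_all del: carrier_product_group\<close>)

definition basis_keys :: "'g nf set" where
  "basis_keys = ({1..n} \<rightarrow>\<^sub>E UNIV) \<times> carrier P \<times> {w. w permutes {1..n}}"

definition nf_space :: "('g nf \<Rightarrow>\<^sub>0 'f::field) set" where
  "nf_space = {v. keys v \<subseteq> basis_keys}"

text \<open>The correction in \<open>s\<^sub>i x\<^sup>\<alpha> = x\<^sup>s\<^sup>\<alpha> s\<^sub>i + t\<^sub>i\<^sub>,\<^sub>i\<^sub>+\<^sub>1 \<Delta>(x\<^sup>\<alpha>)\<close> contains the divided difference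
  \<open>\<Delta>(f) = (f - s f) / (x\<^sub>i\<^sub>+\<^sub>1 - x\<^sub>i)\<close>. On \<open>x\<^sub>i\<^sup>a x\<^sub>i\<^sub>+\<^sub>1\<^sup>b\<close> it is the sum of the monomials
  \<open>x\<^sub>i\<^sup>c x\<^sub>i\<^sub>+\<^sub>1\<^sup>a\<^sup>+\<^sup>b\<^sup>-\<^sup>1\<^sup>-\<^sup>c\<close> over \<open>a \<le> c < b\<close>, or minus the sum over \<open>b \<le> c < a\<close>. The function
  \<open>dterm\<close> is one such monomial multiplied by \<open>t\<^sub>i\<^sub>,\<^sub>i\<^sub>+\<^sub>1\<close>, and \<open>ddiff\<close> is the whole correction; at
  most one of its two sums is nonempty.\<close>

definition dterm :: "nat \<Rightarrow> nat \<Rightarrow> 'g nf \<Rightarrow> ('g nf \<Rightarrow>\<^sub>0 'f::field)" where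
  "dterm i c = (\<lambda>(\<alpha>, g, w). \<Sum>h\<in>carrier G.
     single (\<alpha>(i := c, Suc i := \<alpha> i + \<alpha> (Suc i) - 1 - c), tt i (Suc i) h \<otimes>\<^bsub>P\<^esub> g, w) 1)"

definition ddiff :: "nat \<Rightarrow> 'g nf \<Rightarrow> ('g nf \<Rightarrow>\<^sub>0 'f::field)" where
  "ddiff i k = (\<Sum>c = fst k i..<fst k (Suc i). dterm i c k) -
     (\<Sum>c = fst k (Suc i)..<fst k i. dterm i c k)"

definition twist :: "nat \<Rightarrow> 'g nf \<Rightarrow> 'g nf" where
  "twist i = (\<lambda>(\<alpha>, g, w). (\<alpha> \<circ> adj i, g \<circ> adj i, adj i \<circ> w))"

text \<open>Left multiplication of a normal form by a generator, as the relations prescribe it.\<close>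

definition gen_act :: "'g hecke_gen \<Rightarrow> 'g nf \<Rightarrow> ('g nf \<Rightarrow>\<^sub>0 'f::field)" where
  "gen_act a k = (case a of
      XGen j \<Rightarrow> (case k of (\<alpha>, g, w) \<Rightarrow> single (\<alpha>(j := Suc (\<alpha> j)), g, w) 1)
    | GGen h \<Rightarrow> (case k of (\<alpha>, g, w) \<Rightarrow> single (\<alpha>, h \<otimes>\<^bsub>P\<^esub> g, w) 1)
    | SGen i \<Rightarrow> single (twist i k) 1 + ddiff i k)"

abbreviation "opX j \<equiv> lin (gen_act (XGen j))"
abbreviation "opG g \<equiv> lin (gen_act (GGen g))"
abbreviation "opS i \<equiv> lin (gen_act (SGen i))"

definition opT :: "nat \<Rightarrow> nat \<Rightarrow> ('g nf \<Rightarrow>\<^sub>0 'f::field) \<Rightarrow> ('g nf \<Rightarrow>\<^sub>0 'f)" where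
  "opT j k v = (\<Sum>h\<in>carrier G. opG (tt j k h) v)"

lemma linear_opT: "linear_map (opT j k)"
  unfolding opT_def by (rule linear_map_sums[OF linear_map_lin])

lemmas op_add = lin_add linear_map_add[OF linear_opT]
lemmas op_diff = lin_diff linear_map_diff[OF linear_opT]

lemma gen_act_simps [simp]:
  "gen_act (XGen j) (\<alpha>, g, w) = single (\<alpha>(j := Suc (\<alpha> j)), g, w) 1"
  "gen_act (GGen h) (\<alpha>, g, w) = single (\<alpha>, h \<otimes>\<^bsub>P\<^esub> g, w) 1"
  "gen_act (SGen i) k = single (twist i k) 1 + ddiff i k"
  by (simp_all add: gen_act_def)

lemma opX_single: "opX j (single (\<alpha>, g, w) 1) = single (\<alpha>(j := Suc (\<alpha> j)), g, w) 1"
  by simp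

lemma opG_single: "opG h (single (\<alpha>, g, w) 1) = single (\<alpha>, h \<otimes>\<^bsub>P\<^esub> g, w) 1"
  by simp

lemma opT_single: "opT j k (single (\<alpha>, g, w) 1) = (\<Sum>h\<in>carrier G. single (\<alpha>, tt j k h \<otimes>\<^bsub>P\<^esub> g, w) 1)"
  by (simp add: opT_def)

text \<open>Tuples in \<open>G\<^sup>n\<close> can only be multiplied sensibly inside the carrier, which is why identities are
  stated on \<open>nf_space\<close> and not on the whole type.\<close>

lemma lin_eqI:
  assumes "linear_map T" "linear_map U" "v \<in> nf_space"
    and "\<And>\<alpha> g w. \<lbrakk>\<alpha> \<in> {1..n} \<rightarrow>\<^sub>E UNIV; g \<in> carrier P; w permutes {1..n}\<rbrakk> \<Longrightarrow>
      T (single (\<alpha>, g, w) 1) = U (single (\<alpha>, g, w) 1)"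
  shows "T v = U v"
  using assms(3,4) by - (rule linear_map_eqI[OF assms(1,2)], auto simp: nf_space_def basis_keys_def)

lemma opG_one:
  assumes "v \<in> nf_space" shows "opG \<one>\<^bsub>P\<^esub> v = v"
  by (rule lin_eqI[OF linear_map_lin linear_map_id assms]) (simp add: opG_single P.l_one del: carrier_product_group)

lemma opG_mult:
  assumes "v \<in> nf_space" "g \<in> carrier P" "h \<in> carrier P"
  shows "opG g (opG h v) = opG (g \<otimes>\<^bsub>P\<^esub> h) v"
  by (rule lin_eqI[OF linear_map_compose[OF linear_map_lin linear_map_lin] linear_map_lin assms(1)])
    (use assms in \<open>simp_all add: opG_single P.m_assoc del: carrier_product_group\<close>)

lemma opX_commute: "opX j (opX k v) = opX k (opX j v)"
  by (rule linear_map_eqI[where v = v]; (rule linear_map_compose[OF linear_map_lin linear_map_lin])?)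
    (auto simp: opX_single fun_upd_twist)

lemma opX_opG: "opX j (opG g v) = opG g (opX j v)"
  by (rule linear_map_eqI[where v = v]; (rule linear_map_compose[OF linear_map_lin linear_map_lin])?)
    (auto simp: opX_single opG_single)

lemma opX_dterm: "j \<noteq> i \<Longrightarrow> j \<noteq> Suc i \<Longrightarrow> opX j (dterm i c (\<alpha>, g, w)) = dterm i c (\<alpha>(j := Suc (\<alpha> j)), g, w)"
  by (simp add: dterm_def lin_sum opX_single fun_upd_twist)

lemma opS_opX_far:
  fixes v :: "'g nf \<Rightarrow>\<^sub>0 'f::field"
  assumes "j \<noteq> i" "j \<noteq> Suc i"
  shows "opS i (opX j v) = opX j (opS i v)"
proof (rule linear_map_eqI[where v = v]; (rule linear_map_compose[OF linear_map_lin linear_map_lin])?)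
  fix k :: "'g nf"
  obtain \<alpha> g w where k: "k = (\<alpha>, g, w)" by (cases k)
  have "(\<alpha>(j := Suc (\<alpha> j))) \<circ> adj i = (\<alpha> \<circ> adj i)(j := Suc ((\<alpha> \<circ> adj i) j))"
    using assms by (auto simp: fun_eq_iff transpose_def)
  then have tw: "gen_act (XGen j) (twist i k) = single (twist i (\<alpha>(j := Suc (\<alpha> j)), g, w)) 1"
    unfolding k twist_def by (simp add: opX_single)
  have d: "opX j (ddiff i k) = ddiff i (\<alpha>(j := Suc (\<alpha> j)), g, w)"
    using assms by (simp add: k ddiff_def lin_sum lin_diff lin_uminus opX_dterm)
  show "opS i (opX j (single k 1)) = (opX j (opS i (single k 1)) :: 'g nf \<Rightarrow>\<^sub>0 'f)"
    by (simp add: op_add d tw) (simp add: k)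
qed

text \<open>When the exponent of \<open>x\<^sub>i\<close> grows by one, the range of summation of the divided difference changes
  by the single monomial \<open>x\<^sup>\<alpha>\<close>, and this gives the term \<open>- t\<^sub>i\<^sub>,\<^sub>i\<^sub>+\<^sub>1 x\<^sup>\<alpha>\<close>.\<close>

lemma opS_opX:
  "opS i (opX i v) = opX (Suc i) (opS i v) - opT i (Suc i) v" (is "_ = ?R v")
proof -
  have "linear_map ?R"
    by (rule linear_map_minus[OF linear_map_compose[OF linear_map_lin linear_map_lin] linear_opT])
  then show ?thesis
  proof (rule linear_map_eqI[OF linear_map_compose[OF linear_map_lin linear_map_lin]])
    fix k :: "'g nf"
    obtain \<alpha> g w where k: "k = (\<alpha>, g, w)" by (cases k)
    define k' where "k' = (\<alpha>(i := Suc (\<alpha> i)), g, w)"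
    have fk: "fst k = \<alpha>" "fst k' i = Suc (\<alpha> i)" "fst k' (Suc i) = \<alpha> (Suc i)"
      by (simp_all add: k k'_def)
    have tw: "gen_act (XGen (Suc i)) (twist i k) = single (twist i k') 1"
      unfolding k k'_def twist_def
      by simp (auto simp: fun_eq_iff transpose_def intro!: arg_cong[where f = "\<lambda>x. single x 1"])
    have T: "opT i (Suc i) (single k 1) = dterm i (\<alpha> i) k'"
      by (simp add: k k'_def opT_single dterm_def)
    have d: "opX (Suc i) (dterm i c k) = dterm i c k'" if "c < \<alpha> i + \<alpha> (Suc i)" for c
    proof -
      have "Suc (\<alpha> i + \<alpha> (Suc i) - (1 + c)) = \<alpha> i + \<alpha> (Suc i) - c"
        using that by arith
      then show ?thesis
        by (simp add: k k'_def dterm_def lin_sum)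
    qed
    have gx: "gen_act (XGen i) k = single k' 1"
      by (simp add: k k'_def)
    have D: "opX (Suc i) (ddiff i k) - opT i (Suc i) (single k 1) = ddiff i k'"
    proof (cases "\<alpha> i < \<alpha> (Suc i)")
      case True
      have e: "(\<Sum>c = \<alpha> i..<\<alpha> (Suc i). dterm i c k') = dterm i (\<alpha> i) k' + (\<Sum>c = Suc (\<alpha> i)..<\<alpha> (Suc i). dterm i c k')"
        using True by (simp add: sum.atLeast_Suc_lessThan)
      then show ?thesis
        using True by (simp add: e T ddiff_def lin_sum lin_diff lin_uminus d fk)
    next
      case False
      then show ?thesis
        by (simp add: T ddiff_def lin_sum lin_diff lin_uminus d fk)
    qed
    show "opS i (opX i (single k 1)) = ?R (single k 1)"
      by (simp add: op_add gx tw D[symmetric])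
  qed
qed

text \<open>As for \<open>x\<^sub>i\<close>, except that multiplication by \<open>x\<^sub>i\<close> also shifts the index of summation.\<close>

lemma opS_opX_Suc:
  "opS i (opX (Suc i) v) = opX i (opS i v) + opT i (Suc i) v" (is "_ = ?R v")
proof -
  have "linear_map ?R"
    by (rule linear_map_plus[OF linear_map_compose[OF linear_map_lin linear_map_lin] linear_opT])
  then show ?thesis
  proof (rule linear_map_eqI[OF linear_map_compose[OF linear_map_lin linear_map_lin]])
    fix k :: "'g nf"
    obtain \<alpha> g w where k: "k = (\<alpha>, g, w)" by (cases k)
    define k' where "k' = (\<alpha>(Suc i := Suc (\<alpha> (Suc i))), g, w)"
    have fk: "fst k = \<alpha>" "fst k' i = \<alpha> i" "fst k' (Suc i) = Suc (\<alpha> (Suc i))"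
      by (simp_all add: k k'_def)
    have tw: "gen_act (XGen i) (twist i k) = single (twist i k') 1"
      unfolding k k'_def twist_def
      by simp (auto simp: fun_eq_iff transpose_def intro!: arg_cong[where f = "\<lambda>x. single x 1"])
    have T: "opT i (Suc i) (single k 1) = dterm i (\<alpha> i) k'"
      by (simp add: k k'_def opT_single dterm_def)
    have d: "opX i (dterm i c k) = dterm i (Suc c) k'" for c
      by (simp add: k k'_def dterm_def lin_sum opX_single fun_upd_twist)
    have gx: "gen_act (XGen (Suc i)) k = single k' 1"
      by (simp add: k k'_def)
    have sh: "(\<Sum>c = a..<b. dterm i (Suc c) k') = (\<Sum>c = Suc a..<Suc b. dterm i c k')" for a b
      by (rule sum.shift_bounds_Suc_ivl[symmetric])
    have D: "opX i (ddiff i k) + opT i (Suc i) (single k 1) = ddiff i k'"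
    proof (cases "\<alpha> i \<le> \<alpha> (Suc i)")
      case True
      have e: "(\<Sum>c = \<alpha> i..<Suc (\<alpha> (Suc i)). dterm i c k') = dterm i (\<alpha> i) k' + (\<Sum>c = Suc (\<alpha> i)..<Suc (\<alpha> (Suc i)). dterm i c k')"
        using True by (subst sum.atLeast_Suc_lessThan) simp_all
      then show ?thesis
        using True by (simp add: e T ddiff_def lin_sum lin_diff lin_uminus d fk sh del: sum.op_ivl_Suc sum.shift_bounds_Suc_ivl)
    next
      case False
      have e: "(\<Sum>c = Suc (\<alpha> (Suc i))..<Suc (\<alpha> i). dterm i c k') = dterm i (\<alpha> i) k' + (\<Sum>c = Suc (\<alpha> (Suc i))..<\<alpha> i. dterm i c k')"
        using False by simp
      then show ?thesis
        using False by (simp add: e T ddiff_def lin_sum lin_diff lin_uminus d fk sh del: sum.op_ivl_Suc sum.shift_bounds_Suc_ivl)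
    qed
    show "opS i (opX (Suc i) (single k 1)) = ?R (single k 1)"
      by (simp add: op_add gx tw D[symmetric])
  qed
qed

lemma opG_dterm:
  assumes "i \<in> {1..<n}" "g \<in> carrier P" "h \<in> carrier P"
  shows "opG (h \<circ> adj i) (dterm i c (\<alpha>, g, w)) = dterm i c (\<alpha>, h \<otimes>\<^bsub>P\<^esub> g, w)"
proof -
  let ?f = "\<lambda>x. inv (h (Suc i)) \<otimes> x \<otimes> h i"
  have c: "h i \<in> carrier G" "h (Suc i) \<in> carrier G"
    using assms by (auto intro!: P_apply_closed simp del: carrier_product_group)
  have bij: "bij_betw ?f (carrier G) (carrier G)"
  proof (rule bij_betw_byWitness[where f' = "\<lambda>x. h (Suc i) \<otimes> x \<otimes> inv (h i)"])
    have "b \<otimes> (inv b \<otimes> x \<otimes> a) \<otimes> inv a = (b \<otimes> inv b) \<otimes> x \<otimes> (a \<otimes> inv a)"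
      "inv b \<otimes> (b \<otimes> x \<otimes> inv a) \<otimes> a = (inv b \<otimes> b) \<otimes> x \<otimes> (inv a \<otimes> a)"
      if "x \<in> carrier G" "a \<in> carrier G" "b \<in> carrier G" for x a b
    proof -
      have "b \<otimes> (inv b \<otimes> x) = x" "inv b \<otimes> (b \<otimes> x) = x"
        using that by (simp_all add: m_assoc[symmetric])
      then show "b \<otimes> (inv b \<otimes> x \<otimes> a) \<otimes> inv a = (b \<otimes> inv b) \<otimes> x \<otimes> (a \<otimes> inv a)"
        "inv b \<otimes> (b \<otimes> x \<otimes> inv a) \<otimes> a = (inv b \<otimes> b) \<otimes> x \<otimes> (inv a \<otimes> a)"
        using that by (simp_all add: m_assoc)
    qed
    then show "\<forall>x\<in>carrier G. h (Suc i) \<otimes> ?f x \<otimes> inv (h i) = x"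
      "\<forall>x\<in>carrier G. ?f (h (Suc i) \<otimes> x \<otimes> inv (h i)) = x"
      using c by auto
  qed (use c in auto)
  have eq: "tt i (Suc i) x \<otimes>\<^bsub>P\<^esub> (h \<otimes>\<^bsub>P\<^esub> g) = (h \<circ> adj i) \<otimes>\<^bsub>P\<^esub> (tt i (Suc i) (?f x) \<otimes>\<^bsub>P\<^esub> g)"
    if x: "x \<in> carrier G" for x
  proof -
    have cl: "tt i (Suc i) x \<in> carrier P" "tt i (Suc i) (?f x) \<in> carrier P" "h \<circ> adj i \<in> carrier P"
      using assms x c by (simp_all add: comp_adj_closed del: carrier_product_group)
    have "tt i (Suc i) x \<otimes>\<^bsub>P\<^esub> (h \<otimes>\<^bsub>P\<^esub> g) = (tt i (Suc i) x \<otimes>\<^bsub>P\<^esub> h) \<otimes>\<^bsub>P\<^esub> g"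
      using assms cl by (simp only: P.m_assoc)
    also have "\<dots> = (h \<circ> adj i) \<otimes>\<^bsub>P\<^esub> (tt i (Suc i) (?f x) \<otimes>\<^bsub>P\<^esub> g)"
      unfolding tt_mult[OF assms(1,3) x] using assms cl by (simp only: P.m_assoc)
    finally show ?thesis .
  qed
  show ?thesis
    by (simp add: dterm_def lin_sum opG_single eq)
      (rule sum.reindex_bij_betw[OF bij, symmetric])
qed

lemma opS_opG:
  assumes v: "v \<in> nf_space" and i: "i \<in> {1..<n}" and h: "h \<in> carrier P"
  shows "opS i (opG h v) = opG (h \<circ> adj i) (opS i v)"
proof (rule lin_eqI[OF _ _ v]; (rule linear_map_compose[OF linear_map_lin linear_map_lin])?)
  fix \<alpha> g w assume g: "g \<in> carrier P"
  show "opS i (opG h (single (\<alpha>, g, w) 1)) = opG (h \<circ> adj i) (opS i (single (\<alpha>, g, w) 1))"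
    by (simp add: opG_single op_add ddiff_def lin_sum lin_diff lin_uminus opG_dterm[OF i g h] twist_def comp_adj_mult[OF i])
qed

subsection \<open>The space of normal forms is stable\<close>

lemma nf_space_zero [simp]: "0 \<in> nf_space"
  by (simp add: nf_space_def)

lemma nf_space_add [simp]: "u \<in> nf_space \<Longrightarrow> v \<in> nf_space \<Longrightarrow> u + v \<in> nf_space"
  using Poly_Mapping.keys_add[of u v] by (auto simp: nf_space_def)

lemma nf_space_diff [simp]: "u \<in> nf_space \<Longrightarrow> v \<in> nf_space \<Longrightarrow> u - v \<in> nf_space"
  using keys_diff[of u v] by (auto simp: nf_space_def)

lemma nf_space_scale [simp]: "v \<in> nf_space \<Longrightarrow> scale c v \<in> nf_space"
  using keys_scale[of c v] by (auto simp: nf_space_def)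

lemma nf_space_single [simp]: "k \<in> basis_keys \<Longrightarrow> single k c \<in> nf_space"
  by (auto simp: nf_space_def)

lemma nf_space_sum: "(\<And>i. i \<in> I \<Longrightarrow> f i \<in> nf_space) \<Longrightarrow> sum f I \<in> nf_space"
  by (induction I rule: infinite_finite_induct) auto

lemma nf_space_lin:
  "v \<in> nf_space \<Longrightarrow> (\<And>k. k \<in> basis_keys \<Longrightarrow> f k \<in> nf_space) \<Longrightarrow> lin f v \<in> nf_space"
  unfolding lin_def nf_space_def[THEN eqset_imp_iff, of v, unfolded mem_Collect_eq]
  by (intro nf_space_sum nf_space_scale) blast

lemma basis_keysI:
  "\<alpha> \<in> {1..n} \<rightarrow>\<^sub>E UNIV \<Longrightarrow> g \<in> carrier P \<Longrightarrow> w permutes {1..n} \<Longrightarrow> (\<alpha>, g, w) \<in> basis_keys"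
  by (simp add: basis_keys_def)

lemma basis_keysE:
  assumes "k \<in> basis_keys"
  obtains \<alpha> g w where "k = (\<alpha>, g, w)" "\<alpha> \<in> {1..n} \<rightarrow>\<^sub>E UNIV" "g \<in> carrier P" "w permutes {1..n}"
  using assms by (auto simp: basis_keys_def simp del: carrier_product_group PiE_iff)

lemma twist_closed: "i \<in> {1..<n} \<Longrightarrow> k \<in> basis_keys \<Longrightarrow> twist i k \<in> basis_keys"
  by (elim basis_keysE, simp only: twist_def prod.case,
      intro basis_keysI comp_adj_ext comp_adj_closed permutes_compose permutes_swap_id) auto

lemma upd_ext: "j \<in> I \<Longrightarrow> \<alpha> \<in> I \<rightarrow>\<^sub>E UNIV \<Longrightarrow> \<alpha>(j := c) \<in> I \<rightarrow>\<^sub>E UNIV"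
  by (auto simp: PiE_iff extensional_def)

lemma dterm_closed: "i \<in> {1..<n} \<Longrightarrow> k \<in> basis_keys \<Longrightarrow> dterm i c k \<in> nf_space"
  by (elim basis_keysE, simp only: dterm_def prod.case,
      intro nf_space_sum nf_space_single basis_keysI upd_ext P.m_closed tt_closed) auto

lemma ddiff_closed: "i \<in> {1..<n} \<Longrightarrow> k \<in> basis_keys \<Longrightarrow> ddiff i k \<in> nf_space"
  by (auto simp: ddiff_def dterm_closed intro!: nf_space_diff nf_space_sum)

lemma opX_closed [simp]: "j \<in> {1..n} \<Longrightarrow> v \<in> nf_space \<Longrightarrow> opX j v \<in> nf_space"
  by (erule nf_space_lin, erule basis_keysE, simp only: gen_act_simps)
    (intro nf_space_single basis_keysI upd_ext)

lemma opG_closed [simp]: "g \<in> carrier P \<Longrightarrow> v \<in> nf_space \<Longrightarrow> opG g v \<in> nf_space"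
  by (erule nf_space_lin, erule basis_keysE, simp only: gen_act_simps)
    (intro nf_space_single basis_keysI P.m_closed)

lemma opS_closed [simp]: "i \<in> {1..<n} \<Longrightarrow> v \<in> nf_space \<Longrightarrow> opS i v \<in> nf_space"
  by (rule nf_space_lin) (auto simp: twist_closed ddiff_closed)

lemma opT_closed [simp]: "v \<in> nf_space \<Longrightarrow> opT j k v \<in> nf_space"
  by (simp add: opT_def nf_space_sum del: carrier_product_group)

abbreviation zero_exp :: "nat \<Rightarrow> nat" where "zero_exp \<equiv> \<lambda>k\<in>{1..n}. 0"

lemma ddiff_eq_0: "fst k i = fst k (Suc i) \<Longrightarrow> ddiff i k = 0"
  by (simp add: ddiff_def)

lemma opS_zero_exp:
  assumes "i \<in> {1..<n}"
  shows "opS i (single (zero_exp, g, w) 1) = single (zero_exp, g \<circ> adj i, adj i \<circ> w) 1"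
proof -
  have "zero_exp \<circ> adj i = zero_exp"
    using assms adj_in_iff[of i n] by (auto simp: fun_eq_iff restrict_def simp del: atLeastAtMost_iff)
  moreover have "ddiff i (zero_exp, g, w) = (0 :: 'g nf \<Rightarrow>\<^sub>0 'f::field)"
    using assms by (intro ddiff_eq_0) auto
  ultimately show ?thesis
    by (simp add: twist_def)
qed

text \<open>The permutations generate the space of normal forms under \<open>G\<^sup>n\<close> and the \<open>x\<^sub>j\<close>. Two operators that pass
  these generators in the same way are therefore equal as soon as they agree on permutations.\<close>

lemma nf_space_induct_eq:
  assumes T: "linear_map T" and U: "linear_map U" and v: "v \<in> nf_space"
    and base: "\<And>w. w permutes {1..n} \<Longrightarrow>
      T (single (zero_exp, \<one>\<^bsub>P\<^esub>, w) 1) = U (single (zero_exp, \<one>\<^bsub>P\<^esub>, w) 1)"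
    and G: "\<And>h v. \<lbrakk>h \<in> carrier P; v \<in> nf_space; T v = U v\<rbrakk> \<Longrightarrow> T (opG h v) = U (opG h v)"
    and X: "\<And>j v. \<lbrakk>j \<in> {1..n}; v \<in> nf_space; T v = U v\<rbrakk> \<Longrightarrow> T (opX j v) = U (opX j v)"
  shows "T v = U v"
proof (rule lin_eqI[OF T U v])
  fix \<alpha> g w
  assume \<alpha>: "\<alpha> \<in> {1..n} \<rightarrow>\<^sub>E (UNIV :: nat set)" and g: "g \<in> carrier P" and w: "w permutes {1..n}"
  from \<alpha> show "T (single (\<alpha>, g, w) 1) = U (single (\<alpha>, g, w) 1)"
  proof (induction "sum \<alpha> {1..n}" arbitrary: \<alpha>)
    case 0
    then have \<alpha>: "\<alpha> = zero_exp"
      by (auto simp: fun_eq_iff PiE_iff extensional_def)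
    have eq: "single (\<alpha>, g, w) 1 = opG g (single (zero_exp, \<one>\<^bsub>P\<^esub>, w) 1)"
      using g by (simp add: \<alpha> del: carrier_product_group)
    have "(zero_exp, \<one>\<^bsub>P\<^esub>, w) \<in> basis_keys"
      using w by (intro basis_keysI) (auto simp del: carrier_product_group)
    then show ?case
      unfolding eq by (intro G[OF g] base[OF w] nf_space_single)
  next
    case (Suc d)
    then obtain j where j: "j \<in> {1..n}" "\<alpha> j > 0"
      by (metis gr0I nat.distinct(1) sum.neutral)
    define \<beta> where "\<beta> = \<alpha>(j := \<alpha> j - 1)"
    have \<alpha>\<beta>: "\<alpha> = \<beta>(j := Suc (\<beta> j))"
      using j by (simp add: \<beta>_def)
    have \<beta>: "\<beta> \<in> {1..n} \<rightarrow>\<^sub>E UNIV"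
      using Suc.prems j by (auto simp: \<beta>_def PiE_iff extensional_def)
    have "sum \<alpha> {1..n} = Suc (sum \<beta> {1..n})"
      using j by (simp add: sum.remove[of "{1..n}" j] \<beta>_def)
    then have IH: "T (single (\<beta>, g, w) 1) = U (single (\<beta>, g, w) 1)"
      using Suc.hyps \<beta> by auto
    have eq: "single (\<alpha>, g, w) 1 = opX j (single (\<beta>, g, w) 1)"
      by (subst \<alpha>\<beta>) simp
    show ?case
      unfolding eq by (intro X[OF j(1)] IH nf_space_single basis_keysI \<beta> g w)
  qed
qed

subsection \<open>The defining relations hold for the operators\<close>

lemma opT_commute: "j \<noteq> k \<Longrightarrow> opT j k v = opT k j v"
  unfolding opT_def
  by (rule sum.reindex_bij_witness[where i = "\<lambda>h. inv h" and j = "\<lambda>h. inv h"])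
    (simp_all add: tt_swap[of _ j k])

lemma opS_opT:
  assumes "v \<in> nf_space" "i \<in> {1..<n}"
  shows "opS i (opT j k v) = opT (adj i j) (adj i k) (opS i v)"
  by (simp add: opT_def lin_sum opS_opG[OF assms] tt_comp_adj[OF assms(2)] del: carrier_product_group)

lemma opS_opT_same:
  assumes "v \<in> nf_space" "i \<in> {1..<n}"
  shows "opS i (opT i (Suc i) v) = opT i (Suc i) (opS i v)"
  using opS_opT[OF assms, of i "Suc i"] opT_commute[of i "Suc i" "opS i v"] by simp

text \<open>Both sides commute with every \<open>g\<close> and \<open>x\<^sub>j\<close>: in moving \<open>s\<^sub>i\<^sup>2\<close> past \<open>x\<^sub>i\<close> the two corrections
  \<open>- s\<^sub>i t\<^sub>i\<^sub>,\<^sub>i\<^sub>+\<^sub>1\<close> and \<open>t\<^sub>i\<^sub>,\<^sub>i\<^sub>+\<^sub>1 s\<^sub>i\<close> cancel.\<close>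

lemma opS_square:
  assumes v: "v \<in> nf_space" and i: "i \<in> {1..<n}"
  shows "opS i (opS i v) = v"
proof (rule nf_space_induct_eq[where T = "\<lambda>v. opS i (opS i v)" and U = "\<lambda>v. v", OF _ linear_map_id v])
  show "linear_map (\<lambda>v. opS i (opS i v))"
    by (rule linear_map_compose[OF linear_map_lin linear_map_lin])
  show "opS i (opS i (single (zero_exp, \<one>\<^bsub>P\<^esub>, w) 1)) = single (zero_exp, \<one>\<^bsub>P\<^esub>, w) 1" for w
    by (simp only: opS_zero_exp[OF i] comp_assoc[symmetric] comp_adj_one[OF i]) (simp add: comp_assoc)
  show "opS i (opS i (opG h v)) = opG h v"
    if "h \<in> carrier P" "v \<in> nf_space" "opS i (opS i v) = v" for h v
    using that i by (simp add: opS_opG comp_adj_closed comp_assoc del: carrier_product_group)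
  show "opS i (opS i (opX j v)) = opX j v"
    if "j \<in> {1..n}" "v \<in> nf_space" "opS i (opS i v) = v" for j v
  proof -
    consider "j = i" | "j = Suc i" | "j \<noteq> i" "j \<noteq> Suc i" by blast
    then show ?thesis
      by cases (use that i in \<open>simp_all add: opS_opX opS_opX_Suc opS_opX_far op_add op_diff opS_opT_same\<close>)
  qed
qed

lemma opS_opS_far:
  assumes v: "v \<in> nf_space" and i: "i \<in> {1..<n}" and j: "j \<in> {1..<n}" and ij: "Suc i < j"
  shows "opS i (opS j v) = opS j (opS i v)"
proof (rule nf_space_induct_eq[where T = "\<lambda>v. opS i (opS j v)" and U = "\<lambda>v. opS j (opS i v)", OF _ _ v])
  show "linear_map (\<lambda>v. opS i (opS j v))" "linear_map (\<lambda>v. opS j (opS i v))"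
    by (rule linear_map_compose[OF linear_map_lin linear_map_lin])+
  have c: "adj i (adj j k) = adj j (adj i k)" for k
    using ij by (auto simp: transpose_def)
  have c': "f \<circ> adj i \<circ> adj j = f \<circ> adj j \<circ> adj i" "adj i \<circ> (adj j \<circ> f') = adj j \<circ> (adj i \<circ> f')"
    for f :: "nat \<Rightarrow> 'b" and f' :: "'c \<Rightarrow> nat"
    by (simp_all add: fun_eq_iff c)
  show "opS i (opS j (single (zero_exp, \<one>\<^bsub>P\<^esub>, w) 1)) = opS j (opS i (single (zero_exp, \<one>\<^bsub>P\<^esub>, w) 1))" for w
    by (simp only: opS_zero_exp[OF i] opS_zero_exp[OF j] comp_adj_one[OF i] comp_adj_one[OF j] c')
  show "opS i (opS j (opG h v)) = opS j (opS i (opG h v))"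
    if "h \<in> carrier P" "v \<in> nf_space" "opS i (opS j v) = opS j (opS i v)" for h v
    using that i j by (simp add: opS_opG comp_adj_closed c' del: carrier_product_group)
  show "opS i (opS j (opX k v)) = opS j (opS i (opX k v))"
    if "k \<in> {1..n}" "v \<in> nf_space" "opS i (opS j v) = opS j (opS i v)" for k v
  proof -
    have t: "adj i j = j" "adj i (Suc j) = Suc j" "adj j i = i" "adj j (Suc i) = Suc i"
      using ij by (auto simp: transpose_def)
    have T: "opS i (opT j (Suc j) v) = opT j (Suc j) (opS i v)"
      "opS j (opT i (Suc i) v) = opT i (Suc i) (opS j v)"
      using opS_opT[OF that(2) i, of j "Suc j"] opS_opT[OF that(2) j, of i "Suc i"] t by auto
    consider "k = i" | "k = Suc i" | "k = j" | "k = Suc j" | "k \<noteq> i" "k \<noteq> Suc i" "k \<noteq> j" "k \<noteq> Suc j" by blast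
    then show ?thesis
      by cases (use that i j ij T in \<open>simp_all add: opS_opX opS_opX_Suc opS_opX_far op_add op_diff\<close>)
  qed
qed

text \<open>Moving either side past \<open>x\<^sub>i\<close>, \<open>x\<^sub>i\<^sub>+\<^sub>1\<close> or \<open>x\<^sub>i\<^sub>+\<^sub>2\<close> produces the same corrections, because \<open>s\<^sub>k t\<^sub>a\<^sub>b\<close>
  is \<open>t\<close> with permuted indices times \<open>s\<^sub>k\<close>, and \<open>s\<^sub>k\<^sup>2 = 1\<close>.\<close>

lemma opS_braid:
  assumes v: "v \<in> nf_space" and i: "i \<in> {1..<n}" and j: "Suc i \<in> {1..<n}"
  shows "opS i (opS (Suc i) (opS i v)) = opS (Suc i) (opS i (opS (Suc i) v))"
proof (rule nf_space_induct_eq[where T = "\<lambda>v. opS i (opS (Suc i) (opS i v))"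
      and U = "\<lambda>v. opS (Suc i) (opS i (opS (Suc i) v))", OF _ _ v])
  show "linear_map (\<lambda>v. opS i (opS (Suc i) (opS i v)))" "linear_map (\<lambda>v. opS (Suc i) (opS i (opS (Suc i) v)))"
    by (rule linear_map_compose[OF linear_map_lin linear_map_compose[OF linear_map_lin linear_map_lin]])+
  have c: "adj i (adj (Suc i) (adj i k)) = adj (Suc i) (adj i (adj (Suc i) k))" for k
    by (auto simp: transpose_def)
  have c': "f \<circ> adj i \<circ> adj (Suc i) \<circ> adj i = f \<circ> adj (Suc i) \<circ> adj i \<circ> adj (Suc i)"
    "adj i \<circ> (adj (Suc i) \<circ> (adj i \<circ> f')) = adj (Suc i) \<circ> (adj i \<circ> (adj (Suc i) \<circ> f'))"
    for f :: "nat \<Rightarrow> 'b" and f' :: "'c \<Rightarrow> nat"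
    by (simp_all add: fun_eq_iff c)
  show "opS i (opS (Suc i) (opS i (single (zero_exp, \<one>\<^bsub>P\<^esub>, w) 1)))
      = opS (Suc i) (opS i (opS (Suc i) (single (zero_exp, \<one>\<^bsub>P\<^esub>, w) 1)))" for w
    by (simp only: opS_zero_exp[OF i] opS_zero_exp[OF j] comp_adj_one[OF i] comp_adj_one[OF j] c')
  show "opS i (opS (Suc i) (opS i (opG h v))) = opS (Suc i) (opS i (opS (Suc i) (opG h v)))"
    if "h \<in> carrier P" "v \<in> nf_space" "opS i (opS (Suc i) (opS i v)) = opS (Suc i) (opS i (opS (Suc i) v))" for h v
    using that i j by (simp add: opS_opG comp_adj_closed c' del: carrier_product_group)
  show "opS i (opS (Suc i) (opS i (opX k v))) = opS (Suc i) (opS i (opS (Suc i) (opX k v)))"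
    if "k \<in> {1..n}" "v \<in> nf_space" "opS i (opS (Suc i) (opS i v)) = opS (Suc i) (opS i (opS (Suc i) v))" for k v
  proof -
    have T: "opS i (opT (Suc i) (Suc (Suc i)) u) = opT i (Suc (Suc i)) (opS i u)"
      "opS i (opT i (Suc (Suc i)) u) = opT (Suc i) (Suc (Suc i)) (opS i u)"
      "opS (Suc i) (opT i (Suc (Suc i)) u) = opT i (Suc i) (opS (Suc i) u)"
      "opS (Suc i) (opT i (Suc i) u) = opT i (Suc (Suc i)) (opS (Suc i) u)"
      "opS i (opT i (Suc i) u) = opT i (Suc i) (opS i u)"
      "opS (Suc i) (opT (Suc i) (Suc (Suc i)) u) = opT (Suc i) (Suc (Suc i)) (opS (Suc i) u)"
      if u: "u \<in> nf_space" for u :: "'g nf \<Rightarrow>\<^sub>0 'b"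
      using opS_opT[OF u i] opS_opT[OF u j] opS_opT_same[OF u i] opS_opT_same[OF u j] by (simp_all add: transpose_def)
    consider "k = i" | "k = Suc i" | "k = Suc (Suc i)" | "k \<noteq> i" "k \<noteq> Suc i" "k \<noteq> Suc (Suc i)" by blast
    then show ?thesis
      by cases (use that i j in \<open>simp_all add: opS_opX opS_opX_Suc opS_opX_far op_add op_diff T opS_square\<close>)
  qed
qed

end

section \<open>Words in adjacent transpositions\<close>

text \<open>Equality of words by the Coxeter relations. All letters stay in \<open>{1..<n}\<close>, so that each step can be
  imitated in the wreath Hecke algebra.\<close>

inductive coxeter_eq :: "nat \<Rightarrow> nat list \<Rightarrow> nat list \<Rightarrow> bool" for n where
  cox_refl: "set u \<subseteq> {1..<n} \<Longrightarrow> coxeter_eq n u u"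
| cox_sym: "coxeter_eq n u v \<Longrightarrow> coxeter_eq n v u"
| cox_trans: "coxeter_eq n u v \<Longrightarrow> coxeter_eq n v w \<Longrightarrow> coxeter_eq n u w"
| cox_embed: "\<lbrakk>coxeter_eq n u v; set a \<subseteq> {1..<n}; set b \<subseteq> {1..<n}\<rbrakk> \<Longrightarrow> coxeter_eq n (a @ u @ b) (a @ v @ b)"
| cox_square: "i \<in> {1..<n} \<Longrightarrow> coxeter_eq n [i, i] []"
| cox_commute: "\<lbrakk>i \<in> {1..<n}; j \<in> {1..<n}; Suc i < j \<or> Suc j < i\<rbrakk> \<Longrightarrow> coxeter_eq n [i, j] [j, i]"
| cox_braid: "\<lbrakk>i \<in> {1..<n}; Suc i \<in> {1..<n}\<rbrakk> \<Longrightarrow> coxeter_eq n [i, Suc i, i] [Suc i, i, Suc i]"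

definition word_perm :: "nat list \<Rightarrow> nat \<Rightarrow> nat" where
  "word_perm u = foldr (\<lambda>i w. adj i \<circ> w) u id"

lemma word_perm_simps [simp]:
  "word_perm [] = id" "word_perm (i # u) = adj i \<circ> word_perm u"
  by (simp_all add: word_perm_def)

lemma word_perm_append [simp]: "word_perm (u @ v) = word_perm u \<circ> word_perm v"
  by (induction u) (simp_all add: comp_assoc)

lemma word_perm_permutes: "set u \<subseteq> {1..<m} \<Longrightarrow> word_perm u permutes {1..m}"
  by (induction u) (auto intro!: permutes_compose permutes_swap_id permutes_id)

lemma word_perm_upt: "k \<le> m \<Longrightarrow> word_perm [k..<m] m = k"
proof (induction "m - k" arbitrary: k)
  case (Suc d)
  then have "[k..<m] = k # [Suc k..<m]" "word_perm [Suc k..<m] m = Suc k"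
    by (auto simp: upt_conv_Cons)
  then show ?case by simp
qed auto

lemma coxeter_eq_imp_perm: "coxeter_eq n u v \<Longrightarrow> word_perm u = word_perm v"
  by (induction rule: coxeter_eq.induct) (auto simp: fun_eq_iff transpose_def)

lemma coxeter_eq_Cons: "coxeter_eq n u v \<Longrightarrow> i \<in> {1..<n} \<Longrightarrow> coxeter_eq n (i # u) (i # v)"
  using coxeter_eq.cox_embed[of n u v "[i]" "[]"] by simp

lemma coxeter_eq_append: "coxeter_eq n u v \<Longrightarrow> set b \<subseteq> {1..<n} \<Longrightarrow> coxeter_eq n (u @ b) (v @ b)"
  using coxeter_eq.cox_embed[of n u v "[]" b] by simp

lemma coxeter_eq_prepend: "coxeter_eq n u v \<Longrightarrow> set a \<subseteq> {1..<n} \<Longrightarrow> coxeter_eq n (a @ u) (a @ v)"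
  using coxeter_eq.cox_embed[of n u v a "[]"] by simp

lemma coxeter_eq_move:
  assumes "i \<in> {1..<n}" "set l \<subseteq> {1..<n}" "\<forall>j\<in>set l. Suc i < j \<or> Suc j < i"
  shows "coxeter_eq n (i # l) (l @ [i])"
  using assms(2,3)
proof (induction l)
  case Nil
  then show ?case using assms(1) by (auto intro: coxeter_eq.cox_refl)
next
  case (Cons j l)
  have "coxeter_eq n ([i, j] @ l) ([j, i] @ l)"
    using Cons.prems assms(1) by (intro coxeter_eq_append coxeter_eq.cox_commute) auto
  moreover have "coxeter_eq n (j # i # l) (j # l @ [i])"
    using Cons by (intro coxeter_eq_Cons) auto
  ultimately show ?case
    by (auto intro: coxeter_eq.cox_trans)
qed

text \<open>Each permutation of \<open>{1..m + 1}\<close> is \<open>s\<^sub>k s\<^sub>k\<^sub>+\<^sub>1 \<cdots> s\<^sub>m\<close> times a permutation of \<open>{1..m}\<close>. The words of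
  this shape are stable under prefixing a letter \<open>i\<close>: it lengthens or shortens the chain if
  \<open>i = k - 1\<close> or \<open>i = k\<close>, and otherwise passes through it, unchanged if \<open>i < k - 1\<close> and as \<open>i - 1\<close>
  if \<open>i > k\<close>.\<close>

lemma coxeter_normal_form_step:
  assumes "Suc m \<le> n" "i \<in> {1..m}" "k \<in> {1..Suc m}" "set u \<subseteq> {1..<m}"
  shows "\<exists>k' u'. k' \<in> {1..Suc m} \<and> set u' \<subseteq> {1..<m} \<and>
    coxeter_eq n (i # [k..<Suc m] @ u) ([k'..<Suc m] @ u')"
proof -
  have u: "set u \<subseteq> {1..<n}"
    using assms by auto
  consider "k = Suc i" | "k = i" | "Suc i < k" | "k < i"
    by linarith
  then show ?thesis
  proof cases
    case 1
    then have eq: "i # [k..<Suc m] @ u = [i..<Suc m] @ u"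
      using assms by (simp add: upt_conv_Cons del: upt_Suc)
    have "coxeter_eq n (i # [k..<Suc m] @ u) ([i..<Suc m] @ u)"
      unfolding eq using assms u by (intro coxeter_eq.cox_refl) auto
    then show ?thesis
      using assms by (intro exI[of _ i] exI[of _ u]) (simp del: upt_Suc)
  next
    case 2
    have "coxeter_eq n ([i, i] @ ([Suc i..<Suc m] @ u)) ([] @ ([Suc i..<Suc m] @ u))"
      using assms u by (intro coxeter_eq_append coxeter_eq.cox_square) auto
    moreover have eq: "i # [k..<Suc m] @ u = [i, i] @ ([Suc i..<Suc m] @ u)"
      using 2 assms by (simp add: upt_conv_Cons del: upt_Suc)
    ultimately have "coxeter_eq n (i # [k..<Suc m] @ u) ([Suc i..<Suc m] @ u)"
      unfolding eq by simp
    then show ?thesis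
      using assms by (intro exI[of _ "Suc i"] exI[of _ u]) (simp del: upt_Suc)
  next
    case 3
    have "coxeter_eq n ((i # [k..<Suc m]) @ u) (([k..<Suc m] @ [i]) @ u)"
      using 3 assms u by (intro coxeter_eq_append coxeter_eq_move) auto
    then show ?thesis
      using 3 assms by (intro exI[of _ k] exI[of _ "i # u"]) (simp del: upt_Suc)
  next
    case 4
    then obtain j where j: "i = Suc j" "k \<le> j" by (cases i) auto
    let ?a = "[k..<j]" and ?b = "[Suc i..<Suc m]"
    have "[k..<Suc m] = ?a @ [j..<Suc m]"
      using j assms upt_add_eq_append[of k j "Suc m - j"] by (simp del: upt_Suc)
    then have split: "[k..<Suc m] = ?a @ [j, i] @ ?b"
      using j assms by (simp add: upt_conv_Cons del: upt_Suc)
    have jn: "j \<in> {1..<n}" "i \<in> {1..<n}" "set ?a \<subseteq> {1..<n}" "set ?b \<subseteq> {1..<n}"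
      using j assms by auto
    \<comment> \<open>\<open>i a j i b = a (i j i) b = a (j i j) b = a j i b j\<close>\<close>
    have "coxeter_eq n ((i # ?a) @ ([j, i] @ ?b @ u)) ((?a @ [i]) @ ([j, i] @ ?b @ u))"
      using j jn u by (intro coxeter_eq_append coxeter_eq_move) auto
    moreover have "coxeter_eq n (?a @ [i, j, i] @ ?b @ u) (?a @ [j, i, j] @ ?b @ u)"
      using jn u coxeter_eq.cox_sym[OF coxeter_eq.cox_braid[of j n]] unfolding j(1)
      by (intro coxeter_eq_prepend coxeter_eq_append) (auto simp del: upt_Suc)
    moreover have "coxeter_eq n ((?a @ [j, i]) @ (j # ?b) @ u) ((?a @ [j, i]) @ (?b @ [j]) @ u)"
      using j jn u by (intro coxeter_eq_prepend coxeter_eq_append coxeter_eq_move) auto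
    ultimately have "coxeter_eq n (i # [k..<Suc m] @ u) ([k..<Suc m] @ j # u)"
      unfolding split by (auto intro: coxeter_eq.cox_trans simp del: upt_Suc)
    then show ?thesis
      using j assms by (intro exI[of _ k] exI[of _ "j # u"]) (simp del: upt_Suc)
  qed
qed

lemma coxeter_normal_form:
  assumes "Suc m \<le> n" "set u \<subseteq> {1..<Suc m}"
  shows "\<exists>k u'. k \<in> {1..Suc m} \<and> set u' \<subseteq> {1..<m} \<and> coxeter_eq n u ([k..<Suc m] @ u')"
  using assms(2)
proof (induction u)
  case Nil
  then show ?case
    by (intro exI[of _ "Suc m"] exI[of _ "[]"]) (auto intro: coxeter_eq.cox_refl)
next
  case (Cons i u)
  then obtain k u' where k: "k \<in> {1..Suc m}" "set u' \<subseteq> {1..<m}" "coxeter_eq n u ([k..<Suc m] @ u')"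
    by auto
  have i: "i \<in> {1..m}" "i \<in> {1..<n}"
    using Cons.prems assms(1) by auto
  from coxeter_normal_form_step[OF assms(1) i(1) k(1,2)] coxeter_eq_Cons[OF k(3) i(2)]
  show ?case
    by (meson coxeter_eq.cox_trans)
qed

text \<open>The symmetric group is presented by the Coxeter relations: in the normal form
  \<open>s\<^sub>k \<cdots> s\<^sub>m u'\<close> the number \<open>k\<close> is the image of \<open>m + 1\<close>, so equal permutations have the same chain,
  and the rest follows by induction.\<close>

lemma coxeter_eqI:
  assumes "m \<le> n" "set u \<subseteq> {1..<m}" "set v \<subseteq> {1..<m}" "word_perm u = word_perm v"
  shows "coxeter_eq n u v"
  using assms
proof (induction m arbitrary: u v)
  case 0
  then show ?case by (auto intro: coxeter_eq.cox_refl)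
next
  case (Suc m)
  obtain k u' where k: "k \<in> {1..Suc m}" "set u' \<subseteq> {1..<m}" "coxeter_eq n u ([k..<Suc m] @ u')"
    using coxeter_normal_form[OF Suc.prems(1,2)] by blast
  obtain l v' where l: "l \<in> {1..Suc m}" "set v' \<subseteq> {1..<m}" "coxeter_eq n v ([l..<Suc m] @ v')"
    using coxeter_normal_form[OF Suc.prems(1,3)] by blast
  have eq: "word_perm [k..<Suc m] \<circ> word_perm u' = word_perm [l..<Suc m] \<circ> word_perm v'"
    using coxeter_eq_imp_perm[OF k(3)] coxeter_eq_imp_perm[OF l(3)] Suc.prems(4)
    unfolding word_perm_append by metis
  have "word_perm u' (Suc m) = Suc m" "word_perm v' (Suc m) = Suc m"
    using word_perm_permutes[OF k(2)] word_perm_permutes[OF l(2)] by (auto simp: permutes_def)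
  then have kl: "k = l"
    using fun_cong[OF eq, of "Suc m"] k(1) l(1) by (simp add: word_perm_upt del: upt_Suc)
  have sub: "set [k..<Suc m] \<subseteq> {1..<Suc m}"
    using k(1) by auto
  have "inj (word_perm [k..<Suc m])"
    using permutes_inj[OF word_perm_permutes[OF sub]] .
  then have "word_perm u' = word_perm v'"
    using eq unfolding kl by (metis fun.inj_map_strong inj_def fun_eq_iff comp_apply)
  then have "coxeter_eq n u' v'"
    using Suc.IH Suc.prems(1) k(2) l(2) by simp
  then have "coxeter_eq n ([k..<Suc m] @ u') ([l..<Suc m] @ v')"
    unfolding kl using sub Suc.prems(1) by (intro coxeter_eq_prepend) (auto simp: kl)
  then show ?case
    using k(3) l(3) by (meson coxeter_eq.cox_sym coxeter_eq.cox_trans)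
qed

lemma word_perm_surj: "w permutes {1..m} \<Longrightarrow> \<exists>u. set u \<subseteq> {1..<m} \<and> word_perm u = w"
proof (induction m arbitrary: w)
  case 0
  then show ?case by (intro exI[of _ "[]"]) (auto simp: fun_eq_iff)
next
  case (Suc m)
  define k where "k = w (Suc m)"
  have k: "k \<in> {1..Suc m}"
    using permutes_in_image[OF Suc.prems, of "Suc m"] by (simp add: k_def)
  define c where "c = word_perm [k..<Suc m]"
  have sub: "set [k..<Suc m] \<subseteq> {1..<Suc m}"
    using k by auto
  have c: "c permutes {1..Suc m}"
    unfolding c_def by (rule word_perm_permutes[OF sub])
  have ck: "c (Suc m) = k"
    unfolding c_def using k by (intro word_perm_upt) auto
  have A: "inv_into UNIV c \<circ> w permutes {1..Suc m}"
    using permutes_compose[OF Suc.prems permutes_inv[OF c]] .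
  have B: "(inv_into UNIV c \<circ> w) (Suc m) = Suc m"
    using permutes_inverses(2)[OF c, of "Suc m"] by (simp add: ck k_def)
  have "inv_into UNIV c \<circ> w permutes {1..m}"
  proof (rule permutes_superset[OF A])
    fix x assume "x \<in> {1..Suc m} - {1..m}"
    then have "x = Suc m" by auto
    then show "(inv_into UNIV c \<circ> w) x = x" using B by simp
  qed
  then obtain u where u: "set u \<subseteq> {1..<m}" "word_perm u = inv_into UNIV c \<circ> w"
    using Suc.IH by blast
  have "word_perm ([k..<Suc m] @ u) = c \<circ> (inv_into UNIV c \<circ> w)"
    unfolding word_perm_append u(2) c_def ..
  also have "\<dots> = w"
    using permutes_inverses(1)[OF c] by (simp add: fun_eq_iff)
  finally have "word_perm ([k..<Suc m] @ u) = w" .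
  moreover have "set ([k..<Suc m] @ u) \<subseteq> {1..<Suc m}"
    using u(1) sub by auto
  ultimately show ?case by blast
qed

section \<open>The operators define a module over the wreath Hecke algebra\<close>

context wreath_data
begin

abbreviation F :: "('g, 'f::field) free_hecke set" where
  "F \<equiv> carrier (free_algebra (hecke_gens G n))"

lemma gens_closed [simp]:
  shows "g \<in> carrier P \<Longrightarrow> gL g \<in> F" and "i \<in> {1..<n} \<Longrightarrow> sL i \<in> F" and "j \<in> {1..n} \<Longrightarrow> xL j \<in> F"
  by (auto intro!: letter_free_algebra simp: hecke_gens_def simp del: carrier_product_group)

declare free_algebra_closed [simp]

lemma prod_list_F: "(\<And>a. a \<in> set as \<Longrightarrow> f a \<in> F) \<Longrightarrow> prod_list (map f as) \<in> F"
  by (induction as) auto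

lemma power_F [simp]: "p \<in> F \<Longrightarrow> p ^ k \<in> F"
  by (induction k) auto

lemma scale_F [simp]: "p \<in> F \<Longrightarrow> scale c p \<in> F"
  using times_free_algebra[OF scalar_free_algebra] by (simp add: scale_eq_mult flip: scalar_def)

text \<open>Words are built by prefixing letters, so it is enough to treat left multiplication by generators.\<close>

lemma F_induct [consumes 1, case_names scalar letter add]:
  fixes p :: "('g, 'f::field) free_hecke"
  assumes p: "p \<in> F"
    and scalar: "\<And>c. Q (scalar c)"
    and letter: "\<And>a p. \<lbrakk>a \<in> hecke_gens G n; p \<in> F; Q p\<rbrakk> \<Longrightarrow> Q (letter a * p)"
    and add: "\<And>p q. \<lbrakk>p \<in> F; q \<in> F; Q p; Q q\<rbrakk> \<Longrightarrow> Q (p + q)"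
  shows "Q p"
proof -
  have word: "single (Word as) c \<in> F \<and> Q (single (Word as) c)" if "set as \<subseteq> hecke_gens G n" for as and c :: 'f
    using that
  proof (induction as)
    case Nil
    have "single (Word []) c = (scalar c :: ('g, 'f) free_hecke)"
      by (simp add: scalar_def zero_word_def)
    then show ?case using scalar by simp
  next
    case (Cons a as)
    have "single (Word (a # as)) c = (letter a * single (Word as) c :: ('g, 'f) free_hecke)"
      by (simp add: letter_def mult_single plus_word_def)
    then show ?case
      using Cons letter by (simp add: letter_free_algebra)
  qed
  have "(\<Sum>w\<in>A. single w (lookup p w)) \<in> F \<and> Q (\<Sum>w\<in>A. single w (lookup p w))"
    if "finite A" "A \<subseteq> keys p" for A
    using that
  proof (induction A)
    case empty
    have "scalar 0 = (0 :: ('g, 'f) free_hecke)" by (simp add: scalar_def)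
    then show ?case using scalar[of 0] by simp
  next
    case (insert w A)
    have "set (letters w) \<subseteq> hecke_gens G n"
      using p insert.prems by (auto simp: free_algebra_def)
    then have "single w (lookup p w) \<in> F \<and> Q (single w (lookup p w))"
      using word[of "letters w"] by simp
    then show ?case
      using insert add by simp
  qed
  from this[of "keys p"] show ?thesis
    using lin_expand[of p] by (simp add: lin_def)
qed

definition hact :: "('g, 'f::field) free_hecke \<Rightarrow> ('g nf \<Rightarrow>\<^sub>0 'f) \<Rightarrow> ('g nf \<Rightarrow>\<^sub>0 'f)" where
  "hact = free_act gen_act"

lemma hact_simps [simp]:
  "hact (p * q) v = hact p (hact q v)" "hact 1 v = v" "hact (letter a) v = lin (gen_act a) v"
  "hact (scalar c) v = scale c v" "hact (p + q) v = hact p v + hact q v"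
  "hact (p - q) v = hact p v - hact q v" "hact 0 v = 0"
  "hact (scale c p) v = scale c (hact p v)"
  by (simp_all add: hact_def free_act_add free_act_diff free_act_zero free_act_scale)

lemma linear_hact: "linear_map (hact p)"
  unfolding hact_def by (rule linear_map_free_act)

lemma linear_hact_left: "linear_map (\<lambda>p. hact p v)"
  unfolding hact_def by (rule linear_map_free_act_left)

lemma gen_op_closed:
  assumes "a \<in> hecke_gens G n" "v \<in> nf_space"
  shows "lin (gen_act a) v \<in> nf_space"
  using assms by (auto simp: hecke_gens_def simp del: carrier_product_group)

lemma hact_closed [simp]: "p \<in> F \<Longrightarrow> v \<in> nf_space \<Longrightarrow> hact p v \<in> nf_space"
  by (induction p rule: F_induct) (auto simp: gen_op_closed)

lemma hact_tL: "hact (tL G n j k) v = opT j k v"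
  by (simp add: tL_def opT_def tt_def linear_map_sum[OF linear_hact_left])

text \<open>The relations of the algebra are the identities between the operators proved above.\<close>

lemma hact_rel:
  assumes "r \<in> hecke_rels G n" "v \<in> nf_space"
  shows "hact r v = 0"
  using assms(1)
proof cases
  case (s_commute i j)
  then show ?thesis
    using assms(2) opS_opS_far[of v i j] opS_opS_far[of v j i] by auto
next
  case (s_g i g)
  then have "g \<in> {1..n} \<rightarrow>\<^sub>E carrier G"
    by simp
  then have "perm_tuple n (transpose i (i + 1)) g = g \<circ> adj i"
    using perm_tuple_adj[of i n g "carrier G"] s_g(2) unfolding Suc_eq_plus1 by blast
  then show ?thesis
    using s_g assms(2) opS_opG[of v i g] by (simp del: carrier_product_group)
qed (use assms(2) in \<open>auto simp: opG_one opG_mult opX_commute[of _ _ v] opX_opG opS_square opS_braid hact_tL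
     opS_opX opS_opX_far Suc_eq_plus1[symmetric] simp del: carrier_product_group\<close>)

text \<open>The elements of the free algebra that act as zero form an ideal containing the relations.\<close>

lemma hact_hecke_ideal:
  fixes p :: "('g, 'f::field) free_hecke"
  assumes "p \<in> hecke_ideal G n" "v \<in> nf_space"
  shows "hact p v = 0"
proof -
  let ?R = "free_algebra (hecke_gens G n) :: ('g, 'f) free_hecke ring"
  let ?K = "{p :: ('g, 'f) free_hecke. p \<in> F \<and> ( \<forall>v\<in>nf_space. hact p v = 0)}"
  interpret R: ring ?R by (rule ring_free_algebra)
  have neg: "\<ominus>\<^bsub>?R\<^esub> p = - p" if "p \<in> F" for p
    using that by (intro R.minus_equality) auto
  have A: "ideal ?K ?R"
  proof (rule idealI[OF ring_free_algebra])
    show "subgroup ?K (add_monoid ?R)"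
    proof (rule R.add.subgroupI)
      show "\<ominus>\<^bsub>?R\<^esub> p \<in> ?K" if "p \<in> ?K" for p
        using that by (simp add: neg linear_map_uminus[OF linear_hact_left])
    qed (auto intro: zero_free_algebra)
  qed (use linear_map_zero[OF linear_hact] in auto)
  have B: "hecke_rels G n \<subseteq> ?K"
    using hecke_rels_closed[OF is_group] hact_rel by blast
  have "hecke_ideal G n \<subseteq> ?K"
    unfolding hecke_ideal_def using R.genideal_minimal[OF A B] .
  then show ?thesis
    using assms by blast
qed

section \<open>Normal forms span the wreath Hecke algebra\<close>

text \<open>Congruence modulo the ideal replaces equality in the quotient, so that computations take place in the
  ring type of the free algebra. Membership in the carrier is part of the relation and need not be
  carried along separately.\<close>

definition hecke_cong :: "('g, 'f::field) free_hecke \<Rightarrow> ('g, 'f) free_hecke \<Rightarrow> bool" (infix "\<approx>\<^sub>H" 50) where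
  "p \<approx>\<^sub>H q \<longleftrightarrow> p \<in> F \<and> q \<in> F \<and> p - q \<in> hecke_ideal G n"

lemma ideal_J: "ideal (hecke_ideal G n) (free_algebra (hecke_gens G n))"
  by (rule ideal_hecke_ideal[OF is_group])

lemma J_zero: "0 \<in> hecke_ideal G n"
  using additive_subgroup.zero_closed[OF ideal.axioms(1)[OF ideal_J]] by simp

lemma J_add: "p \<in> hecke_ideal G n \<Longrightarrow> q \<in> hecke_ideal G n \<Longrightarrow> p + q \<in> hecke_ideal G n"
  using additive_subgroup.a_closed[OF ideal.axioms(1)[OF ideal_J]] by simp

lemma J_mult: "p \<in> hecke_ideal G n \<Longrightarrow> q \<in> F \<Longrightarrow> p * q \<in> hecke_ideal G n"
  "p \<in> hecke_ideal G n \<Longrightarrow> q \<in> F \<Longrightarrow> q * p \<in> hecke_ideal G n"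
  using ideal.I_r_closed[OF ideal_J] ideal.I_l_closed[OF ideal_J] by simp_all

lemma J_uminus: "p \<in> hecke_ideal G n \<Longrightarrow> - p \<in> hecke_ideal G n"
  using J_mult(2)[of p "- 1"] by simp

lemma hcong_F: "p \<approx>\<^sub>H q \<Longrightarrow> p \<in> F" "p \<approx>\<^sub>H q \<Longrightarrow> q \<in> F"
  by (simp_all add: hecke_cong_def)

lemma hcong_refl [simp]: "p \<in> F \<Longrightarrow> p \<approx>\<^sub>H p"
  by (simp add: hecke_cong_def J_zero)

lemma hcong_sym: "p \<approx>\<^sub>H q \<Longrightarrow> q \<approx>\<^sub>H p"
  using J_uminus[of "p - q"] by (simp add: hecke_cong_def)

lemma hcong_trans [trans]: "p \<approx>\<^sub>H q \<Longrightarrow> q \<approx>\<^sub>H r \<Longrightarrow> p \<approx>\<^sub>H r"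
  using J_add[of "p - q" "q - r"] by (simp add: hecke_cong_def)

lemma hcong_add: "p \<approx>\<^sub>H p' \<Longrightarrow> q \<approx>\<^sub>H q' \<Longrightarrow> p + q \<approx>\<^sub>H p' + q'"
  using J_add[of "p - p'" "q - q'"] by (simp add: hecke_cong_def algebra_simps)

lemma hcong_mult: "p \<approx>\<^sub>H p' \<Longrightarrow> q \<approx>\<^sub>H q' \<Longrightarrow> p * q \<approx>\<^sub>H p' * q'"
proof -
  assume pq: "p \<approx>\<^sub>H p'" "q \<approx>\<^sub>H q'"
  have "p * q - p' * q' = (p - p') * q + p' * (q - q')"
    by (simp add: algebra_simps)
  then show "p * q \<approx>\<^sub>H p' * q'"
    using pq by (simp add: hecke_cong_def J_add J_mult)
qed

lemma hcong_multL: "q \<approx>\<^sub>H q' \<Longrightarrow> p \<in> F \<Longrightarrow> p * q \<approx>\<^sub>H p * q'"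
  by (rule hcong_mult) simp_all

lemma hcong_multR: "p \<approx>\<^sub>H p' \<Longrightarrow> q \<in> F \<Longrightarrow> p * q \<approx>\<^sub>H p' * q"
  by (rule hcong_mult) simp_all

lemma hcong_scale: "p \<approx>\<^sub>H q \<Longrightarrow> scale c p \<approx>\<^sub>H scale c q"
  using hcong_multL[OF _ scalar_free_algebra] by (simp add: scale_eq_mult flip: scalar_def)

lemma hcong_diff: "p \<approx>\<^sub>H p' \<Longrightarrow> q \<approx>\<^sub>H q' \<Longrightarrow> p - q \<approx>\<^sub>H p' - q'"
  using hcong_add[of p p' "- q" "- q'"] hcong_multL[of q q' "- 1"] by simp

lemma hcong_sum: "(\<And>i. i \<in> I \<Longrightarrow> p i \<approx>\<^sub>H q i) \<Longrightarrow> sum p I \<approx>\<^sub>H sum q I"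
  by (induction I rule: infinite_finite_induct) (auto intro: hcong_add)

lemma hcong_rel:
  assumes "p - q \<in> hecke_rels G n" "p \<in> F" "q \<in> F"
  shows "p \<approx>\<^sub>H q"
  using assms ring.genideal_self[OF ring_free_algebra hecke_rels_closed[OF is_group]]
  by (auto simp: hecke_cong_def hecke_ideal_def)

lemma hcong_hact: "p \<approx>\<^sub>H q \<Longrightarrow> v \<in> nf_space \<Longrightarrow> hact p v = hact q v"
  using hact_hecke_ideal[of "p - q" v] by (simp add: hecke_cong_def)

lemma tL_F [simp]: "tL G n j k \<in> F"
  unfolding tL_def by (intro sum_free_algebra gens_closed) (simp add: flip: tt_def del: carrier_product_group)

lemma commute_prod_list:
  assumes "p \<in> F" "\<And>a. a \<in> set as \<Longrightarrow> f a \<in> F" "\<And>a. a \<in> set as \<Longrightarrow> p * f a \<approx>\<^sub>H f a * p"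
  shows "p * prod_list (map f as) \<approx>\<^sub>H prod_list (map f as) * p"
  using assms(2,3)
proof (induction as)
  case Nil
  then show ?case using assms(1) by simp
next
  case (Cons a as)
  have "p * (f a * prod_list (map f as)) = (p * f a) * prod_list (map f as)"
    by (simp add: mult.assoc)
  also have "\<dots> \<approx>\<^sub>H (f a * p) * prod_list (map f as)"
    using Cons.prems by (intro hcong_multR prod_list_F) auto
  also have "\<dots> = f a * (p * prod_list (map f as))"
    by (simp add: mult.assoc)
  also have "\<dots> \<approx>\<^sub>H f a * (prod_list (map f as) * p)"
    using Cons by (intro hcong_multL) auto
  finally show ?case by (simp add: mult.assoc)
qed

lemma commute_power:
  assumes "p \<in> F" "q \<in> F" "p * q \<approx>\<^sub>H q * p"
  shows "p * q ^ k \<approx>\<^sub>H q ^ k * p"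
  using commute_prod_list[of p "replicate k q" "\<lambda>q. q"] assms by simp

definition xpow :: "(nat \<Rightarrow> nat) \<Rightarrow> ('g, 'f::field) free_hecke" where
  "xpow \<alpha> = prod_list (map (\<lambda>k. xL k ^ \<alpha> k) [1..<n + 1])"

definition sword :: "nat list \<Rightarrow> ('g, 'f::field) free_hecke" where
  "sword u = prod_list (map sL u)"

text \<open>Any word for \<open>w\<close> would do, since words with the same permutation are congruent.\<close>

definition perm_word :: "(nat \<Rightarrow> nat) \<Rightarrow> nat list" where
  "perm_word w = (SOME u. set u \<subseteq> {1..<n} \<and> word_perm u = w)"

definition normal_form :: "'g nf \<Rightarrow> ('g, 'f::field) free_hecke" where
  "normal_form = (\<lambda>(\<alpha>, g, w). xpow \<alpha> * (gL g * sword (perm_word w)))"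

lemma perm_word:
  assumes "w permutes {1..n}"
  shows "set (perm_word w) \<subseteq> {1..<n}" "word_perm (perm_word w) = w"
  using someI_ex[OF word_perm_surj[OF assms]] by (simp_all add: perm_word_def)

lemma xpow_F [simp]: "xpow \<alpha> \<in> F"
  unfolding xpow_def by (rule prod_list_F) auto

lemma sword_F [simp]: "set u \<subseteq> {1..<n} \<Longrightarrow> sword u \<in> F"
  unfolding sword_def by (rule prod_list_F) auto

lemma normal_form_F: "k \<in> basis_keys \<Longrightarrow> normal_form k \<in> F"
  by (elim basis_keysE) (simp add: normal_form_def perm_word del: carrier_product_group)

lemma lin_normal_form_F: "v \<in> nf_space \<Longrightarrow> lin normal_form v \<in> F"
  unfolding lin_def nf_space_def by (intro sum_free_algebra scale_F normal_form_F) auto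

lemma hcong_sword:
  assumes "coxeter_eq n u v"
  shows "sword u \<approx>\<^sub>H sword v"
  using assms
proof (induction rule: coxeter_eq.induct)
  case (cox_sym u v)
  show ?case by (rule hcong_sym[OF cox_sym.IH])
next
  case (cox_trans u v w)
  show ?case by (rule hcong_trans[OF cox_trans.IH])
next
  case (cox_embed u v a b)
  then show ?case
    by (simp add: sword_def) (simp add: hcong_mult flip: sword_def)
next
  case (cox_square i)
  then show ?case
    using hcong_rel[OF s_square] by (simp add: sword_def)
next
  case (cox_commute i j)
  then show ?case
    using hcong_rel[OF s_commute, of i j] by (simp add: sword_def Suc_eq_plus1[symmetric])
next
  case (cox_braid i)
  then show ?case
    using hcong_rel[OF s_braid, of i] by (simp add: sword_def mult.assoc Suc_eq_plus1[symmetric])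
qed simp

lemma hcong_sword_perm:
  "set u \<subseteq> {1..<n} \<Longrightarrow> set v \<subseteq> {1..<n} \<Longrightarrow> word_perm u = word_perm v \<Longrightarrow> sword u \<approx>\<^sub>H sword v"
  by (intro hcong_sword coxeter_eqI[OF order_refl])

text \<open>The power product \<open>xpow\<close> lists its factors in increasing order, so \<open>x\<^sub>j\<close> is moved past the factors
  with smaller index.\<close>

lemma hcong_x_xpow:
  assumes j: "j \<in> {1..n}"
  shows "xL j * xpow \<alpha> \<approx>\<^sub>H xpow (\<alpha>(j := Suc (\<alpha> j)))"
proof -
  let ?X = "\<lambda>\<alpha> as. prod_list (map (\<lambda>k. xL k ^ \<alpha> k) as)"
  obtain as bs where l: "[1..<n + 1] = as @ j # bs"
    using j split_list[of j "[1..<n + 1]"] by auto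
  have "distinct (as @ j # bs)" "set (as @ j # bs) = {1..n}"
    unfolding l[symmetric] by auto
  then have ab: "set as \<subseteq> {1..n}" "set bs \<subseteq> {1..n}" "j \<notin> set as" "j \<notin> set bs"
    by auto
  have F: "?X \<alpha> as \<in> F" "?X \<alpha> bs \<in> F"
    using ab by (auto intro!: prod_list_F power_F gens_closed)
  have c: "xL j * ?X \<alpha> as \<approx>\<^sub>H ?X \<alpha> as * xL j"
    using j ab by (intro commute_prod_list commute_power hcong_rel[OF x_x]) auto
  have "xL j * xpow \<alpha> = (xL j * ?X \<alpha> as) * (xL j ^ \<alpha> j * ?X \<alpha> bs)"
    by (simp add: xpow_def l mult.assoc del: upt_Suc)
  also have "\<dots> \<approx>\<^sub>H (?X \<alpha> as * xL j) * (xL j ^ \<alpha> j * ?X \<alpha> bs)"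
    using j by (intro hcong_multR[OF c]) (simp add: F)
  also have "\<dots> = xpow (\<alpha>(j := Suc (\<alpha> j)))"
  proof -
    have e: "?X (\<alpha>(j := Suc (\<alpha> j))) l = ?X \<alpha> l" if "j \<notin> set l" for l
      using that by (intro arg_cong[where f = prod_list] map_cong) auto
    show ?thesis
      using ab by (simp add: e fun_upd_same xpow_def l mult.assoc del: upt_Suc fun_upd_apply)
  qed
  finally show ?thesis .
qed

lemma hcong_g_xpow:
  assumes g: "g \<in> carrier P"
  shows "gL g * xpow \<alpha> \<approx>\<^sub>H xpow \<alpha> * gL g"
  unfolding xpow_def using g
  by (intro commute_prod_list commute_power hcong_sym[OF hcong_rel[OF x_g]]) (auto simp del: carrier_product_group)

lemma hcong_x_normal_form:
  assumes j: "j \<in> {1..n}" and k: "(\<alpha>, g, w) \<in> basis_keys"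
  shows "xL j * normal_form (\<alpha>, g, w) \<approx>\<^sub>H normal_form (\<alpha>(j := Suc (\<alpha> j)), g, w)"
proof -
  have "gL g * sword (perm_word w) \<in> F"
    using k by (auto elim!: basis_keysE simp: perm_word simp del: carrier_product_group)
  from hcong_multR[OF hcong_x_xpow[OF j] this] show ?thesis
    by (simp add: normal_form_def mult.assoc)
qed

lemma hcong_g_normal_form:
  assumes h: "h \<in> carrier P" and k: "(\<alpha>, g, w) \<in> basis_keys"
  shows "gL h * normal_form (\<alpha>, g, w) \<approx>\<^sub>H normal_form (\<alpha>, h \<otimes>\<^bsub>P\<^esub> g, w)"
proof -
  have F: "g \<in> carrier P" "sword (perm_word w) \<in> F"
    using k by (auto elim!: basis_keysE simp: perm_word simp del: carrier_product_group)
  have "gL h * normal_form (\<alpha>, g, w) = (gL h * xpow \<alpha>) * (gL g * sword (perm_word w))"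
    by (simp add: normal_form_def mult.assoc)
  also have "\<dots> \<approx>\<^sub>H (xpow \<alpha> * gL h) * (gL g * sword (perm_word w))"
    using h by (intro hcong_multR hcong_g_xpow) (simp_all add: F del: carrier_product_group)
  also have "\<dots> = xpow \<alpha> * ((gL h * gL g) * sword (perm_word w))"
    by (simp add: mult.assoc)
  also have "\<dots> \<approx>\<^sub>H xpow \<alpha> * (gL (h \<otimes>\<^bsub>P\<^esub> g) * sword (perm_word w))"
    using h by (intro hcong_multL hcong_multR hcong_rel[OF G_mult]) (simp_all add: F G_mult del: carrier_product_group)
  finally show ?thesis
    by (simp add: normal_form_def)
qed

definition spanned :: "('g, 'f::field) free_hecke \<Rightarrow> bool" where
  "spanned p \<longleftrightarrow> (\<exists>v\<in>nf_space. p \<approx>\<^sub>H lin normal_form v)"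

lemma spanned_cong: "spanned q \<Longrightarrow> p \<approx>\<^sub>H q \<Longrightarrow> spanned p"
  by (auto simp: spanned_def intro: hcong_trans)

lemma spanned_add: "spanned p \<Longrightarrow> spanned q \<Longrightarrow> spanned (p + q)"
  unfolding spanned_def by (metis hcong_add lin_add nf_space_add)

lemma spanned_scale: "spanned p \<Longrightarrow> spanned (scale c p)"
  unfolding spanned_def by (metis hcong_scale lin_scale nf_space_scale)

lemma spanned_diff: "spanned p \<Longrightarrow> spanned q \<Longrightarrow> spanned (p - q)"
  unfolding spanned_def by (metis hcong_diff lin_diff nf_space_diff)

lemma spanned_zero: "spanned 0"
  unfolding spanned_def by (rule bexI[of _ 0]) (simp_all add: lin_zero)

lemma spanned_sum: "(\<And>i. i \<in> I \<Longrightarrow> spanned (p i)) \<Longrightarrow> spanned (sum p I)"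
  by (induction I rule: infinite_finite_induct)
    (auto intro: spanned_add spanned_zero)

lemma spanned_normal_form: "k \<in> basis_keys \<Longrightarrow> spanned (normal_form k)"
  unfolding spanned_def by (rule bexI[of _ "single k 1"]) (simp_all add: normal_form_F)

text \<open>By linearity, stability of the span under left multiplication by \<open>q\<close> is a question about normal forms.\<close>

lemma spanned_mult:
  assumes q: "q \<in> F" and nf: "\<And>k. k \<in> basis_keys \<Longrightarrow> spanned (q * normal_form k)" and p: "spanned p"
  shows "spanned (q * p)"
proof -
  obtain v where v: "v \<in> nf_space" "p \<approx>\<^sub>H lin normal_form v"
    using p by (auto simp: spanned_def)
  have "q * lin normal_form v = (\<Sum>k\<in>keys v. scale (lookup v k) (q * normal_form k))"
    unfolding lin_def linear_map_sum[OF linear_map_mult_left] linear_map_scale[OF linear_map_mult_left] ..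
  moreover have "spanned \<dots>"
    using v(1) by (intro spanned_sum spanned_scale nf) (auto simp: nf_space_def)
  ultimately show ?thesis
    using spanned_cong hcong_multL[OF v(2) q] by metis
qed

lemma spanned_x:
  assumes "j \<in> {1..n}" "spanned p"
  shows "spanned (xL j * p)"
proof (rule spanned_mult[OF _ _ assms(2)])
  show "spanned (xL j * normal_form k)" if "k \<in> basis_keys" for k
    using that
  proof (cases rule: basis_keysE)
    case (1 \<alpha> g w)
    then have "(\<alpha>(j := Suc (\<alpha> j)), g, w) \<in> basis_keys"
      using assms(1) by (intro basis_keysI upd_ext)
    then show ?thesis
      using hcong_x_normal_form[OF assms(1)] that 1(1) spanned_normal_form spanned_cong by metis
  qed
qed (use assms in simp)

lemma spanned_g:
  assumes "h \<in> carrier P" "spanned p"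
  shows "spanned (gL h * p)"
proof (rule spanned_mult[OF _ _ assms(2)])
  show "spanned (gL h * normal_form k)" if "k \<in> basis_keys" for k
    using that
  proof (cases rule: basis_keysE)
    case (1 \<alpha> g w)
    then have "(\<alpha>, h \<otimes>\<^bsub>P\<^esub> g, w) \<in> basis_keys"
      using assms(1) by (intro basis_keysI P.m_closed)
    then show ?thesis
      using hcong_g_normal_form[OF assms(1)] that 1(1) spanned_normal_form spanned_cong by metis
  qed
qed (use assms in \<open>simp del: carrier_product_group\<close>)

lemma spanned_t: "spanned p \<Longrightarrow> spanned (tL G n j k * p)"
  unfolding tL_def sum_distrib_right
  by (intro spanned_sum spanned_g) (simp_all flip: tt_def del: carrier_product_group)

lemma xpow_zero [simp]: "xpow zero_exp = 1"
proof -
  have one: "prod_list (map (\<lambda>k. 1) l) = 1" for l :: "nat list"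
    by (induction l) auto
  have "xpow zero_exp = prod_list (map (\<lambda>k. 1) [1..<n + 1])"
    unfolding xpow_def by (intro arg_cong[where f = prod_list] map_cong) auto
  then show ?thesis
    by (simp only: one)
qed

lemma hcong_s_x:
  assumes i: "i \<in> {1..<n}"
  shows "sL i * xL i \<approx>\<^sub>H xL (Suc i) * sL i - tL G n i (Suc i)"
  by (rule hcong_rel[OF s_x[OF i, unfolded Suc_eq_plus1[symmetric]]]) (use i in simp_all)

lemma hcong_s_g:
  assumes i: "i \<in> {1..<n}" and g: "g \<in> carrier P"
  shows "sL i * gL g \<approx>\<^sub>H gL (g \<circ> adj i) * sL i"
proof (rule hcong_rel)
  have p: "g \<circ> adj i = perm_tuple n (transpose i (i + 1)) g"
    using perm_tuple_adj[OF i, of g "carrier G"] g by (simp add: Suc_eq_plus1[symmetric])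
  show "sL i * gL g - gL (g \<circ> adj i) * sL i \<in> hecke_rels G n"
    unfolding p by (rule s_g[OF i g])
qed (use assms comp_adj_closed[OF assms] in \<open>simp_all del: carrier_product_group\<close>)

lemma hcong_t_s:
  assumes i: "i \<in> {1..<n}"
  shows "sL i * tL G n i (Suc i) \<approx>\<^sub>H tL G n i (Suc i) * sL i"
proof -
  have "sL i * tL G n i (Suc i) = (\<Sum>h\<in>carrier G. sL i * gL (tt i (Suc i) h))"
    by (simp add: tL_def tt_def sum_distrib_left)
  also have "\<dots> \<approx>\<^sub>H (\<Sum>h\<in>carrier G. gL (tt (Suc i) i h) * sL i)"
    by (intro hcong_sum
        hcong_s_g[OF i tt_closed[where j = i and k = "Suc i"],
          unfolded tt_comp_adj[OF i] transpose_apply_first transpose_apply_second])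
  also have "\<dots> = (\<Sum>h\<in>carrier G. gL (tt i (Suc i) h) * sL i)"
    by (rule sum.reindex_bij_witness[where i = "\<lambda>h. inv h" and j = "\<lambda>h. inv h"])
      (simp_all add: tt_swap[of _ "Suc i" i])
  also have "\<dots> = tL G n i (Suc i) * sL i"
    by (simp add: tL_def tt_def sum_distrib_right)
  finally show ?thesis .
qed

text \<open>This follows from the relation for \<open>x\<^sub>i\<close> by multiplying with \<open>s\<^sub>i\<close> on both sides, since \<open>s\<^sub>i\<close>
  commutes with \<open>t\<^sub>i\<^sub>,\<^sub>i\<^sub>+\<^sub>1\<close>.\<close>

lemma hcong_s_x_Suc:
  assumes i: "i \<in> {1..<n}"
  shows "sL i * xL (Suc i) \<approx>\<^sub>H (xL i * sL i + tL G n i (Suc i) :: ('g, 'f::field) free_hecke)"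
proof -
  let ?s = "sL i :: ('g, 'f) free_hecke" and ?x = "xL i :: ('g, 'f) free_hecke" and ?y = "xL (Suc i) :: ('g, 'f) free_hecke" and ?t = "tL G n i (Suc i) :: ('g, 'f) free_hecke"
  have F: "?s \<in> F" "?x \<in> F" "?y \<in> F" "?t \<in> F"
    using i by auto
  have ss: "?s * ?s \<approx>\<^sub>H 1"
    using i F by (intro hcong_rel s_square) auto
  have y: "?y * ?s \<approx>\<^sub>H ?s * ?x + ?t"
    using hcong_add[OF hcong_sym[OF hcong_s_x[OF i]] hcong_refl[OF F(4)]] by simp
  have "?s * ?y \<approx>\<^sub>H ?s * ?y * (?s * ?s)"
    using hcong_multL[OF hcong_sym[OF ss], of "?s * ?y"] F by simp
  also have "\<dots> = ?s * (?y * ?s) * ?s"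
    by (simp add: mult.assoc)
  also have "\<dots> \<approx>\<^sub>H ?s * (?s * ?x + ?t) * ?s"
    using F by (intro hcong_multL hcong_multR y) auto
  also have "\<dots> = (?s * ?s) * ?x * ?s + (?s * ?t) * ?s"
    by (simp add: algebra_simps)
  also have "\<dots> \<approx>\<^sub>H 1 * ?x * ?s + (?t * ?s) * ?s"
    using F by (intro hcong_add hcong_multR ss hcong_t_s[OF i]) auto
  also have "\<dots> = ?x * ?s + ?t * (?s * ?s)"
    by (simp add: mult.assoc)
  also have "\<dots> \<approx>\<^sub>H ?x * ?s + ?t * 1"
    using F by (intro hcong_add hcong_multL ss) auto
  finally show ?thesis by simp
qed

text \<open>Induction on the total exponent: a factor \<open>x\<^sub>j\<close> is moved to the left of \<open>s\<^sub>i\<close>, which leaves an \<open>x\<close> times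
  an element treated before, plus possibly a multiple of \<open>t\<^sub>i\<^sub>,\<^sub>i\<^sub>+\<^sub>1\<close> times a normal form.\<close>

lemma spanned_s_normal_form:
  assumes i: "i \<in> {1..<n}" and \<alpha>: "\<alpha> \<in> {1..n} \<rightarrow>\<^sub>E (UNIV :: nat set)" and g: "g \<in> carrier P" and w: "w permutes {1..n}"
  shows "spanned (sL i * normal_form (\<alpha>, g, w) :: ('g, 'f::field) free_hecke)"
  using \<alpha>
proof (induction "sum \<alpha> {1..n}" arbitrary: \<alpha>)
  case 0
  then have \<alpha>: "\<alpha> = zero_exp"
    by (auto simp: fun_eq_iff PiE_iff extensional_def)
  have w': "adj i \<circ> w permutes {1..n}"
    using i w by (intro permutes_compose permutes_swap_id) auto
  have g': "g \<circ> adj i \<in> carrier P"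
    using comp_adj_closed[OF i g] .
  have F: "sL i \<in> F" "gL g \<in> F" "sword (perm_word w) \<in> F" "gL (g \<circ> adj i) \<in> F"
    using i g g' w by (simp_all add: perm_word del: carrier_product_group)
  have "sL i * normal_form (\<alpha>, g, w) = (sL i * gL g) * sword (perm_word w)"
    by (simp add: \<alpha> normal_form_def mult.assoc)
  also have "\<dots> \<approx>\<^sub>H (gL (g \<circ> adj i) * sL i) * sword (perm_word w)"
    by (intro hcong_multR hcong_s_g[OF i g] F)
  also have "\<dots> = gL (g \<circ> adj i) * sword (i # perm_word w)"
    by (simp add: sword_def mult.assoc)
  also have "\<dots> \<approx>\<^sub>H gL (g \<circ> adj i) * sword (perm_word (adj i \<circ> w))"
    using i perm_word[OF w] perm_word[OF w'] by (intro hcong_multL hcong_sword_perm F) auto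
  also have "\<dots> = normal_form (zero_exp, g \<circ> adj i, adj i \<circ> w)"
    by (simp add: normal_form_def)
  finally show ?case
    by (rule spanned_cong[rotated]) (intro spanned_normal_form basis_keysI g' w', auto)
next
  case (Suc d)
  then obtain j where j: "j \<in> {1..n}" "\<alpha> j > 0"
    by (metis gr0I nat.distinct(1) sum.neutral)
  define \<beta> where "\<beta> = \<alpha>(j := \<alpha> j - 1)"
  have \<alpha>\<beta>: "\<alpha> = \<beta>(j := Suc (\<beta> j))"
    using j by (simp add: \<beta>_def)
  have \<beta>: "\<beta> \<in> {1..n} \<rightarrow>\<^sub>E UNIV"
    using Suc.prems j by (auto simp: \<beta>_def PiE_iff extensional_def)
  have "sum \<alpha> {1..n} = Suc (sum \<beta> {1..n})"
    using j by (simp add: sum.remove[of "{1..n}" j] \<beta>_def)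
  then have IH: "spanned (sL i * normal_form (\<beta>, g, w) :: ('g, 'f) free_hecke)"
    using Suc.hyps \<beta> by auto
  have k: "(\<beta>, g, w) \<in> basis_keys"
    using \<beta> g w by (rule basis_keysI)
  let ?q = "normal_form (\<beta>, g, w) :: ('g, 'f) free_hecke"
  have q: "?q \<in> F" "spanned ?q"
    using k by (simp_all add: normal_form_F spanned_normal_form)
  have "spanned ((sL i * xL j) * ?q)"
  proof -
    consider "j = i" | "j = Suc i" | "j \<noteq> i" "j \<noteq> Suc i" by blast
    then show ?thesis
    proof cases
      case 1
      have "(sL i * xL j) * ?q \<approx>\<^sub>H (xL (Suc i) * sL i - tL G n i (Suc i)) * ?q"
        using q 1 by (simp add: hcong_multR hcong_s_x[OF i])
      then show ?thesis
        using i q IH by (elim spanned_cong[rotated])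
          (simp add: left_diff_distrib mult.assoc spanned_diff spanned_x spanned_t)
    next
      case 2
      have "(sL i * xL j) * ?q \<approx>\<^sub>H (xL i * sL i + tL G n i (Suc i)) * ?q"
        using q 2 by (simp add: hcong_multR hcong_s_x_Suc[OF i])
      then show ?thesis
        using i q IH by (elim spanned_cong[rotated])
          (simp add: distrib_right mult.assoc spanned_add spanned_x spanned_t)
    next
      case 3
      have "(sL i * xL j) * ?q \<approx>\<^sub>H (xL j * sL i) * ?q"
        using q 3 i j by (intro hcong_multR hcong_rel s_x_far) auto
      then show ?thesis
        using i j q IH by (elim spanned_cong[rotated]) (simp add: mult.assoc spanned_x)
    qed
  qed
  moreover have "sL i * normal_form (\<alpha>, g, w) \<approx>\<^sub>H (sL i * xL j) * ?q"
    using hcong_multL[OF hcong_sym[OF hcong_x_normal_form[OF j(1) k]], of "sL i"] i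
    by (simp add: mult.assoc flip: \<alpha>\<beta>)
  ultimately show ?case
    by (rule spanned_cong)
qed

lemma spanned_s: "i \<in> {1..<n} \<Longrightarrow> spanned p \<Longrightarrow> spanned (sL i * p)"
  by (rule spanned_mult) (auto elim!: basis_keysE intro: spanned_s_normal_form)

lemma spanned_one: "spanned (1 :: ('g, 'f::field) free_hecke)"
proof (rule spanned_cong)
  have id: "id permutes {1..n}"
    by (rule permutes_id)
  have k: "(zero_exp, \<one>\<^bsub>P\<^esub>, id) \<in> basis_keys"
    by (intro basis_keysI id P.one_closed) auto
  then show "spanned (normal_form (zero_exp, \<one>\<^bsub>P\<^esub>, id) :: ('g, 'f) free_hecke)"
    by (rule spanned_normal_form)
  have "gL \<one>\<^bsub>P\<^esub> * sword (perm_word id) \<approx>\<^sub>H (1 * sword [] :: ('g, 'f::field) free_hecke)"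
    using perm_word[OF id] P.one_closed
    by (intro hcong_mult hcong_rel[OF G_one] hcong_sword_perm) (simp_all del: carrier_product_group)
  then have h: "gL \<one>\<^bsub>P\<^esub> * sword (perm_word id) \<approx>\<^sub>H (1 :: ('g, 'f) free_hecke)"
    by (simp add: sword_def)
  show "(1 :: ('g, 'f) free_hecke) \<approx>\<^sub>H normal_form (zero_exp, \<one>\<^bsub>P\<^esub>, id)"
    by (simp add: normal_form_def hcong_sym[OF h])
qed

lemma spanned_all: "p \<in> F \<Longrightarrow> spanned p"
proof (induction p rule: F_induct)
  case (scalar c)
  have "scale c 1 = scalar c"
    by (simp add: scale_eq_mult scalar_def)
  then show ?case using spanned_scale[OF spanned_one] by metis
next
  case (letter a p)
  then show ?case
    by (auto simp: hecke_gens_def spanned_x spanned_s spanned_g simp del: carrier_product_group)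
qed (rule spanned_add)

section \<open>Normal forms are linearly independent\<close>

text \<open>The basis vector of the unit element; \<open>hact p vac\<close> is the coordinate vector of \<open>p\<close>.\<close>

abbreviation vac :: "'g nf \<Rightarrow>\<^sub>0 'f::field" where
  "vac \<equiv> single (zero_exp, \<one>\<^bsub>P\<^esub>, id) 1"

lemma vac_nf_space [simp]: "vac \<in> nf_space"
  by (intro nf_space_single basis_keysI permutes_id P.one_closed) auto

lemma hact_power_x:
  "hact (xL j ^ a) (single (\<beta>, g, w) 1) = single (\<beta>(j := \<beta> j + a), g, w) 1"
  by (induction a) (simp_all add: fun_upd_same del: fun_upd_apply)

lemma hact_xpow:
  "hact (xpow \<alpha>) (single (\<beta>, g, w) 1) = single (\<lambda>k. if k \<in> {1..n} then \<beta> k + \<alpha> k else \<beta> k, g, w) 1"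
proof -
  have gen: "distinct as \<Longrightarrow> hact (prod_list (map (\<lambda>k. xL k ^ \<alpha> k) as)) (single (\<beta>, g, w) 1)
    = single (\<lambda>k. if k \<in> set as then \<beta> k + \<alpha> k else \<beta> k, g, w) 1" for as
  proof (induction as)
    case (Cons j as)
    have e: "(\<lambda>k. if k \<in> set as then \<beta> k + \<alpha> k else \<beta> k)(j := \<beta> j + \<alpha> j) =
      (\<lambda>k. if k \<in> set (j # as) then \<beta> k + \<alpha> k else \<beta> k)"
      using Cons.prems by auto
    show ?case
      using Cons by (simp add: hact_power_x e[simplified] del: fun_upd_apply)
  qed simp
  have s: "set [1..<n + 1] = {1..n}"
    by auto
  show ?thesis
    unfolding xpow_def by (rule gen[OF distinct_upt, of 1 "n + 1", unfolded s])
qed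

lemma hact_sword:
  assumes "set u \<subseteq> {1..<n}"
  shows "hact (sword u) (single (zero_exp, g, w) 1) =
    (single (zero_exp, g \<circ> inv_into UNIV (word_perm u), word_perm u \<circ> w) 1 :: 'g nf \<Rightarrow>\<^sub>0 'f::field)"
  using assms
proof (induction u)
  case Nil
  then show ?case by (simp add: sword_def)
next
  case (Cons i u)
  then have i: "i \<in> {1..<n}" and u: "set u \<subseteq> {1..<n}"
    by auto
  have "bij (word_perm u)"
    using permutes_bij[OF word_perm_permutes[OF u]] .
  then have iv: "inv_into UNIV (word_perm (i # u)) = inv_into UNIV (word_perm u) \<circ> adj i"
    by (simp add: o_inv_distrib del: o_apply)
  have "hact (sword (i # u)) (single (zero_exp, g, w) 1) =
      (opS i (hact (sword u) (single (zero_exp, g, w) 1)) :: 'g nf \<Rightarrow>\<^sub>0 'f)"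
    by (simp add: sword_def)
  also have "\<dots> = single (zero_exp, g \<circ> inv_into UNIV (word_perm u) \<circ> adj i, adj i \<circ> (word_perm u \<circ> w)) 1"
    unfolding Cons.IH[OF u] by (rule opS_zero_exp[OF i])
  finally show ?case
    unfolding iv by (simp only: comp_assoc word_perm_simps)
qed

lemma hact_normal_form_zero_exp:
  assumes "(\<alpha>, g, w) \<in> basis_keys"
  shows "hact (normal_form (\<alpha>, g, w)) (single (zero_exp, h, u) 1) =
    single (\<alpha>, g \<otimes>\<^bsub>P\<^esub> (h \<circ> inv_into UNIV w), w \<circ> u) 1"
proof -
  have "(\<lambda>k. if k \<in> {1..n} then zero_exp k + \<alpha> k else zero_exp k) = \<alpha>"
    using assms by (auto simp: fun_eq_iff basis_keys_def PiE_iff extensional_def)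
  moreover have "w permutes {1..n}"
    using assms by (auto simp: basis_keys_def)
  ultimately show ?thesis
    by (simp add: normal_form_def hact_sword perm_word hact_xpow del: restrict_apply)
qed

lemma hact_normal_form_vac:
  assumes "k \<in> basis_keys"
  shows "hact (normal_form k) vac = single k 1"
proof -
  obtain \<alpha> g w where k: "k = (\<alpha>, g, w)" "g \<in> carrier P" "w permutes {1..n}"
    using assms by (rule basis_keysE)
  have one: "\<one>\<^bsub>P\<^esub> \<circ> inv_into UNIV w = \<one>\<^bsub>P\<^esub>"
    using permutes_in_image[OF permutes_inv[OF k(3)]] by (auto simp: one_product_group restrict_def fun_eq_iff simp del: atLeastAtMost_iff)
  show ?thesis
    unfolding k(1) hact_normal_form_zero_exp[OF assms[unfolded k(1)]]
    using k by (simp add: one del: carrier_product_group)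
qed

lemma hact_lin_normal_form:
  "v \<in> nf_space \<Longrightarrow> hact (lin normal_form v) u = lin (\<lambda>k. hact (normal_form k) u) v"
  unfolding lin_def linear_map_sum[OF linear_hact_left] linear_map_scale[OF linear_hact_left] ..

lemma hact_lin_normal_form_vac:
  assumes "v \<in> nf_space"
  shows "hact (lin normal_form v) vac = v"
proof -
  have "lin (\<lambda>k. hact (normal_form k) vac) v = lin (\<lambda>k. single k 1) v"
    using assms by (intro lin_cong hact_normal_form_vac) (auto simp: nf_space_def)
  then show ?thesis
    by (simp add: hact_lin_normal_form[OF assms] lin_expand)
qed

text \<open>The element \<open>p\<close> is congruent to some combination of normal forms, and applying both to \<open>vac\<close>
  identifies the coefficients.\<close>

theorem hecke_normal_form: "p \<in> F \<Longrightarrow> p \<approx>\<^sub>H lin normal_form (hact p vac)"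
  using spanned_all[of p] hcong_hact[OF _ vac_nf_space] hact_lin_normal_form_vac
  unfolding spanned_def by metis

text \<open>The coordinate vector is a complete invariant modulo the ideal, which is the linear independence of
  normal forms. From here on, identities in the algebra are proved in the module.\<close>

lemma hcong_iff:
  assumes "p \<in> F" "q \<in> F"
  shows "p \<approx>\<^sub>H q \<longleftrightarrow> hact p vac = hact q vac"
proof
  assume eq: "hact p vac = hact q vac"
  show "p \<approx>\<^sub>H q"
    using hecke_normal_form[OF assms(1)] hcong_sym[OF hecke_normal_form[OF assms(2)]]
    unfolding eq by (rule hcong_trans)
qed (rule hcong_hact[OF _ vac_nf_space])

section \<open>Normal forms of central elements\<close>

definition central :: "('g, 'f::field) free_hecke \<Rightarrow> bool" where
  "central p \<longleftrightarrow> p \<in> F \<and> (\<forall>a\<in>F. p * a \<approx>\<^sub>H a * p)"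

lemma central_hact:
  assumes "central p" "a \<in> F"
  shows "hact p (hact a vac) = hact a (hact p vac)"
  using assms hcong_hact[OF _ vac_nf_space, of "p * a" "a * p"] by (simp add: central_def)

lemma commute_gen_hact:
  assumes p: "p \<in> F" and a: "a \<in> hecke_gens G n"
    and eq: "hact p (lin (gen_act a) vac) = lin (gen_act a) (hact p vac)"
    and u: "u \<in> nf_space"
  shows "hact p (lin (gen_act a) u) = lin (gen_act a) (hact p u)"
proof -
  have "p * letter a \<approx>\<^sub>H letter a * p"
    using p eq by (simp add: hcong_iff letter_free_algebra[OF a])
  from hcong_hact[OF this u] show ?thesis
    by simp
qed

lemma scalar_commute: "p * scalar c = scalar c * (p :: ('g, 'f::field) free_hecke)"
  unfolding scalar_def using scale_eq_mult[of c p] scale_eq_mult_right[of c p] by simp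

text \<open>By \<open>hcong_iff\<close>, commuting with a generator can be tested on \<open>vac\<close>; the elements that commute with \<open>p\<close>
  form a subalgebra.\<close>

lemma central_gensI:
  assumes p: "p \<in> F"
    and gens: "\<And>a. a \<in> hecke_gens G n \<Longrightarrow> hact p (lin (gen_act a) vac) = lin (gen_act a) (hact p vac)"
  shows "central p"
  unfolding central_def
proof (intro conjI ballI p)
  fix a :: "('g, 'a) free_hecke" assume "a \<in> F"
  then show "p * a \<approx>\<^sub>H a * p"
  proof (induction a rule: F_induct)
    case (scalar c)
    then show ?case
      using p by (simp add: scalar_commute)
  next
    case (letter b q)
    have "p * letter b \<approx>\<^sub>H letter b * p"
      using p gens[OF letter(1)] by (simp add: hcong_iff letter_free_algebra[OF letter(1)])
    from hcong_multR[OF this letter(2)] hcong_multL[OF letter(3) letter_free_algebra[OF letter(1)]]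
    show ?case
      unfolding mult.assoc by (rule hcong_trans)
  next
    case (add q r)
    then show ?case
      using hcong_add by (simp add: distrib_left distrib_right)
  qed
qed

subsection \<open>Right multiplication by the generators\<close>

lemma comp_inv_one:
  assumes "w permutes {1..n}"
  shows "\<one>\<^bsub>P\<^esub> \<circ> inv_into UNIV w = \<one>\<^bsub>P\<^esub>"
  using permutes_in_image[OF permutes_inv[OF assms]]
  by (auto simp: one_product_group restrict_def fun_eq_iff simp del: atLeastAtMost_iff)

text \<open>Right multiplication of \<open>x\<^sup>\<alpha> g w\<close> by a generator \<open>a\<close> is seen in the module as the action of
  \<open>x\<^sup>\<alpha> g w\<close> on \<open>a vac\<close>. For \<open>a = h\<close> and \<open>a = s\<^sub>i\<close> no correction terms arise, because divided
  differences vanish on exponent zero.\<close>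

lemma right_mult_g:
  assumes v: "v \<in> nf_space" and h: "h \<in> carrier P"
  shows "hact (lin normal_form v) (opG h vac) =
    lin (\<lambda>k. single (fst k, fst (snd k) \<otimes>\<^bsub>P\<^esub> (h \<circ> inv_into UNIV (snd (snd k))), snd (snd k)) 1) v"
proof -
  have e: "opG h vac = single (zero_exp, h, id) 1"
    using h by (simp del: carrier_product_group)
  show ?thesis
    unfolding hact_lin_normal_form[OF v] e
  proof (rule lin_cong)
    fix k assume "k \<in> keys v"
    then have k: "(fst k, fst (snd k), snd (snd k)) \<in> basis_keys"
      using v by (auto simp: nf_space_def)
    show "hact (normal_form k) (single (zero_exp, h, id) 1) =
      single (fst k, fst (snd k) \<otimes>\<^bsub>P\<^esub> (h \<circ> inv_into UNIV (snd (snd k))), snd (snd k)) 1"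
      by (simp add: hact_normal_form_zero_exp[OF k, simplified])
  qed
qed

lemma opS_vac:
  assumes "i \<in> {1..<n}"
  shows "opS i vac = single (zero_exp, \<one>\<^bsub>P\<^esub>, adj i) 1"
  unfolding opS_zero_exp[OF assms] comp_adj_one[OF assms] by simp

lemma right_mult_s:
  assumes v: "v \<in> nf_space" and i: "i \<in> {1..<n}"
  shows "hact (lin normal_form v) (opS i vac) =
    lin (\<lambda>k. single (fst k, fst (snd k), snd (snd k) \<circ> adj i) 1) v"
  unfolding hact_lin_normal_form[OF v] opS_vac[OF i]
proof (rule lin_cong)
  fix k assume k: "k \<in> keys v"
  then have "k \<in> basis_keys"
    using v by (auto simp: nf_space_def)
  then obtain \<alpha> g w where kk: "k = (\<alpha>, g, w)" "g \<in> carrier P" "w permutes {1..n}" "(\<alpha>, g, w) \<in> basis_keys"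
    by (metis basis_keysE)
  show "hact (normal_form k) (single (zero_exp, \<one>\<^bsub>P\<^esub>, adj i) 1) =
    single (fst k, fst (snd k), snd (snd k) \<circ> adj i) 1"
    unfolding kk(1) hact_normal_form_zero_exp[OF kk(4)] comp_inv_one[OF kk(3)]
    using kk(2) by (simp del: carrier_product_group)
qed

text \<open>For right multiplication by \<open>x\<^sub>j\<close> only the leading term is needed. Corrections lower the total
  exponent, and \<open>hom_space\<close> records the total exponent in which they live.\<close>

abbreviation deg :: "(nat \<Rightarrow> nat) \<Rightarrow> nat" where
  "deg \<alpha> \<equiv> sum \<alpha> {1..n}"

definition hom_space :: "nat \<Rightarrow> ('g nf \<Rightarrow>\<^sub>0 'f::field) set" where
  "hom_space d = {v. \<forall>k\<in>keys v. deg (fst k) = d}"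

lemma hom_space_add: "u \<in> hom_space d \<Longrightarrow> v \<in> hom_space d \<Longrightarrow> u + v \<in> hom_space d"
  using Poly_Mapping.keys_add[of u v] by (auto simp: hom_space_def)

lemma hom_space_diff: "u \<in> hom_space d \<Longrightarrow> v \<in> hom_space d \<Longrightarrow> u - v \<in> hom_space d"
  using keys_diff[of u v] by (auto simp: hom_space_def)

lemma hom_space_single: "deg (fst k) = d \<Longrightarrow> single k c \<in> hom_space d"
  by (auto simp: hom_space_def)

lemma hom_space_lin:
  assumes "\<And>k. k \<in> keys v \<Longrightarrow> f k \<in> hom_space d"
  shows "lin f v \<in> hom_space d"
  using keys_lin[of f v] assms unfolding hom_space_def by blast

lemma hom_space_zero_exp:
  assumes "v \<in> nf_space" "v \<in> hom_space 0" "k \<in> keys v"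
  shows "\<exists>g w. k = (zero_exp, g, w) \<and> g \<in> carrier P"
proof -
  have "k \<in> basis_keys"
    using assms by (auto simp: nf_space_def)
  then obtain \<alpha> g w where k: "k = (\<alpha>, g, w)" "\<alpha> \<in> {1..n} \<rightarrow>\<^sub>E UNIV" "g \<in> carrier P"
    by (rule basis_keysE)
  have "\<alpha> = zero_exp"
    using assms(2,3) k(1,2) by (auto simp: hom_space_def fun_eq_iff PiE_iff extensional_def)
  then show ?thesis using k by blast
qed

lemma hom_space_zero [simp]: "0 \<in> hom_space d"
  by (simp add: hom_space_def)

lemma hom_space_uminus: "v \<in> hom_space d \<Longrightarrow> - v \<in> hom_space d"
  using hom_space_diff[of 0 d v] by simp

lemma hom_space_sum: "(\<And>i. i \<in> I \<Longrightarrow> f i \<in> hom_space d) \<Longrightarrow> sum f I \<in> hom_space d"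
  by (induction I rule: infinite_finite_induct) (auto intro: hom_space_add)

lemma opG_hom: "v \<in> hom_space d \<Longrightarrow> opG g v \<in> hom_space d"
  by (rule hom_space_lin) (auto simp: hom_space_def)

lemma opT_hom: "v \<in> hom_space d \<Longrightarrow> opT j k v \<in> hom_space d"
  unfolding opT_def by (intro hom_space_sum opG_hom)

lemma opS_hom:
  assumes "v \<in> nf_space" "v \<in> hom_space 0" "i \<in> {1..<n}"
  shows "opS i v \<in> hom_space 0"
proof (rule hom_space_lin)
  fix k assume "k \<in> keys v"
  then obtain g w where k: "k = (zero_exp, g, w)"
    using hom_space_zero_exp[OF assms(1,2)] by blast
  have "gen_act (SGen i) k = opS i (single k 1)"
    by simp
  also have "\<dots> \<in> hom_space 0"
    unfolding k opS_zero_exp[OF assms(3)] by (rule hom_space_single) simp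
  finally show "gen_act (SGen i) k \<in> hom_space 0" .
qed

lemma hact_xpow_hom:
  assumes "v \<in> hom_space d"
  shows "hact (xpow \<alpha>) v \<in> hom_space (d + deg \<alpha>)"
proof -
  have "lin (\<lambda>k. hact (xpow \<alpha>) (single k 1)) v \<in> hom_space (d + deg \<alpha>)"
  proof (rule hom_space_lin)
    fix k assume k: "k \<in> keys v"
    obtain \<beta> g w where kk: "k = (\<beta>, g, w)" by (cases k)
    have "deg \<beta> = d"
      using assms k by (auto simp: hom_space_def kk)
    then show "hact (xpow \<alpha>) (single k 1) \<in> hom_space (d + deg \<alpha>)"
      unfolding kk hact_xpow by (intro hom_space_single) (simp add: sum.distrib)
  qed
  then show ?thesis
    by (simp only: linear_map_eq_lin[OF linear_hact, symmetric])
qed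

lemma hact_sword_Cons: "hact (sword (i # u)) v = opS i (hact (sword u) v)"
  by (simp add: sword_def)

text \<open>Each \<open>s\<^sub>i\<close> moves past \<open>x\<^sub>k\<close>, permuting the index, at the cost of a term without any \<open>x\<close>.\<close>

lemma hact_sword_opX:
  assumes "set u \<subseteq> {1..<n}" "j \<in> {1..n}" "g \<in> carrier P" "w permutes {1..n}"
  shows "\<exists>r\<in>nf_space \<inter> hom_space 0. hact (sword u) (opX j (single (zero_exp, g, w) 1)) =
    opX (word_perm u j) (hact (sword u) (single (zero_exp, g, w) 1)) + (r :: 'g nf \<Rightarrow>\<^sub>0 'f::field)"
  using assms(1)
proof (induction u)
  case Nil
  show ?case
    by (rule bexI[of _ 0]) (simp_all add: sword_def)
next
  case (Cons i u)
  then have i: "i \<in> {1..<n}" and u: "set u \<subseteq> {1..<n}"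
    by auto
  let ?y = "hact (sword u) (single (zero_exp, g, w) 1) :: 'g nf \<Rightarrow>\<^sub>0 'f" and ?k = "word_perm u j"
  obtain r where r: "r \<in> nf_space" "r \<in> hom_space 0"
    "hact (sword u) (opX j (single (zero_exp, g, w) 1)) = opX ?k ?y + r"
    using Cons.IH[OF u] by blast
  have y: "?y \<in> nf_space" "?y \<in> hom_space 0"
  proof -
    show "?y \<in> nf_space"
      using u assms(3,4) by (intro hact_closed sword_F nf_space_single basis_keysI) auto
    show "?y \<in> hom_space 0"
      unfolding hact_sword[OF u] by (rule hom_space_single) simp
  qed
  obtain e where e: "e \<in> nf_space" "e \<in> hom_space 0" "opS i (opX ?k ?y) = opX (adj i ?k) (opS i ?y) + e"
  proof -
    consider "?k = i" | "?k = Suc i" | "?k \<noteq> i" "?k \<noteq> Suc i" by blast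
    then show thesis
    proof cases
      case 1
      show thesis
        by (rule that[of "- opT i (Suc i) ?y"])
          (use y 1 nf_space_diff[of 0 "opT i (Suc i) ?y"] in \<open>auto simp: opS_opX intro: hom_space_uminus opT_hom\<close>)
    next
      case 2
      show thesis
        by (rule that[of "opT i (Suc i) ?y"]) (use y 2 in \<open>auto simp: opS_opX_Suc intro: opT_hom\<close>)
    next
      case 3
      then show thesis
        by (intro that[of 0]) (auto simp: opS_opX_far transpose_def)
    qed
  qed
  have "hact (sword (i # u)) (opX j (single (zero_exp, g, w) 1)) = opS i (opX ?k ?y + r)"
    unfolding r(3)[symmetric] by (rule hact_sword_Cons)
  also have "\<dots> = opX (word_perm (i # u) j) (hact (sword (i # u)) (single (zero_exp, g, w) 1)) + (e + opS i r)"
    by (simp only: op_add e(3) hact_sword_Cons word_perm_simps o_apply add.assoc)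
  finally show ?case
  proof (rule bexI)
    show "e + opS i r \<in> nf_space \<inter> hom_space 0"
      by (intro IntI nf_space_add hom_space_add e opS_closed opS_hom r i)
  qed
qed

text \<open>The leading term \<open>x\<^sub>w\<^sub>(\<^sub>j\<^sub>) x\<^sup>\<alpha> g w\<close> of \<open>x\<^sup>\<alpha> g w x\<^sub>j\<close>.\<close>

definition x_shift :: "nat \<Rightarrow> 'g nf \<Rightarrow> 'g nf" where
  "x_shift j = (\<lambda>(\<alpha>, g, w). (\<alpha>(w j := Suc (\<alpha> (w j))), g, w))"

lemma xpow_zero_exp_upd:
  assumes "\<alpha> \<in> {1..n} \<rightarrow>\<^sub>E UNIV" "j \<in> {1..n}"
  shows "hact (xpow \<alpha>) (single (zero_exp(j := Suc (zero_exp j)), g, w) 1) = single (\<alpha>(j := Suc (\<alpha> j)), g, w) 1"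
proof -
  have "(\<lambda>k. if k \<in> {1..n} then (zero_exp(j := Suc (zero_exp j))) k + \<alpha> k else (zero_exp(j := Suc (zero_exp j))) k)
    = \<alpha>(j := Suc (\<alpha> j))"
    using assms by (auto simp: fun_eq_iff PiE_iff extensional_def)
  then show ?thesis
    unfolding hact_xpow by simp
qed

lemma normal_form_opX_vac:
  assumes k: "k \<in> basis_keys" and j: "j \<in> {1..n}"
  shows "hact (normal_form k) (opX j vac) - single (x_shift j k) 1 \<in> (hom_space (deg (fst k)) :: ('g nf \<Rightarrow>\<^sub>0 'f::field) set)"
proof -
  obtain \<alpha> g w where kk: "k = (\<alpha>, g, w)" "\<alpha> \<in> {1..n} \<rightarrow>\<^sub>E UNIV" "g \<in> carrier P" "w permutes {1..n}"
    using k by (rule basis_keysE)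
  note w = perm_word[OF kk(4)]
  obtain r :: "'g nf \<Rightarrow>\<^sub>0 'f" where r: "r \<in> hom_space 0"
    "hact (sword (perm_word w)) (opX j vac) = opX (w j) (hact (sword (perm_word w)) vac) + r"
    using hact_sword_opX[OF w(1) j P.one_closed permutes_id] unfolding w(2) by blast
  have wj: "w j \<in> {1..n}"
    using permutes_in_image[OF kk(4)] j by blast
  have y: "hact (sword (perm_word w)) vac = single (zero_exp, \<one>\<^bsub>P\<^esub>, w) 1"
    unfolding hact_sword[OF w(1)] w(2) comp_inv_one[OF kk(4)] by simp
  have "hact (normal_form k) (opX j vac) =
      hact (xpow \<alpha>) (opG g (opX (w j) (single (zero_exp, \<one>\<^bsub>P\<^esub>, w) 1) + r))"
    unfolding kk(1) normal_form_def prod.case hact_simps(1) r(2) y by simp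
  also have "\<dots> = single (\<alpha>(w j := Suc (\<alpha> (w j))), g, w) 1 + hact (xpow \<alpha>) (opG g r)"
  proof -
    have e: "opG g (opX (w j) (single (zero_exp, \<one>\<^bsub>P\<^esub>, w) 1)) = single (zero_exp(w j := Suc (zero_exp (w j))), g, w) 1"
      unfolding opX_single opG_single P.r_one[OF kk(3)] ..
    show ?thesis
      unfolding lin_add linear_map_add[OF linear_hact] e xpow_zero_exp_upd[OF kk(2) wj] ..
  qed
  finally have eq: "hact (normal_form k) (opX j vac) - single (x_shift j k) 1 = hact (xpow \<alpha>) (opG g r)"
    unfolding kk(1) x_shift_def prod.case by (simp only: add_diff_cancel_left')
  show ?thesis
    unfolding eq using hact_xpow_hom[OF opG_hom[OF r(1)], of \<alpha> g] by (simp add: kk(1))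
qed

lemma hact_perm_word_id:
  assumes "v \<in> nf_space"
  shows "hact (sword (perm_word id)) v = v"
proof -
  have "sword (perm_word id) \<approx>\<^sub>H sword []"
    using perm_word[OF permutes_id] by (intro hcong_sword_perm) auto
  then have "hact (sword (perm_word id)) v = hact (sword []) v"
    using assms by (rule hcong_hact)
  then show ?thesis
    by (simp add: sword_def)
qed

lemma normal_form_opX_vac_id:
  assumes k: "(\<alpha>, g, id) \<in> basis_keys" and j: "j \<in> {1..n}"
  shows "hact (normal_form (\<alpha>, g, id)) (opX j vac) = single (\<alpha>(j := Suc (\<alpha> j)), g, id) 1"
proof -
  have \<alpha>: "\<alpha> \<in> {1..n} \<rightarrow>\<^sub>E UNIV" "g \<in> carrier P"
    using k by (auto simp: basis_keys_def)
  have "hact (normal_form (\<alpha>, g, id)) (opX j vac) = hact (xpow \<alpha>) (opG g (opX j vac))"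
    unfolding normal_form_def prod.case hact_simps(1)
    by (simp only: hact_perm_word_id[OF opX_closed[OF j vac_nf_space]] hact_simps(3))
  also have "\<dots> = single (\<alpha>(j := Suc (\<alpha> j)), g, id) 1"
    unfolding opX_single opG_single P.r_one[OF \<alpha>(2)] by (rule xpow_zero_exp_upd[OF \<alpha>(1) j])
  finally show ?thesis .
qed

lemma right_mult_x_id:
  assumes v: "v \<in> nf_space" and id: "\<And>k. k \<in> keys v \<Longrightarrow> snd (snd k) = id" and j: "j \<in> {1..n}"
  shows "hact (lin normal_form v) (opX j vac) = opX j v"
  unfolding hact_lin_normal_form[OF v]
proof (rule lin_cong)
  fix k assume k: "k \<in> keys v"
  obtain \<alpha> g where kk: "k = (\<alpha>, g, id)"
    using id[OF k] by (metis prod.collapse)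
  have b: "(\<alpha>, g, id) \<in> basis_keys"
    using v k kk by (auto simp: nf_space_def)
  show "hact (normal_form k) (opX j vac) = gen_act (XGen j) k"
    unfolding kk gen_act_simps by (rule normal_form_opX_vac_id[OF b j])
qed

subsection \<open>Central elements have no components outside the identity permutation\<close>

lemma lookup_opX:
  "lookup (opX j v) (\<beta>, g, w) = (if \<beta> j = 0 then 0 else lookup v (\<beta>(j := \<beta> j - 1), g, w))"
proof -
  define f where "f = (\<lambda>k :: 'g nf. ((fst k)(j := Suc (fst k j)), snd k))"
  have e: "opX j v = lin (\<lambda>k. single (f k) 1) v"
    by (rule lin_cong) (auto simp: f_def)
  show ?thesis
  proof (cases "\<beta> j = 0")
    case True
    then have "f k \<noteq> (\<beta>, g, w)" for k
      by (auto simp: f_def)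
    then show ?thesis
      using True by (simp add: e lookup_lin lookup_single_not_eq)
  next
    case False
    have "f k = (\<beta>, g, w) \<longleftrightarrow> k = (\<beta>(j := \<beta> j - 1), g, w)" for k
      using False by (cases k) (auto simp: f_def fun_eq_iff)
    then show ?thesis
      unfolding e using False by (simp add: lookup_lin_single_inj)
  qed
qed

text \<open>Moving a unit of exponent from \<open>x\<^sub>b\<close> to \<open>x\<^sub>a\<close> can be repeated finitely often only. This is the form in
  which it is used that \<open>x\<^sub>a - x\<^sub>b\<close> is not a zero divisor; the predicate \<open>Q\<close> restricts the argument
  to one total degree.\<close>

lemma shift_zero:
  fixes c :: "(nat \<Rightarrow> nat) \<Rightarrow> 'f::zero"
  assumes ab: "a \<noteq> b" and \<alpha>: "Q \<alpha>"
    and zero: "\<And>\<alpha>. Q \<alpha> \<Longrightarrow> \<alpha> b = 0 \<Longrightarrow> c \<alpha> = 0"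
    and shift: "\<And>\<alpha>. Q \<alpha> \<Longrightarrow> \<alpha> b > 0 \<Longrightarrow> Q (\<alpha>(a := Suc (\<alpha> a), b := \<alpha> b - 1)) \<and>
      c \<alpha> = c (\<alpha>(a := Suc (\<alpha> a), b := \<alpha> b - 1))"
  shows "c \<alpha> = 0"
  using \<alpha>
proof (induction "\<alpha> b" arbitrary: \<alpha>)
  case 0
  then show ?case using zero by simp
next
  case (Suc m)
  then show ?case
    using shift[of \<alpha>] Suc.hyps(1)[of "\<alpha>(a := Suc (\<alpha> a), b := \<alpha> b - 1)"] by simp
qed

lemma opX_eq_imp_zero:
  assumes "a \<noteq> b" "opX a u = opX b u"
  shows "u = 0"
proof (rule poly_mapping_eqI)
  fix k :: "'g nf"
  obtain \<alpha> g w where k: "k = (\<alpha>, g, w)" by (cases k)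
  have eq: "lookup u (\<alpha>, g, w) = (if \<alpha> b = 0 then 0 else lookup u (\<alpha>(a := Suc (\<alpha> a), b := \<alpha> b - 1), g, w))" for \<alpha>
    using arg_cong[OF assms(2), of "\<lambda>v. lookup v (\<alpha>(a := Suc (\<alpha> a)), g, w)"] assms(1)
    by (simp add: lookup_opX)
  have "lookup u (\<alpha>, g, w) = 0"
    by (rule shift_zero[OF assms(1), where c = "\<lambda>\<alpha>. lookup u (\<alpha>, g, w)" and Q = "\<lambda>_. True"])
      (use eq in auto)
  then show "lookup u k = lookup 0 k"
    by (simp add: k)
qed

text \<open>Let \<open>D\<close> be the top degree of the part of \<open>v\<close> with \<open>w \<noteq> id\<close>. In degree \<open>D + 1\<close> and away from
  \<open>w = id\<close>, left multiplication by \<open>x\<^sub>j\<close> agrees with multiplication by \<open>x\<^sub>w\<^sub>(\<^sub>j\<^sub>)\<close>: corrections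
  only come from terms with \<open>w \<noteq> id\<close>, and these have degree at most \<open>D\<close>.\<close>

lemma central_keys_id:
  fixes v :: "'g nf \<Rightarrow>\<^sub>0 'f::field"
  assumes v: "v \<in> nf_space"
    and comm: "\<And>j. j \<in> {1..n} \<Longrightarrow> hact (lin normal_form v) (opX j vac) = opX j v"
    and k: "k \<in> keys v"
  shows "snd (snd k) = id"
proof (rule ccontr)
  assume nid: "snd (snd k) \<noteq> id"
  define K where "K = {k \<in> keys v. snd (snd k) \<noteq> id}"
  define D where "D = Max ((\<lambda>k. deg (fst k)) ` K)"
  have "k \<in> K"
    using k nid by (simp add: K_def)
  then have K: "K \<noteq> {}"
    by blast
  have fin: "finite K"
    by (simp add: K_def)
  have D: "deg (fst k) \<le> D" if "k \<in> K" for k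
    unfolding D_def using fin that by (intro Max_ge) auto
  have "D \<in> (\<lambda>k. deg (fst k)) ` K"
    unfolding D_def using K fin by (intro Max_in) auto
  then obtain k0 where k0: "k0 \<in> K" "deg (fst k0) = D"
    by auto
  obtain \<alpha>0 g w where kk: "k0 = (\<alpha>0, g, w)" by (cases k0)
  have kk': "(\<alpha>0, g, w) \<in> keys v" "w \<noteq> id" "(\<alpha>0, g, w) \<in> basis_keys"
    using k0(1) v by (auto simp: K_def kk nf_space_def)
  have w: "w permutes {1..n}"
    using kk'(3) by (auto simp: basis_keys_def)
  obtain j where j: "w j \<noteq> j"
    using kk'(2) by (auto simp: fun_eq_iff)
  then have jn: "j \<in> {1..n}" "w j \<in> {1..n}"
    using w permutes_in_image[OF w] by (auto simp: permutes_def)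
  define R where "R = (\<lambda>k. hact (normal_form k) (opX j vac) - single (x_shift j k) (1 :: 'f))"
  have R: "lookup v k * lookup (R k) (\<beta>, g, w) = 0" if k: "k \<in> keys v" and \<beta>: "deg \<beta> = Suc D" for k \<beta>
  proof (cases "snd (snd k) = id")
    case True
    then obtain \<alpha>' g' where k': "k = (\<alpha>', g', id)"
      by (metis prod.collapse)
    have b: "(\<alpha>', g', id) \<in> basis_keys"
      using v k by (auto simp: nf_space_def k')
    have "R k = 0"
      unfolding R_def k' x_shift_def prod.case id_apply normal_form_opX_vac_id[OF b jn(1)] by simp
    then show ?thesis by simp
  next
    case False
    then have "deg (fst k) \<le> D"
      using k by (intro D) (simp add: K_def)
    moreover have "R k \<in> hom_space (deg (fst k))"
      unfolding R_def using v k by (intro normal_form_opX_vac jn) (auto simp: nf_space_def)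
    ultimately have "(\<beta>, g, w) \<notin> keys (R k)"
      using \<beta> by (auto simp: hom_space_def)
    then show ?thesis
      by (simp add: in_keys_iff)
  qed
  \<comment> \<open>Only leading terms reach degree \<open>D + 1\<close> at \<open>w\<close>.\<close>
  have right: "lookup (opX j v) (\<beta>, g, w) =
      (if \<beta> (w j) = 0 then 0 else lookup v (\<beta>(w j := \<beta> (w j) - 1), g, w))" if \<beta>: "deg \<beta> = Suc D" for \<beta>
  proof -
    have "lookup (opX j v) (\<beta>, g, w) = (\<Sum>k\<in>keys v. lookup v k * lookup (hact (normal_form k) (opX j vac)) (\<beta>, g, w))"
      unfolding comm[OF jn(1), symmetric] hact_lin_normal_form[OF v] lookup_lin ..
    also have "\<dots> = (\<Sum>k\<in>keys v. lookup v k * lookup (single (x_shift j k) 1) (\<beta>, g, w))"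
      by (rule sum.cong) (use R[OF _ \<beta>] in \<open>simp_all add: R_def lookup_minus algebra_simps\<close>)
    also have "\<dots> = lookup (lin (\<lambda>k. single (x_shift j k) 1) v) (\<beta>, g, w)"
      by (simp add: lookup_lin)
    also have "\<dots> = (if \<beta> (w j) = 0 then 0 else lookup v (\<beta>(w j := \<beta> (w j) - 1), g, w))"
    proof (cases "\<beta> (w j) = 0")
      case True
      then have "x_shift j k \<noteq> (\<beta>, g, w)" for k
        by (cases k) (auto simp: x_shift_def)
      then show ?thesis
        using True by (simp add: lookup_lin lookup_single_not_eq)
    next
      case False
      have "x_shift j k = (\<beta>, g, w) \<longleftrightarrow> k = (\<beta>(w j := \<beta> (w j) - 1), g, w)" for k
        using False by (cases k) (auto simp: x_shift_def fun_eq_iff)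
      then show ?thesis
        using False by (simp add: lookup_lin_single_inj)
    qed
    finally show ?thesis .
  qed
  have deg_upd: "deg (\<alpha>(a := Suc (\<alpha> a))) = Suc (deg \<alpha>)" if "a \<in> {1..n}" for \<alpha> a
    using that by (simp add: sum.remove[of "{1..n}" a])
  have deg_upd': "deg (\<alpha>(a := Suc (\<alpha> a), b := \<alpha> b - 1)) = deg \<alpha>" if "a \<in> {1..n}" "b \<in> {1..n}" "a \<noteq> b" "\<alpha> b > 0" for \<alpha> a b
    using that by (simp add: sum.remove[of "{1..n}" b] sum.remove[of "{1..n} - {b}" a])
  have eq: "lookup v (\<alpha>, g, w) =
      (if \<alpha> (w j) = 0 then 0 else lookup v (\<alpha>(j := Suc (\<alpha> j), w j := \<alpha> (w j) - 1), g, w))" if "deg \<alpha> = D" for \<alpha>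
    using right[of "\<alpha>(j := Suc (\<alpha> j))"] deg_upd[OF jn(1), of \<alpha>] that j by (simp add: lookup_opX)
  have "lookup v (\<alpha>0, g, w) = 0"
  proof (rule shift_zero[OF j[symmetric], where c = "\<lambda>\<alpha>. lookup v (\<alpha>, g, w)" and Q = "\<lambda>\<alpha>. deg \<alpha> = D"])
    show "deg \<alpha>0 = D"
      using k0(2) by (simp add: kk)
  qed (use eq deg_upd'[OF jn j[symmetric]] in auto)
  then show False
    using kk'(1) by (simp add: in_keys_iff)
qed

section \<open>The centre in terms of coefficients\<close>

text \<open>The coordinate vectors of central elements. Invariance is only demanded for adjacent
  transpositions, in the form in which the relations provide it; \<open>invariant_perm\<close> extends it to all
  permutations.\<close>

definition invariant :: "('g nf \<Rightarrow>\<^sub>0 'f::field) \<Rightarrow> bool" where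
  "invariant v \<longleftrightarrow> v \<in> nf_space \<and> (\<forall>k\<in>keys v. snd (snd k) = id) \<and>
    (\<forall>\<alpha>. \<forall>g\<in>carrier P. \<forall>h\<in>carrier P. lookup v (\<alpha>, h \<otimes>\<^bsub>P\<^esub> g \<otimes>\<^bsub>P\<^esub> inv\<^bsub>P\<^esub> h, id) = lookup v (\<alpha>, g, id)) \<and>
    (\<forall>\<alpha>\<in>{1..n} \<rightarrow>\<^sub>E UNIV. \<forall>g\<in>carrier P. \<forall>i\<in>{1..<n}. lookup v (\<alpha> \<circ> adj i, g \<circ> adj i, id) = lookup v (\<alpha>, g, id))"

lemma comp_adj_eq_iff: "f \<circ> adj i = g \<longleftrightarrow> f = g \<circ> adj i" "adj i \<circ> f' = g' \<longleftrightarrow> f' = adj i \<circ> g'"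
  by (auto simp: fun_eq_iff) (metis transpose_involutory)+

lemma lookup_opG:
  assumes v: "v \<in> nf_space" and h: "h \<in> carrier P" and g: "g \<in> carrier P"
  shows "lookup (opG h v) (\<alpha>, g, w) = lookup v (\<alpha>, inv\<^bsub>P\<^esub> h \<otimes>\<^bsub>P\<^esub> g, w)"
proof -
  have e: "opG h v = lin (\<lambda>k. single (fst k, h \<otimes>\<^bsub>P\<^esub> fst (snd k), snd (snd k)) 1) v"
    by (rule lin_cong) auto
  show ?thesis
    unfolding e
  proof (rule lookup_lin_single_inj)
    fix k assume "k \<in> keys v"
    then have "fst (snd k) \<in> carrier P"
      using v by (auto simp: nf_space_def basis_keys_def simp del: carrier_product_group)
    then have "h \<otimes>\<^bsub>P\<^esub> fst (snd k) = g \<longleftrightarrow> fst (snd k) = inv\<^bsub>P\<^esub> h \<otimes>\<^bsub>P\<^esub> g"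
      using h g P.inv_solve_left by blast
    then show "(fst k, h \<otimes>\<^bsub>P\<^esub> fst (snd k), snd (snd k)) = (\<alpha>, g, w) \<longleftrightarrow>
        k = (\<alpha>, inv\<^bsub>P\<^esub> h \<otimes>\<^bsub>P\<^esub> g, w)"
      by (cases k) auto
  qed
qed

lemma lookup_right_mult_g:
  assumes v: "v \<in> nf_space" and id: "\<And>k. k \<in> keys v \<Longrightarrow> snd (snd k) = id"
    and h: "h \<in> carrier P" and g: "g \<in> carrier P"
  shows "lookup (hact (lin normal_form v) (opG h vac)) (\<alpha>, g, w) = lookup v (\<alpha>, g \<otimes>\<^bsub>P\<^esub> inv\<^bsub>P\<^esub> h, w)"
  unfolding right_mult_g[OF v h]
proof (rule lookup_lin_single_inj)
  fix k assume k: "k \<in> keys v"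
  then have c: "fst (snd k) \<in> carrier P"
    using v by (auto simp: nf_space_def basis_keys_def simp del: carrier_product_group)
  have "fst (snd k) \<otimes>\<^bsub>P\<^esub> h = g \<longleftrightarrow> fst (snd k) = g \<otimes>\<^bsub>P\<^esub> inv\<^bsub>P\<^esub> h"
    using c h g P.inv_solve_right by blast
  then show "(fst k, fst (snd k) \<otimes>\<^bsub>P\<^esub> (h \<circ> inv_into UNIV (snd (snd k))), snd (snd k)) = (\<alpha>, g, w) \<longleftrightarrow>
      k = (\<alpha>, g \<otimes>\<^bsub>P\<^esub> inv\<^bsub>P\<^esub> h, w)"
    using id[OF k] by (cases k) (auto simp: inv_id)
qed

lemma lookup_right_mult_s:
  assumes v: "v \<in> nf_space" and i: "i \<in> {1..<n}"
  shows "lookup (hact (lin normal_form v) (opS i vac)) (\<alpha>, g, w) = lookup v (\<alpha>, g, w \<circ> adj i)"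
  unfolding right_mult_s[OF v i]
proof (rule lookup_lin_single_inj)
  fix k :: "'g nf"
  show "(fst k, fst (snd k), snd (snd k) \<circ> adj i) = (\<alpha>, g, w) \<longleftrightarrow> k = (\<alpha>, g, w \<circ> adj i)"
    using comp_adj_eq_iff(1)[of "snd (snd k)" i w] by (cases k) auto
qed

lemma lin_fun_add: "lin (\<lambda>k. f k + g k) v = lin f v + lin g v"
  by (simp add: lin_def scale_add sum.distrib)

lemma opS_eq: "opS i v = lin (\<lambda>k. single (twist i k) 1) v + lin (ddiff i) v"
  unfolding lin_fun_add[symmetric] by (rule lin_cong) simp

lemma lookup_lin_twist:
  "lookup (lin (\<lambda>k. single (twist i k) 1) v) (\<alpha>, g, w) = lookup v (\<alpha> \<circ> adj i, g \<circ> adj i, adj i \<circ> w)"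
proof (rule lookup_lin_single_inj)
  fix k :: "'g nf"
  obtain \<beta> b u where k: "k = (\<beta>, b, u)" by (cases k)
  show "twist i k = (\<alpha>, g, w) \<longleftrightarrow> k = (\<alpha> \<circ> adj i, g \<circ> adj i, adj i \<circ> w)"
    unfolding k twist_def prod.case prod.inject
    using comp_adj_eq_iff(1)[of \<beta> i \<alpha>] comp_adj_eq_iff(1)[of b i g] comp_adj_eq_iff(2)[of i u w] by blast
qed

lemma keys_sum_subset:
  assumes "\<And>i. i \<in> I \<Longrightarrow> keys (f i) \<subseteq> S"
  shows "keys (sum f I) \<subseteq> S"
  using assms
proof (induction I rule: infinite_finite_induct)
  case (insert x I)
  have "keys (f x + sum f I) \<subseteq> keys (f x) \<union> keys (sum f I)"
    by (rule Poly_Mapping.keys_add)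
  moreover have "keys (f x) \<subseteq> S" "keys (sum f I) \<subseteq> S"
    using insert by simp_all
  ultimately show ?case
    unfolding sum.insert[OF insert(1,2)] by (meson Un_least order_trans)
qed simp_all

lemma keys_dterm: "keys (dterm i c k) \<subseteq> {l. snd (snd l) = snd (snd k)}"
  unfolding dterm_def by (cases k) (simp, intro keys_sum_subset, simp)

lemma keys_ddiff: "keys (ddiff i k) \<subseteq> {l. snd (snd l) = snd (snd k)}"
  unfolding ddiff_def by (intro order_trans[OF keys_diff] Un_least keys_sum_subset keys_dterm)

lemma keys_lin_ddiff:
  fixes v :: "'g nf \<Rightarrow>\<^sub>0 'f::field"
  assumes "\<And>k. k \<in> keys v \<Longrightarrow> snd (snd k) = id" "l \<in> keys (lin (ddiff i) v)"
  shows "snd (snd l) = id"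
proof -
  obtain k where k: "k \<in> keys v" "l \<in> keys (ddiff i k :: 'g nf \<Rightarrow>\<^sub>0 'f)"
    using assms(2) keys_lin[of "ddiff i" v] by blast
  have "l \<in> {l. snd (snd l) = snd (snd k)}"
    by (rule subsetD[OF keys_ddiff k(2)])
  then show ?thesis
    using assms(1)[OF k(1)] by simp
qed

lemma adj_neq_id: "adj i \<noteq> id"
  by (metis id_apply n_not_Suc_n transpose_apply_first)

lemma gen_mem:
  "j \<in> {1..n} \<Longrightarrow> XGen j \<in> hecke_gens G n" "h \<in> carrier P \<Longrightarrow> GGen h \<in> hecke_gens G n"
  "i \<in> {1..<n} \<Longrightarrow> SGen i \<in> hecke_gens G n"
  by (auto simp: hecke_gens_def simp del: carrier_product_group)

lemma hecke_gens_cases: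
  assumes "a \<in> hecke_gens G n"
  obtains j where "a = XGen j" "j \<in> {1..n}" | h where "a = GGen h" "h \<in> carrier P"
    | i where "a = SGen i" "i \<in> {1..<n}"
  using assms by (auto simp: hecke_gens_def simp del: carrier_product_group)

text \<open>With \<open>w = id\<close> throughout, the coefficients of \<open>h v\<close> and \<open>v h\<close> at \<open>h g\<close>, and those of \<open>s\<^sub>i v\<close> and
  \<open>v s\<^sub>i\<close> at \<open>w = s\<^sub>i\<close>, are compared; divided differences only contribute at \<open>w = id\<close>.\<close>

lemma central_imp_invariant:
  assumes "central p"
  shows "invariant (hact p vac)"
proof -
  define v where "v = hact p vac"
  have p: "p \<in> F"
    using assms by (simp add: central_def)
  have v: "v \<in> nf_space"
    unfolding v_def by (rule hact_closed[OF p vac_nf_space])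
  have pv: "hact p u = hact (lin normal_form v) u" if "u \<in> nf_space" for u
    unfolding v_def by (rule hcong_hact[OF hecke_normal_form[OF p] that])
  have comm: "hact (lin normal_form v) (lin (gen_act a) vac) = lin (gen_act a) v" if a: "a \<in> hecke_gens G n" for a
    using central_hact[OF assms letter_free_algebra[OF a]]
    unfolding hact_simps(3) pv[OF gen_op_closed[OF a vac_nf_space]] v_def[symmetric] .
  have id: "snd (snd k) = id" if "k \<in> keys v" for k
    by (rule central_keys_id[OF v comm[OF gen_mem(1)] that])
  have conj: "lookup v (\<alpha>, h \<otimes>\<^bsub>P\<^esub> g \<otimes>\<^bsub>P\<^esub> inv\<^bsub>P\<^esub> h, id) = lookup v (\<alpha>, g, id)"
    if g: "g \<in> carrier P" and h: "h \<in> carrier P" for \<alpha> g h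
  proof -
    have hg: "h \<otimes>\<^bsub>P\<^esub> g \<in> carrier P"
      using h g by (rule P.m_closed)
    have "lookup (opG h v) (\<alpha>, h \<otimes>\<^bsub>P\<^esub> g, id) = lookup v (\<alpha>, h \<otimes>\<^bsub>P\<^esub> g \<otimes>\<^bsub>P\<^esub> inv\<^bsub>P\<^esub> h, id)"
      unfolding comm[OF gen_mem(2)[OF h], symmetric] by (rule lookup_right_mult_g[OF v id h hg])
    moreover have "inv\<^bsub>P\<^esub> h \<otimes>\<^bsub>P\<^esub> (h \<otimes>\<^bsub>P\<^esub> g) = g"
      using h g P.inv_solve_left[of g h "h \<otimes>\<^bsub>P\<^esub> g"] hg by metis
    ultimately show ?thesis
      unfolding lookup_opG[OF v h hg] by simp
  qed
  have sym: "lookup v (\<alpha> \<circ> adj i, g \<circ> adj i, id) = lookup v (\<alpha>, g, id)" if i: "i \<in> {1..<n}" for \<alpha> g i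
  proof -
    have "(\<alpha>, g, adj i) \<notin> keys (lin (ddiff i) v)"
      using keys_lin_ddiff[OF id, of v "(\<alpha>, g, adj i)" i] adj_neq_id by auto
    then have "lookup (opS i v) (\<alpha>, g, adj i) = lookup v (\<alpha> \<circ> adj i, g \<circ> adj i, id)"
      unfolding opS_eq by (simp add: lookup_add lookup_lin_twist in_keys_iff)
    moreover have "lookup (opS i v) (\<alpha>, g, adj i) = lookup v (\<alpha>, g, id)"
      unfolding comm[OF gen_mem(3)[OF i], symmetric] lookup_right_mult_s[OF v i] by simp
    ultimately show ?thesis by simp
  qed
  show ?thesis
    unfolding invariant_def v_def[symmetric] using v id conj sym by blast
qed

text \<open>Commuting with \<open>s\<^sub>i\<close> is the hard case. The commutator \<open>q = s\<^sub>i p - p s\<^sub>i\<close> only involves \<open>w = id\<close>, so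
  \<open>q x\<^sub>i = x\<^sub>i q\<close>, while the relations give \<open>q x\<^sub>i = x\<^sub>i\<^sub>+\<^sub>1 q\<close>. Two different \<open>x\<close> that act equally on
  \<open>q\<close> force \<open>q = 0\<close>, without any cancellation among divided differences being traced.\<close>

lemma invariant_imp_central:
  assumes "invariant v"
  shows "central (lin normal_form v)"
proof -
  let ?p = "lin normal_form v"
  have v: "v \<in> nf_space" and id: "\<And>k. k \<in> keys v \<Longrightarrow> snd (snd k) = id"
    and conj: "\<And>\<alpha> g h. g \<in> carrier P \<Longrightarrow> h \<in> carrier P \<Longrightarrow>
      lookup v (\<alpha>, h \<otimes>\<^bsub>P\<^esub> g \<otimes>\<^bsub>P\<^esub> inv\<^bsub>P\<^esub> h, id) = lookup v (\<alpha>, g, id)"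
    and sym: "\<And>\<alpha> g i. \<alpha> \<in> {1..n} \<rightarrow>\<^sub>E UNIV \<Longrightarrow> g \<in> carrier P \<Longrightarrow> i \<in> {1..<n} \<Longrightarrow>
      lookup v (\<alpha> \<circ> adj i, g \<circ> adj i, id) = lookup v (\<alpha>, g, id)"
    using assms unfolding invariant_def by blast+
  have p: "?p \<in> F"
    by (rule lin_normal_form_F[OF v])
  have pvac: "hact ?p vac = v"
    by (rule hact_lin_normal_form_vac[OF v])
  have zero: "lookup v (\<alpha>, g, w) = 0" if "w \<noteq> id" for \<alpha> g w
    using id[of "(\<alpha>, g, w)"] that by (auto simp: in_keys_iff)
  have eqI: "u = u'" if "u \<in> nf_space" "u' \<in> nf_space"
    "\<And>\<alpha> g w. \<alpha> \<in> {1..n} \<rightarrow>\<^sub>E UNIV \<Longrightarrow> g \<in> carrier P \<Longrightarrow> lookup u (\<alpha>, g, w) = lookup u' (\<alpha>, g, w)"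
    for u u' :: "'g nf \<Rightarrow>\<^sub>0 'a"
  proof (rule poly_mapping_eqI)
    fix k
    show "lookup u k = lookup u' k"
    proof (cases "k \<in> basis_keys")
      case True
      then show ?thesis
        using that(3) by (auto elim!: basis_keysE simp del: carrier_product_group)
    next
      case False
      then have "k \<notin> keys u" "k \<notin> keys u'"
        using that(1,2) by (auto simp: nf_space_def)
      then show ?thesis
        by (simp add: in_keys_iff)
    qed
  qed
  have X: "hact ?p (opX j vac) = opX j v" if j: "j \<in> {1..n}" for j
    by (rule right_mult_x_id[OF v id j])
  have G: "hact ?p (opG h vac) = opG h v" if h: "h \<in> carrier P" for h
  proof (rule eqI)
    show "hact ?p (opG h vac) \<in> nf_space" "opG h v \<in> nf_space"
      by (intro hact_closed p opG_closed h vac_nf_space v)+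
    fix \<alpha> g w
    assume g: "g \<in> carrier P"
    have ih: "inv\<^bsub>P\<^esub> h \<in> carrier P"
      using h by (rule P.inv_closed)
    have "inv\<^bsub>P\<^esub> h \<otimes>\<^bsub>P\<^esub> (g \<otimes>\<^bsub>P\<^esub> inv\<^bsub>P\<^esub> h) \<otimes>\<^bsub>P\<^esub> inv\<^bsub>P\<^esub> (inv\<^bsub>P\<^esub> h) = inv\<^bsub>P\<^esub> h \<otimes>\<^bsub>P\<^esub> g"
      using g h ih by (simp add: P.m_assoc del: carrier_product_group)
    then have "lookup v (\<alpha>, inv\<^bsub>P\<^esub> h \<otimes>\<^bsub>P\<^esub> g, id) = lookup v (\<alpha>, g \<otimes>\<^bsub>P\<^esub> inv\<^bsub>P\<^esub> h, id)"
      using conj[OF P.m_closed[OF g ih] ih] by metis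
    then have c: "lookup v (\<alpha>, g \<otimes>\<^bsub>P\<^esub> inv\<^bsub>P\<^esub> h, w) = lookup v (\<alpha>, inv\<^bsub>P\<^esub> h \<otimes>\<^bsub>P\<^esub> g, w)"
      by (cases "w = id") (simp_all add: zero)
    have "lookup (hact ?p (opG h vac)) (\<alpha>, g, w) = lookup v (\<alpha>, g \<otimes>\<^bsub>P\<^esub> inv\<^bsub>P\<^esub> h, w)"
      by (rule lookup_right_mult_g[OF v id h g])
    then show "lookup (hact ?p (opG h vac)) (\<alpha>, g, w) = lookup (opG h v) (\<alpha>, g, w)"
      unfolding c lookup_opG[OF v h g] .
  qed
  have S: "hact ?p (opS i vac) = opS i v" if i: "i \<in> {1..<n}" for i
  proof -
    \<comment> \<open>The coordinate vector of the commutator \<open>s\<^sub>i p - p s\<^sub>i\<close>.\<close>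
    define u where "u = opS i v - hact ?p (opS i vac)"
    have nf: "opS i vac \<in> nf_space" "opS i v \<in> nf_space" "hact ?p (opS i vac) \<in> nf_space"
      by (intro hact_closed p opS_closed i vac_nf_space v)+
    have u: "u \<in> nf_space"
      unfolding u_def using nf by simp
    \<comment> \<open>By symmetry the leading parts cancel, and only divided differences remain in \<open>u\<close>; these live at \<open>w = id\<close>.\<close>
    have T: "lin (\<lambda>k. single (twist i k) 1) v = hact ?p (opS i vac)"
    proof (rule eqI)
      show "lin (\<lambda>k. single (twist i k) 1) v \<in> nf_space"
        by (rule nf_space_lin[OF v]) (simp add: twist_closed[OF i])
      fix \<alpha> g w
      assume \<alpha>: "\<alpha> \<in> {1..n} \<rightarrow>\<^sub>E (UNIV :: nat set)" and g: "g \<in> carrier P"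
      show "lookup (lin (\<lambda>k. single (twist i k) 1) v) (\<alpha>, g, w) = lookup (hact ?p (opS i vac)) (\<alpha>, g, w)"
        unfolding lookup_lin_twist lookup_right_mult_s[OF v i]
      proof (cases "w = adj i")
        case True
        then show "lookup v (\<alpha> \<circ> adj i, g \<circ> adj i, adj i \<circ> w) = lookup v (\<alpha>, g, w \<circ> adj i)"
          using sym[OF \<alpha> g i] by simp
      next
        case False
        then have "adj i \<circ> w \<noteq> id" "w \<circ> adj i \<noteq> id"
          using comp_adj_eq_iff(1)[where i = i and f = w and g = id]
            comp_adj_eq_iff(2)[where i = i and f' = w and g' = id] by simp_all
        then show "lookup v (\<alpha> \<circ> adj i, g \<circ> adj i, adj i \<circ> w) = lookup v (\<alpha>, g, w \<circ> adj i)"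
          by (simp add: zero)
      qed
    qed (rule nf)
    have u_eq: "u = lin (ddiff i) v"
      unfolding u_def opS_eq T by simp
    have uid: "snd (snd k) = id" if "k \<in> keys u" for k
      using keys_lin_ddiff[OF id] that unfolding u_eq by blast
    define q where "q = sL i * ?p - ?p * sL i"
    have q: "q \<in> F"
      unfolding q_def using p i by simp
    have qvac: "hact q vac = u"
      unfolding q_def u_def by (simp add: pvac del: lin_single)
    have pX: "hact ?p (opX j y) = opX j (hact ?p y)" if "j \<in> {1..n}" "y \<in> nf_space" for j y
      using commute_gen_hact[OF p gen_mem(1)[OF that(1)] _ that(2)] X[OF that(1)] by (simp only: pvac)
    have pG: "hact ?p (opG h y) = opG h (hact ?p y)" if "h \<in> carrier P" "y \<in> nf_space" for h y
      using commute_gen_hact[OF p gen_mem(2)[OF that(1)] _ that(2)] G[OF that(1)] by (simp only: pvac)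
    have pT: "hact ?p (opT j k vac) = opT j k v" for j k
      unfolding opT_def linear_map_sum[OF linear_hact]
      by (rule sum.cong) (simp_all add: G del: carrier_product_group lin_single)
    have ii: "i \<in> {1..n}" "Suc i \<in> {1..n}"
      using i by auto
    \<comment> \<open>The corrections with \<open>t\<^sub>i\<^sub>,\<^sub>i\<^sub>+\<^sub>1\<close> from the two terms of \<open>q x\<^sub>i\<close> cancel.\<close>
    have "hact q (opX i vac) = opS i (opX i v) - hact ?p (opX (Suc i) (opS i vac) - opT i (Suc i) vac)"
      unfolding q_def hact_simps X[OF ii(1)] opS_opX ..
    also have "\<dots> = opX (Suc i) (opS i v) - opX (Suc i) (hact ?p (opS i vac))"
      unfolding opS_opX linear_map_diff[OF linear_hact] pT pX[OF ii(2) nf(1)] by simp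
    also have "\<dots> = opX (Suc i) u"
      unfolding u_def lin_diff ..
    finally have 1: "hact q (opX i vac) = opX (Suc i) u" .
    have "hact q (opX i vac) = hact (lin normal_form u) (opX i vac)"
      using hcong_hact[OF hecke_normal_form[OF q] opX_closed[OF ii(1) vac_nf_space]] unfolding qvac .
    also have "\<dots> = opX i u"
      by (rule right_mult_x_id[OF u uid ii(1)])
    finally have "opX i u = opX (Suc i) u"
      unfolding 1 ..
    then have "u = 0"
      by (rule opX_eq_imp_zero[rotated]) simp
    then show ?thesis
      by (simp add: u_def)
  qed
  show ?thesis
  proof (rule central_gensI[OF p])
    fix a assume "a \<in> hecke_gens G n"
    then show "hact ?p (lin (gen_act a) vac) = lin (gen_act a) (hact ?p vac)"
      unfolding pvac
      by (cases rule: hecke_gens_cases) (simp_all only: X G S)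
  qed
qed

section \<open>Residue classes\<close>

abbreviation H :: "('g, 'f::field) free_hecke set ring" where
  "H \<equiv> wreath_Hecke G n"

lemma class_hom: "hecke_class G n \<in> ring_hom (free_algebra (hecke_gens G n)) H"
  using ideal.rcos_ring_hom[OF ideal_J] by (simp add: wreath_Hecke_def hecke_class_def[abs_def])

lemma class_closed [simp]: "p \<in> F \<Longrightarrow> hecke_class G n p \<in> carrier H"
  using ring_hom_closed[OF class_hom] .

lemma class_mult: "p \<in> F \<Longrightarrow> q \<in> F \<Longrightarrow> hecke_class G n (p * q) = hecke_class G n p \<otimes>\<^bsub>H\<^esub> hecke_class G n q"
  using ring_hom_mult[OF class_hom] by simp

lemma class_add: "p \<in> F \<Longrightarrow> q \<in> F \<Longrightarrow> hecke_class G n (p + q) = hecke_class G n p \<oplus>\<^bsub>H\<^esub> hecke_class G n q"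
  using ring_hom_add[OF class_hom] by simp

lemma class_one: "hecke_class G n 1 = \<one>\<^bsub>H\<^esub>"
  using ring_hom_one[OF class_hom] by simp

lemma class_zero: "hecke_class G n 0 = \<zero>\<^bsub>H\<^esub>"
  using ring_hom_zero[OF class_hom ring_free_algebra ring_wreath_Hecke[OF is_group]] by simp

lemma class_surj:
  assumes "z \<in> carrier H"
  obtains p where "p \<in> F" "z = hecke_class G n p"
  using assms unfolding wreath_Hecke_def FactRing_def A_RCOSETS_def' hecke_class_def by auto

lemma class_eq_iff:
  fixes p :: "('g, 'f::field) free_hecke"
  assumes "p \<in> F" "q \<in> F"
  shows "hecke_class G n p = hecke_class G n q \<longleftrightarrow> p \<approx>\<^sub>H q"
proof -
  let ?R = "free_algebra (hecke_gens G n) :: ('g, 'f) free_hecke ring"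
  interpret R: ring ?R
    by (rule ring_free_algebra)
  have "\<ominus>\<^bsub>?R\<^esub> q = - q"
    using assms(2) by (intro R.minus_equality) auto
  then have "p \<ominus>\<^bsub>?R\<^esub> q = p - q"
    by (simp add: a_minus_def)
  then show ?thesis
    using R.quotient_eq_iff_same_a_r_cos[OF ideal_J, of p q] assms
    by (simp add: hecke_cong_def hecke_class_def)
qed

lemma class_sum:
  assumes "finite I" "\<And>i. i \<in> I \<Longrightarrow> f i \<in> F"
  shows "hecke_class G n (sum f I) = (\<Oplus>\<^bsub>H\<^esub>i\<in>I. hecke_class G n (f i))"
proof -
  interpret H: ring H
    by (rule ring_wreath_Hecke[OF is_group])
  show ?thesis
    using assms
  proof (induction I)
    case empty
    then show ?case by (simp add: class_zero)
  next
    case (insert i I)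
    then show ?case
      by (subst H.finsum_insert) (auto simp: class_add sum_free_algebra)
  qed
qed

lemma class_power: "p \<in> F \<Longrightarrow> hecke_class G n (p ^ k) = hecke_class G n p [^]\<^bsub>H\<^esub> k"
proof (induction k)
  case 0
  then show ?case by (simp add: class_one nat_pow_def)
next
  case (Suc k)
  then show ?case
    by (subst power_Suc2) (simp add: class_mult nat_pow_def)
qed

lemma class_xpow: "hecke_class G n (xpow \<alpha>) = hecke_xpow G n \<alpha>"
proof -
  have gen: "set as \<subseteq> {1..n} \<Longrightarrow> hecke_class G n (prod_list (map (\<lambda>k. xL k ^ \<alpha> k) as)) =
    foldr (\<lambda>k z. (hecke_class G n (xL k) [^]\<^bsub>H\<^esub> \<alpha> k) \<otimes>\<^bsub>H\<^esub> z) as \<one>\<^bsub>H\<^esub>" for as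
  proof (induction as)
    case (Cons a as)
    have asF: "prod_list (map (\<lambda>k. xL k ^ \<alpha> k) as) \<in> F"
      using Cons.prems by (intro prod_list_F power_F gens_closed) auto
    show ?case
      using Cons by (simp add: class_mult class_power asF)
  qed (simp add: class_one)
  show ?thesis
    unfolding xpow_def hecke_xpow_def by (rule gen) auto
qed

text \<open>Passage from the quotient ring to congruences between representatives.\<close>

lemma ring_center_eq: "ring_center (H :: ('g, 'f::field) free_hecke set ring) = hecke_class G n ` {p. central p}"
  (is "?Z = ?C")
proof
  show "?Z \<subseteq> ?C"
  proof
    fix z :: "('g, 'f) free_hecke set" assume z: "z \<in> ring_center H"
    then obtain p where p: "p \<in> F" "z = hecke_class G n p"
      by (auto simp: ring_center_def elim: class_surj)
    have "p * a \<approx>\<^sub>H a * p" if "a \<in> F" for a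
    proof -
      have "hecke_class G n (p * a) = hecke_class G n (a * p)"
        using z that p by (simp add: ring_center_def class_mult)
      then show ?thesis
        using class_eq_iff[of "p * a" "a * p"] p(1) that by simp
    qed
    then have "central p"
      using p(1) by (simp add: central_def)
    then show "z \<in> ?C"
      using p(2) by blast
  qed
next
  show "?C \<subseteq> ?Z"
  proof clarify
    fix p :: "('g, 'f) free_hecke" assume p: "central p"
    then have pF: "p \<in> F"
      by (simp add: central_def)
    have "hecke_class G n p \<otimes>\<^bsub>H\<^esub> z = z \<otimes>\<^bsub>H\<^esub> hecke_class G n p" if z: "z \<in> carrier H" for z
    proof -
      obtain a where a: "a \<in> F" "z = hecke_class G n a"
        using z by (rule class_surj)
      have "hecke_class G n (p * a) = hecke_class G n (a * p)"
        using p a(1) pF by (subst class_eq_iff) (auto simp: central_def)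
      then show ?thesis
        using a pF by (simp add: class_mult)
    qed
    then show "hecke_class G n p \<in> ring_center H"
      using pF by (simp add: ring_center_def)
  qed
qed

lemma normal_form_id:
  assumes "g \<in> carrier P"
  shows "normal_form (\<alpha>, g, id) \<approx>\<^sub>H (xpow \<alpha> * gL g :: ('g, 'f::field) free_hecke)"
proof -
  have "sword (perm_word id) \<approx>\<^sub>H sword []"
    using perm_word[OF permutes_id] by (intro hcong_sword_perm) auto
  then have "(xpow \<alpha> * gL g) * sword (perm_word id) \<approx>\<^sub>H ((xpow \<alpha> * gL g) * sword [] :: ('g, 'f) free_hecke)"
    by (rule hcong_multL) (intro times_free_algebra xpow_F gens_closed(1)[OF assms])
  then show ?thesis
    by (simp add: normal_form_def sword_def mult.assoc)
qed

lemma perm_tuple_word_perm_Cons: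
  assumes "i \<in> {1..<n}" "set u \<subseteq> {1..<n}"
  shows "perm_tuple n (word_perm (i # u)) f = perm_tuple n (word_perm u) f \<circ> adj i"
proof
  fix k
  have "bij (word_perm u)"
    using permutes_bij[OF word_perm_permutes[OF assms(2)]] .
  then have iv: "inv_into UNIV (word_perm (i # u)) = inv_into UNIV (word_perm u) \<circ> adj i"
    by (simp add: o_inv_distrib del: o_apply)
  show "perm_tuple n (word_perm (i # u)) f k = (perm_tuple n (word_perm u) f \<circ> adj i) k"
    unfolding perm_tuple_def iv using adj_in_iff[of i n k] assms(1) by (simp add: restrict_def)
qed

lemma perm_tuple_id: "f \<in> {1..n} \<rightarrow>\<^sub>E A \<Longrightarrow> perm_tuple n id f = f"
  by (auto simp: perm_tuple_def fun_eq_iff PiE_iff extensional_def inv_id)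

text \<open>Every permutation is the product of a word in adjacent transpositions.\<close>

lemma invariant_perm:
  assumes inv: "invariant v" and w: "w permutes {1..n}"
    and \<alpha>: "\<alpha> \<in> {1..n} \<rightarrow>\<^sub>E UNIV" and g: "g \<in> carrier P"
  shows "lookup v (perm_tuple n w \<alpha>, perm_tuple n w g, id) = lookup v (\<alpha>, g, id)"
proof -
  have g': "g \<in> {1..n} \<rightarrow>\<^sub>E carrier G"
    using g by simp
  have "lookup v (perm_tuple n (word_perm u) \<alpha>, perm_tuple n (word_perm u) g, id) = lookup v (\<alpha>, g, id)"
    if "set u \<subseteq> {1..<n}" for u
    using that
  proof (induction u)
    case Nil
    show ?case
      unfolding word_perm_simps perm_tuple_id[OF \<alpha>] perm_tuple_id[OF g'] ..
  next
    case (Cons i u)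
    then have i: "i \<in> {1..<n}" and u: "set u \<subseteq> {1..<n}"
      by auto
    note wu = word_perm_permutes[OF u]
    have "perm_tuple n (word_perm u) g \<in> carrier P"
      using perm_tuple_closed[OF wu g'] by simp
    then show ?case
      unfolding perm_tuple_word_perm_Cons[OF i u] Cons.IH[OF u, symmetric]
      using inv i perm_tuple_closed[OF wu \<alpha>] unfolding invariant_def by blast
  qed
  from this[OF perm_word(1)[OF w]] show ?thesis
    unfolding perm_word(2)[OF w] .
qed

end

section \<open>Class functions and symmetric coefficients\<close>

text \<open>The enumeration \<open>C\<close> of the conjugacy classes of \<open>G\<close> makes the conjugacy classes of \<open>G\<^sup>n\<close>
  correspond to multi-indices: \<open>tuple_index\<close> gives the class of a tuple, and \<open>representative\<close> picks
  an element of a class.\<close>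

locale wreath_classes = wreath_data G n for G :: "('g, 'm) monoid_scheme" (structure) and n +
  fixes s :: nat and C :: "nat \<Rightarrow> 'g set"
  assumes bij_C: "bij_betw C {1..s} (conj_classes G)"
begin

definition conj_class_of :: "'g \<Rightarrow> 'g set" where
  "conj_class_of x = {h \<otimes> x \<otimes> inv h | h. h \<in> carrier G}"

lemma conj_classes_eq: "conj_classes G = conj_class_of ` carrier G"
  by (auto simp: conj_classes_def orbits_def orbit_def conj_class_of_def)

lemma conj_class_of_self: "x \<in> carrier G \<Longrightarrow> x \<in> conj_class_of x"
  unfolding conj_class_of_def by (rule CollectI, rule exI[of _ \<one>]) simp

lemma conj_class_of_closed: "x \<in> carrier G \<Longrightarrow> conj_class_of x \<subseteq> carrier G"
  by (auto simp: conj_class_of_def)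

lemma conj_class_of_subset: "x \<in> carrier G \<Longrightarrow> y \<in> conj_class_of x \<Longrightarrow> conj_class_of y \<subseteq> conj_class_of x"
proof
  fix z assume x: "x \<in> carrier G" and "y \<in> conj_class_of x" "z \<in> conj_class_of y"
  then obtain h k where hk: "h \<in> carrier G" "k \<in> carrier G" "y = h \<otimes> x \<otimes> inv h" "z = k \<otimes> y \<otimes> inv k"
    by (auto simp: conj_class_of_def)
  then have "z = (k \<otimes> h) \<otimes> x \<otimes> inv (k \<otimes> h)"
    using x by (simp add: m_assoc inv_mult_group)
  then show "z \<in> conj_class_of x"
    using hk(1,2) unfolding conj_class_of_def by blast
qed

lemma conj_class_of_sym: "x \<in> carrier G \<Longrightarrow> y \<in> conj_class_of x \<Longrightarrow> x \<in> conj_class_of y"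
proof -
  assume x: "x \<in> carrier G" and "y \<in> conj_class_of x"
  then obtain h where h: "h \<in> carrier G" "y = h \<otimes> x \<otimes> inv h"
    by (auto simp: conj_class_of_def)
  have "inv h \<otimes> (h \<otimes> (x \<otimes> (inv h \<otimes> h))) = x"
    using x h by (simp add: m_assoc[symmetric])
  then have "x = inv h \<otimes> y \<otimes> inv (inv h)"
    using x h by (simp add: m_assoc)
  then show "x \<in> conj_class_of y"
    using h(1) unfolding conj_class_of_def by blast
qed

lemma conj_class_of_eq: "x \<in> carrier G \<Longrightarrow> y \<in> conj_class_of x \<Longrightarrow> conj_class_of y = conj_class_of x"
  using conj_class_of_subset conj_class_of_sym conj_class_of_closed by (metis subset_antisym subsetD)

lemma C_eq: "i \<in> {1..s} \<Longrightarrow> x \<in> C i \<Longrightarrow> x \<in> carrier G \<and> C i = conj_class_of x"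
proof -
  assume i: "i \<in> {1..s}" and x: "x \<in> C i"
  then have "C i \<in> conj_classes G"
    using bij_C by (auto simp: bij_betw_def)
  then obtain y where y: "y \<in> carrier G" "C i = conj_class_of y"
    by (auto simp: conj_classes_eq)
  then show ?thesis
    using x conj_class_of_eq[OF y(1), of x] conj_class_of_closed[OF y(1)] by auto
qed

lemma C_nonempty: "i \<in> {1..s} \<Longrightarrow> C i \<noteq> {}"
proof -
  assume "i \<in> {1..s}"
  then have "C i \<in> conj_classes G"
    using bij_C by (auto simp: bij_betw_def)
  then obtain y where "y \<in> carrier G" "C i = conj_class_of y"
    by (auto simp: conj_classes_eq)
  then show "C i \<noteq> {}"
    using conj_class_of_self by blast
qed

lemma C_ex1: "x \<in> carrier G \<Longrightarrow> \<exists>!i. i \<in> {1..s} \<and> x \<in> C i"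
proof -
  assume x: "x \<in> carrier G"
  then obtain i where i: "i \<in> {1..s}" "C i = conj_class_of x"
    using bij_C unfolding bij_betw_def conj_classes_eq by (metis imageE imageI)
  show ?thesis
  proof (rule ex1I[of _ i])
    show "i \<in> {1..s} \<and> x \<in> C i"
      using i conj_class_of_self[OF x] by simp
    fix j assume j: "j \<in> {1..s} \<and> x \<in> C j"
    then have "C j = C i"
      using C_eq[of j x] i by simp
    then show "j = i"
      using bij_C i(1) j unfolding bij_betw_def inj_on_def by blast
  qed
qed

definition class_index :: "'g \<Rightarrow> nat" where
  "class_index x = (THE i. i \<in> {1..s} \<and> x \<in> C i)"

lemma class_index: "x \<in> carrier G \<Longrightarrow> class_index x \<in> {1..s} \<and> x \<in> C (class_index x)"
  unfolding class_index_def by (rule theI'[OF C_ex1])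

lemma class_index_eq: "i \<in> {1..s} \<Longrightarrow> x \<in> C i \<Longrightarrow> class_index x = i"
  using C_ex1[of x] C_eq[of i x] class_index[of x] by blast

definition tuple_index :: "(nat \<Rightarrow> 'g) \<Rightarrow> nat \<Rightarrow> nat" where
  "tuple_index g = (\<lambda>k\<in>{1..n}. class_index (g k))"

definition representative :: "(nat \<Rightarrow> nat) \<Rightarrow> nat \<Rightarrow> 'g" where
  "representative i = (\<lambda>k\<in>{1..n}. SOME x. x \<in> C (i k))"

abbreviation indices :: "(nat \<Rightarrow> nat) set" where
  "indices \<equiv> {1..n} \<rightarrow>\<^sub>E {1..s}"

abbreviation tuples :: "(nat \<Rightarrow> nat) \<Rightarrow> (nat \<Rightarrow> 'g) set" where
  "tuples i \<equiv> \<Pi>\<^sub>E k\<in>{1..n}. C (i k)"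

lemma tuple_index_closed: "g \<in> carrier P \<Longrightarrow> tuple_index g \<in> indices"
  using class_index P_apply_closed[of g] unfolding tuple_index_def
  by (auto simp del: carrier_product_group atLeastAtMost_iff)

lemma tuples_closed: "i \<in> indices \<Longrightarrow> g \<in> tuples i \<Longrightarrow> g \<in> carrier P"
proof -
  assume "i \<in> indices" "g \<in> tuples i"
  then have "g k \<in> carrier G" if "k \<in> {1..n}" for k
    using that C_eq[of "i k" "g k"] by (auto simp: PiE_iff simp del: atLeastAtMost_iff)
  then show ?thesis
    using \<open>g \<in> tuples i\<close> by (auto simp: PiE_iff)
qed

lemma tuples_iff:
  assumes i: "i \<in> indices" and g: "g \<in> carrier P"
  shows "g \<in> tuples i \<longleftrightarrow> tuple_index g = i"
proof
  assume "g \<in> tuples i"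
  then show "tuple_index g = i"
    using i class_index_eq
    by (auto simp: tuple_index_def fun_eq_iff PiE_iff extensional_def simp del: atLeastAtMost_iff)
next
  assume eq: "tuple_index g = i"
  have "g k \<in> C (i k)" if "k \<in> {1..n}" for k
    using class_index[OF P_apply_closed[OF g that]] that by (simp add: eq[symmetric] tuple_index_def)
  then show "g \<in> tuples i"
    using g by (auto simp: PiE_iff)
qed

lemma representative_tuples: "i \<in> indices \<Longrightarrow> representative i \<in> tuples i"
  using C_nonempty some_in_eq unfolding representative_def
  by (auto simp: PiE_iff simp del: atLeastAtMost_iff)

lemma representative_closed: "i \<in> indices \<Longrightarrow> representative i \<in> carrier P"
  using representative_tuples tuples_closed by blast

lemma tuple_index_representative: "i \<in> indices \<Longrightarrow> tuple_index (representative i) = i"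
  using tuples_iff[of i "representative i"] representative_tuples representative_closed by blast

lemma tuple_index_conj:
  assumes g: "g \<in> carrier P" and h: "h \<in> carrier P"
  shows "tuple_index (h \<otimes>\<^bsub>P\<^esub> g \<otimes>\<^bsub>P\<^esub> inv\<^bsub>P\<^esub> h) = tuple_index g"
proof -
  have "class_index (h k \<otimes> g k \<otimes> inv (h k)) = class_index (g k)" if k: "k \<in> {1..n}" for k
  proof -
    note c = P_apply_closed[OF g k] P_apply_closed[OF h k]
    have "C (class_index (g k)) = conj_class_of (g k)"
      using C_eq class_index[OF c(1)] by blast
    moreover have "h k \<otimes> g k \<otimes> inv (h k) \<in> conj_class_of (g k)"
      using c(2) unfolding conj_class_of_def by blast
    ultimately show ?thesis
      using class_index[OF c(1)] by (intro class_index_eq) auto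
  qed
  moreover have "inv\<^bsub>P\<^esub> h = (\<lambda>k\<in>{1..n}. inv (h k))"
    using h by (intro inv_product_group) auto
  ultimately show ?thesis
    by (auto simp: tuple_index_def P_mult_apply fun_eq_iff)
qed

text \<open>Conjugacy in \<open>G\<^sup>n\<close> is conjugacy in each factor.\<close>

lemma conj_representative:
  assumes g: "g \<in> carrier P"
  shows "\<exists>h\<in>carrier P. representative (tuple_index g) = h \<otimes>\<^bsub>P\<^esub> g \<otimes>\<^bsub>P\<^esub> inv\<^bsub>P\<^esub> h"
proof -
  let ?r = "representative (tuple_index g)"
  have r: "?r \<in> tuples (tuple_index g)" "g \<in> tuples (tuple_index g)"
    using representative_tuples tuples_iff g tuple_index_closed by blast+
  have "\<exists>h. h \<in> carrier G \<and> ?r k = h \<otimes> g k \<otimes> inv h" if k: "k \<in> {1..n}" for k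
  proof -
    have "tuple_index g k \<in> {1..s}" "?r k \<in> C (tuple_index g k)" "g k \<in> C (tuple_index g k)"
      using r tuple_index_closed[OF g] k by (auto simp del: atLeastAtMost_iff)
    then have "?r k \<in> conj_class_of (g k)"
      using C_eq by blast
    then show ?thesis
      by (auto simp: conj_class_of_def)
  qed
  then obtain h where h: "\<And>k. k \<in> {1..n} \<Longrightarrow> h k \<in> carrier G \<and> ?r k = h k \<otimes> g k \<otimes> inv (h k)"
    by metis
  define h' where "h' = restrict h {1..n}"
  have h': "h' \<in> carrier P"
    using h by (auto simp: h'_def)
  have iv: "inv\<^bsub>P\<^esub> h' = (\<lambda>k\<in>{1..n}. inv (h' k))"
    using h' by (intro inv_product_group) auto
  have "?r = h' \<otimes>\<^bsub>P\<^esub> g \<otimes>\<^bsub>P\<^esub> inv\<^bsub>P\<^esub> h'"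
  proof (rule P_eqI)
    show "?r \<in> carrier P"
      using representative_closed tuple_index_closed[OF g] by blast
    show "h' \<otimes>\<^bsub>P\<^esub> g \<otimes>\<^bsub>P\<^esub> inv\<^bsub>P\<^esub> h' \<in> carrier P"
      using g h' by (intro P.m_closed P.inv_closed)
    fix k assume k: "k \<in> {1..n}"
    then show "?r k = (h' \<otimes>\<^bsub>P\<^esub> g \<otimes>\<^bsub>P\<^esub> inv\<^bsub>P\<^esub> h') k"
      unfolding P_mult_apply iv using h[OF k] by (simp add: h'_def del: atLeastAtMost_iff)
  qed
  then show ?thesis using h' by blast
qed

lemma perm_tuple_apply_closed: "w permutes {1..n} \<Longrightarrow> k \<in> {1..n} \<Longrightarrow> inv_into UNIV w k \<in> {1..n}"
  using permutes_in_image[OF permutes_inv[of w "{1..n}"], of k] by simp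

lemma representative_perm:
  "w permutes {1..n} \<Longrightarrow> representative (perm_tuple n w i) = perm_tuple n w (representative i)"
  using perm_tuple_apply_closed[of w]
  by (auto simp: representative_def perm_tuple_def fun_eq_iff simp del: atLeastAtMost_iff)

lemma tuple_index_adj:
  "i \<in> {1..<n} \<Longrightarrow> tuple_index (g \<circ> adj i) = tuple_index g \<circ> adj i"
  using adj_in_iff[of i n] by (auto simp: tuple_index_def fun_eq_iff restrict_def simp del: atLeastAtMost_iff)

abbreviation supp :: "((nat \<Rightarrow> nat) \<Rightarrow> (nat \<Rightarrow> nat) \<Rightarrow> 'f::field) \<Rightarrow> ((nat \<Rightarrow> nat) \<times> (nat \<Rightarrow> nat)) set" where
  "supp d \<equiv> {(i, \<alpha>) \<in> indices \<times> ({1..n} \<rightarrow>\<^sub>E UNIV). d i \<alpha> \<noteq> 0}"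

text \<open>The coordinate vector of \<open>\<Sum> d\<^sub>i\<^sub>,\<^sub>\<alpha> x\<^sup>\<alpha> C\<^sub>i\<close>, where \<open>C\<^sub>i\<close> is the class sum.\<close>

definition class_vector :: "((nat \<Rightarrow> nat) \<Rightarrow> (nat \<Rightarrow> nat) \<Rightarrow> 'f::field) \<Rightarrow> ('g nf \<Rightarrow>\<^sub>0 'f)" where
  "class_vector d = (\<Sum>(i, \<alpha>)\<in>supp d. \<Sum>g\<in>tuples i. single (\<alpha>, g, id) (d i \<alpha>))"

lemma finite_tuples: "i \<in> indices \<Longrightarrow> finite (tuples i)"
proof -
  assume i: "i \<in> indices"
  have "finite (carrier P)"
    using finite_carrier by (auto intro: finite_PiE)
  then show ?thesis
    by (rule finite_subset[rotated]) (use tuples_closed[OF i] in blast)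
qed

lemma class_vector_nf_space: "class_vector d \<in> nf_space"
  unfolding class_vector_def
  by (intro nf_space_sum) (auto intro!: nf_space_sum nf_space_single basis_keysI permutes_id tuples_closed
      simp del: carrier_product_group)

lemma lookup_class_vector:
  assumes fin: "finite (supp d)" and \<alpha>: "\<alpha> \<in> {1..n} \<rightarrow>\<^sub>E UNIV" and g: "g \<in> carrier P"
  shows "lookup (class_vector d) (\<alpha>, g, w) = (if w = id then d (tuple_index g) \<alpha> else 0)"
proof -
  have inner: "(\<Sum>g'\<in>tuples i. lookup (single (\<beta>, g', id) (d i \<beta>)) (\<alpha>, g, w)) =
      (if w = id \<and> (i, \<beta>) = (tuple_index g, \<alpha>) then d i \<beta> else 0)" if i: "i \<in> indices" for i \<beta>
  proof -
    have "(\<Sum>g'\<in>tuples i. lookup (single (\<beta>, g', id) (d i \<beta>)) (\<alpha>, g, w)) =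
        (\<Sum>g'\<in>tuples i. if g' = g then (if \<beta> = \<alpha> \<and> w = id then d i \<beta> else 0) else 0)"
      by (rule sum.cong) (auto simp: lookup_single when_def)
    also have "\<dots> = (if g \<in> tuples i then (if \<beta> = \<alpha> \<and> w = id then d i \<beta> else 0) else 0)"
      by (rule sum.delta[OF finite_tuples[OF i]])
    finally show ?thesis
      using tuples_iff[OF i g] by auto
  qed
  have "lookup (class_vector d) (\<alpha>, g, w) =
      (\<Sum>(i, \<beta>)\<in>supp d. if w = id \<and> (i, \<beta>) = (tuple_index g, \<alpha>) then d i \<beta> else 0)"
    unfolding class_vector_def lookup_sum
  proof (rule sum.cong[OF refl])
    fix x assume "x \<in> supp d"
    then obtain i \<beta> where x: "x = (i, \<beta>)" "i \<in> indices"
      by blast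
    show "lookup (case x of (i, \<alpha>) \<Rightarrow> \<Sum>g\<in>tuples i. single (\<alpha>, g, id) (d i \<alpha>)) (\<alpha>, g, w) =
      (case x of (i, \<beta>) \<Rightarrow> if w = id \<and> (i, \<beta>) = (tuple_index g, \<alpha>) then d i \<beta> else 0)"
      unfolding x(1) prod.case lookup_sum by (rule inner[OF x(2)])
  qed
  also have "\<dots> = (\<Sum>x\<in>supp d. if x = (tuple_index g, \<alpha>) then (if w = id then d (tuple_index g) \<alpha> else 0) else 0)"
    by (rule sum.cong) (auto split: if_splits)
  also have "\<dots> = (if (tuple_index g, \<alpha>) \<in> supp d then (if w = id then d (tuple_index g) \<alpha> else 0) else 0)"
    by (rule sum.delta[OF fin])
  also have "\<dots> = (if w = id then d (tuple_index g) \<alpha> else 0)"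
    using \<alpha> tuple_index_closed[OF g] by auto
  finally show ?thesis .
qed

lemma class_vector_eqI:
  assumes fin: "finite (supp d)" and v: "v \<in> nf_space"
    and eq: "\<And>\<alpha> g w. \<alpha> \<in> {1..n} \<rightarrow>\<^sub>E UNIV \<Longrightarrow> g \<in> carrier P \<Longrightarrow>
      lookup v (\<alpha>, g, w) = (if w = id then d (tuple_index g) \<alpha> else 0)"
  shows "v = class_vector d"
proof (rule poly_mapping_eqI)
  fix k
  show "lookup v k = lookup (class_vector d) k"
  proof (cases "k \<in> basis_keys")
    case True
    then obtain \<alpha> g w where "k = (\<alpha>, g, w)" "\<alpha> \<in> {1..n} \<rightarrow>\<^sub>E UNIV" "g \<in> carrier P"
      by (rule basis_keysE)
    then show ?thesis
      using eq lookup_class_vector[OF fin] by simp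
  next
    case False
    then have "k \<notin> keys v" "k \<notin> keys (class_vector d)"
      using v class_vector_nf_space[of d] by (auto simp: nf_space_def)
    then show ?thesis by (simp add: in_keys_iff)
  qed
qed

abbreviation symmetric_coeffs :: "((nat \<Rightarrow> nat) \<Rightarrow> (nat \<Rightarrow> nat) \<Rightarrow> 'f::field) \<Rightarrow> bool" where
  "symmetric_coeffs d \<equiv> \<forall>w i \<alpha>. w permutes {1..n} \<longrightarrow> i \<in> indices \<longrightarrow> \<alpha> \<in> {1..n} \<rightarrow>\<^sub>E UNIV \<longrightarrow>
    d (perm_tuple n w i) (perm_tuple n w \<alpha>) = d i \<alpha>"

text \<open>The coefficient at \<open>(\<alpha>, g, id)\<close> is \<open>d (tuple_index g) \<alpha>\<close>, and the class of a tuple is unchanged by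
  conjugation and permuted along with the tuple.\<close>

lemma invariant_class_vector:
  assumes fin: "finite (supp d)" and sym: "symmetric_coeffs d"
  shows "invariant (class_vector d)"
proof -
  let ?v = "class_vector d"
  have id: "snd (snd k) = id" if k: "k \<in> keys ?v" for k
  proof -
    have "k \<in> basis_keys"
      using k class_vector_nf_space[of d] by (auto simp: nf_space_def)
    then obtain \<alpha> g w where "k = (\<alpha>, g, w)" "\<alpha> \<in> {1..n} \<rightarrow>\<^sub>E UNIV" "g \<in> carrier P"
      by (rule basis_keysE)
    then show ?thesis
      using k lookup_class_vector[OF fin, of \<alpha> g w] by (auto simp: in_keys_iff split: if_splits)
  qed
  have conj: "lookup ?v (\<alpha>, h \<otimes>\<^bsub>P\<^esub> g \<otimes>\<^bsub>P\<^esub> inv\<^bsub>P\<^esub> h, id) = lookup ?v (\<alpha>, g, id)"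
    if g: "g \<in> carrier P" and h: "h \<in> carrier P" for \<alpha> g h
  proof (cases "\<alpha> \<in> {1..n} \<rightarrow>\<^sub>E (UNIV :: nat set)")
    case True
    have "h \<otimes>\<^bsub>P\<^esub> g \<otimes>\<^bsub>P\<^esub> inv\<^bsub>P\<^esub> h \<in> carrier P"
      using g h by (intro P.m_closed P.inv_closed)
    then show ?thesis
      using lookup_class_vector[OF fin True] tuple_index_conj[OF g h] g by metis
  next
    case False
    then have "(\<alpha>, b, id) \<notin> keys ?v" for b
      using class_vector_nf_space[of d] by (auto simp: nf_space_def basis_keys_def simp del: PiE_iff)
    then show ?thesis
      by (simp add: in_keys_iff)
  qed
  have "lookup ?v (\<alpha> \<circ> adj i, g \<circ> adj i, id) = lookup ?v (\<alpha>, g, id)"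
    if \<alpha>: "\<alpha> \<in> {1..n} \<rightarrow>\<^sub>E UNIV" and g: "g \<in> carrier P" and i: "i \<in> {1..<n}" for \<alpha> g i
  proof -
    have adj: "adj i permutes {1..n}"
      using i by (intro permutes_swap_id) auto
    have "d (tuple_index g \<circ> adj i) (\<alpha> \<circ> adj i) = d (tuple_index g) \<alpha>"
      using sym adj \<alpha> tuple_index_closed[OF g]
        perm_tuple_adj[OF i \<alpha>] perm_tuple_adj[OF i tuple_index_closed[OF g]] by metis
    then show ?thesis
      using lookup_class_vector[OF fin comp_adj_ext[OF i \<alpha>] comp_adj_closed[OF i g], of id]
        lookup_class_vector[OF fin \<alpha> g, of id]
      by (simp add: tuple_index_adj[OF i])
  qed
  then show ?thesis
    unfolding invariant_def using class_vector_nf_space id conj by blast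
qed

text \<open>The coefficients are read off at representatives. Choosing representatives componentwise makes the
  choice compatible with permutations, so the coefficients inherit the symmetry exactly.\<close>

lemma invariant_imp_class_vector:
  assumes inv: "invariant v"
  obtains d where "finite (supp d)" "symmetric_coeffs d" "v = class_vector d"
proof -
  define d where "d = (\<lambda>i \<alpha>. lookup v (\<alpha>, representative i, id))"
  have v: "v \<in> nf_space"
    using inv by (simp add: invariant_def)
  have "supp d \<subseteq> (\<lambda>k. (tuple_index (fst (snd k)), fst k)) ` keys v"
  proof clarify
    fix i \<alpha> assume i: "i \<in> indices" and d: "d i \<alpha> \<noteq> 0"
    then have "(\<alpha>, representative i, id) \<in> keys v"
      by (simp add: d_def in_keys_iff)
    moreover have "(i, \<alpha>) = (\<lambda>k. (tuple_index (fst (snd k)), fst k)) (\<alpha>, representative i, id)"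
      by (simp add: tuple_index_representative[OF i])
    ultimately show "(i, \<alpha>) \<in> (\<lambda>k. (tuple_index (fst (snd k)), fst k)) ` keys v"
      by (rule rev_image_eqI)
  qed
  then have fin: "finite (supp d)"
    by (rule finite_subset) simp
  have sym: "symmetric_coeffs d"
  proof (intro allI impI)
    fix w i \<alpha>
    assume w: "w permutes {1..n}" and i: "i \<in> indices" and \<alpha>: "\<alpha> \<in> {1..n} \<rightarrow>\<^sub>E (UNIV :: nat set)"
    show "d (perm_tuple n w i) (perm_tuple n w \<alpha>) = d i \<alpha>"
      unfolding d_def representative_perm[OF w]
      by (rule invariant_perm[OF inv w \<alpha> representative_closed[OF i]])
  qed
  have "v = class_vector d"
  proof (rule class_vector_eqI[OF fin v])
    fix \<alpha> g w
    assume g: "g \<in> carrier P"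
    show "lookup v (\<alpha>, g, w) = (if w = id then d (tuple_index g) \<alpha> else 0)"
    proof (cases "w = id")
      case True
      obtain h where "h \<in> carrier P" "representative (tuple_index g) = h \<otimes>\<^bsub>P\<^esub> g \<otimes>\<^bsub>P\<^esub> inv\<^bsub>P\<^esub> h"
        using conj_representative[OF g] by blast
      then show ?thesis
        using inv g True unfolding invariant_def d_def by simp
    next
      case False
      then have "(\<alpha>, g, w) \<notin> keys v"
        using inv by (force simp: invariant_def)
      then show ?thesis
        using False by (simp add: in_keys_iff)
    qed
  qed
  with fin sym show thesis
    by (rule that)
qed

lemma class_class_vector:
  fixes d :: "(nat \<Rightarrow> nat) \<Rightarrow> (nat \<Rightarrow> nat) \<Rightarrow> 'f::field"
  assumes fin: "finite (supp d)"
  shows "hecke_class G n (lin normal_form (class_vector d)) =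
    finsum H (\<lambda>(i, \<alpha>). hecke_scalar G n (d i \<alpha>) \<otimes>\<^bsub>H\<^esub> (hecke_xpow G n \<alpha> \<otimes>\<^bsub>H\<^esub> hecke_class_sum G n C i)) (supp d)"
proof -
  interpret H: ring "H :: ('g, 'f) free_hecke set ring"
    by (rule ring_wreath_Hecke[OF is_group])
  let ?f = "\<lambda>i \<alpha>. scalar (d i \<alpha>) * (xpow \<alpha> * (\<Sum>g\<in>tuples i. gL g))"
  have gF: "gL g \<in> F" if "i \<in> indices" "g \<in> tuples i" for i g
    using tuples_closed[OF that] by (rule gens_closed(1))
  have sF: "(\<Sum>g\<in>tuples i. gL g) \<in> F" if "i \<in> indices" for i
    using that by (intro sum_free_algebra gF)
  have fF: "?f i \<alpha> \<in> F" if "i \<in> indices" for i \<alpha>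
    by (intro times_free_algebra scalar_free_algebra xpow_F sF that)
  have cls: "hecke_class G n (?f i \<alpha>) =
      hecke_scalar G n (d i \<alpha>) \<otimes>\<^bsub>H\<^esub> (hecke_xpow G n \<alpha> \<otimes>\<^bsub>H\<^esub> hecke_class_sum G n C i)"
    if i: "i \<in> indices" for i \<alpha>
  proof -
    have sum: "hecke_class G n (\<Sum>g\<in>tuples i. gL g) = hecke_class_sum G n C i"
      unfolding hecke_class_sum_def by (rule class_sum[OF finite_tuples[OF i] gF[OF i]])
    show ?thesis
      by (simp add: sum class_mult sF[OF i] hecke_scalar_def class_xpow)
  qed
  have nf: "lin normal_form (\<Sum>g\<in>tuples i. single (\<alpha>, g, id) (d i \<alpha>)) \<approx>\<^sub>H ?f i \<alpha>" if i: "i \<in> indices" for i \<alpha>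
  proof -
    have "lin normal_form (\<Sum>g\<in>tuples i. single (\<alpha>, g, id) (d i \<alpha>)) =
        (\<Sum>g\<in>tuples i. scale (d i \<alpha>) (normal_form (\<alpha>, g, id)))"
      by (simp add: lin_sum)
    also have "\<dots> \<approx>\<^sub>H (\<Sum>g\<in>tuples i. scale (d i \<alpha>) (xpow \<alpha> * gL g))"
      by (intro hcong_sum hcong_scale normal_form_id tuples_closed[OF i])
    also have "\<dots> = ?f i \<alpha>"
      by (simp add: scale_eq_mult scalar_def sum_distrib_left)
    finally show ?thesis .
  qed
  have lin_eq: "lin normal_form (class_vector d) =
      (\<Sum>(i, \<alpha>)\<in>supp d. lin normal_form (\<Sum>g\<in>tuples i. single (\<alpha>, g, id) (d i \<alpha>)))"
    unfolding class_vector_def lin_sum by (rule sum.cong) (auto simp: lin_sum)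
  have cong: "lin normal_form (class_vector d) \<approx>\<^sub>H (\<Sum>(i, \<alpha>)\<in>supp d. ?f i \<alpha>)"
    unfolding lin_eq by (rule hcong_sum) (use nf in auto)
  have "hecke_class G n (lin normal_form (class_vector d)) = hecke_class G n (\<Sum>(i, \<alpha>)\<in>supp d. ?f i \<alpha>)"
    using cong class_eq_iff[OF hcong_F[OF cong]] by blast
  also have "\<dots> = finsum H (\<lambda>x. hecke_class G n (case x of (i, \<alpha>) \<Rightarrow> ?f i \<alpha>)) (supp d)"
    by (rule class_sum[OF fin]) (use fF in auto)
  also have "\<dots> = finsum H (\<lambda>(i, \<alpha>). hecke_scalar G n (d i \<alpha>) \<otimes>\<^bsub>H\<^esub>
      (hecke_xpow G n \<alpha> \<otimes>\<^bsub>H\<^esub> hecke_class_sum G n C i)) (supp d)"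
  proof (rule H.finsum_cong')
    show "(\<lambda>(i, \<alpha>). hecke_scalar G n (d i \<alpha>) \<otimes>\<^bsub>H\<^esub> (hecke_xpow G n \<alpha> \<otimes>\<^bsub>H\<^esub> hecke_class_sum G n C i))
      \<in> supp d \<rightarrow> carrier H"
      using class_closed[OF fF] cls by auto
  qed (use cls in auto)
  finally show ?thesis .
qed

theorem ring_center_wreath_Hecke:
  "ring_center (H :: ('g, 'f::field) free_hecke set ring) =
    {z. \<exists>d :: (nat \<Rightarrow> nat) \<Rightarrow> (nat \<Rightarrow> nat) \<Rightarrow> 'f. finite (supp d) \<and> symmetric_coeffs d \<and>
    z = finsum H (\<lambda>(i, \<alpha>). hecke_scalar G n (d i \<alpha>) \<otimes>\<^bsub>H\<^esub>
      (hecke_xpow G n \<alpha> \<otimes>\<^bsub>H\<^esub> hecke_class_sum G n C i)) (supp d)}"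
  (is "_ = ?R")
proof (intro equalityI subsetI)
  fix z :: "('g, 'f) free_hecke set" assume "z \<in> ring_center H"
  then obtain p where p: "central p" "z = hecke_class G n p"
    by (auto simp: ring_center_eq)
  have pF: "p \<in> F"
    using p(1) by (simp add: central_def)
  obtain d where d: "finite (supp d)" "symmetric_coeffs d" "hact p vac = class_vector d"
    using central_imp_invariant[OF p(1)] by (rule invariant_imp_class_vector)
  have "z = hecke_class G n (lin normal_form (class_vector d))"
    using hecke_normal_form[OF pF] class_eq_iff[OF hcong_F[OF hecke_normal_form[OF pF]]]
    unfolding p(2) d(3) by blast
  then show "z \<in> ?R"
    unfolding class_class_vector[OF d(1)] using d(1,2) by blast
next
  fix z :: "('g, 'f) free_hecke set" assume "z \<in> ?R"
  then obtain d where d: "finite (supp d)" "symmetric_coeffs d"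
    "z = hecke_class G n (lin normal_form (class_vector d))"
    using class_class_vector by blast
  then show "z \<in> ring_center H"
    using invariant_imp_central[OF invariant_class_vector[OF d(1,2)]] by (auto simp: ring_center_eq)
qed

end

theorem theorem2p10:
  fixes G :: "('g, 'm) monoid_scheme" and n s :: nat and C :: "nat \<Rightarrow> 'g set"
  assumes "group G" and "finite (carrier G)" and "n \<ge> 1"
    and "bij_betw C {1..s} (conj_classes G)"
  shows "ring_center (wreath_Hecke G n :: ('g, 'f::alg_closed_field) free_hecke set ring) =
    {z. \<exists>d :: (nat \<Rightarrow> nat) \<Rightarrow> (nat \<Rightarrow> nat) \<Rightarrow> 'f.
      finite {(i, \<alpha>) \<in> ({1..n} \<rightarrow>\<^sub>E {1..s}) \<times> ({1..n} \<rightarrow>\<^sub>E UNIV). d i \<alpha> \<noteq> 0} \<and>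
      (\<forall>w i \<alpha>. w permutes {1..n} \<longrightarrow> i \<in> {1..n} \<rightarrow>\<^sub>E {1..s} \<longrightarrow> \<alpha> \<in> {1..n} \<rightarrow>\<^sub>E UNIV \<longrightarrow>
        d (perm_tuple n w i) (perm_tuple n w \<alpha>) = d i \<alpha>) \<and>
      z = finsum (wreath_Hecke G n)
        (\<lambda>(i, \<alpha>). hecke_scalar G n (d i \<alpha>) \<otimes>\<^bsub>wreath_Hecke G n\<^esub>
          (hecke_xpow G n \<alpha> \<otimes>\<^bsub>wreath_Hecke G n\<^esub> hecke_class_sum G n C i))
        {(i, \<alpha>) \<in> ({1..n} \<rightarrow>\<^sub>E {1..s}) \<times> ({1..n} \<rightarrow>\<^sub>E UNIV). d i \<alpha> \<noteq> 0}}"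
proof -
  interpret wreath_classes G n s C
    using assms by (simp add: wreath_classes_def wreath_data_def wreath_data_axioms_def wreath_classes_axioms_def)
  show ?thesis
    by (rule ring_center_wreath_Hecke)
qed

end
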